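(* Let $\mathcal I\subset[0,1]$ be a compact set satisfying $\dim_{\mathcal H}(\mathcal I)=\dim_{u\text{-}box}(\mathcal I)>0$, let $\alpha>0$ and let $\eta\in(0,\dim_{\mathcal H}(\mathcal I))$. Assume that the regularity $r(\psi)$ of the wavelet $\psi$ is greater than $\alpha\frac{\dim_{\mathcal H}(\mathcal I)}{\eta}+1$. If $f$ is the lacunary wavelet series on $\mathcal I$ of parameters $(\alpha,\eta)$, then almost surely $$\dim_{\mathcal H}\{x\in[0,1]:h_f(x)\le h\}=\frac{\eta}{\alpha}h\qquad\text{for all }h\in\left[\alpha,\alpha\frac{\dim_{\mathcal H}(\mathcal I)}{\eta}\right],$$ where $h_f(x)$ denotes the pointwise Hölder exponent of $f$ at $x$.
   Context: $\dim_{\mathcal H}$ is the Hausdorff dimension. The upper-box dimension of $\mathcal I\subset\mathbb R$ is $\dim_{u\text{-}box}(\mathcal I)=\limsup_{r\to0}\frac{\log N(r)}{-\log r}$, where $N(r)$ is the smallest number of intervals of length $r$ which can cover $\mathcal I$. Wavelets: $\varphi,\psi:\mathbb R\to\mathbb R$ are functions such that $\{\varphi(\cdot-k):k\in\mathbb Z\}\cup\{2^{j/2}\psi(2^j\cdot-k):j\in\mathbb N,k\in\mathbb Z\}$ is an orthonormal basis of $L^2(\mathbb R)$ ($\mathbb N$ includes $0$). The wavelet basis is $r$-smooth, with $r=r(\psi)$ called the regularity of the wavelet, if $\varphi$ and $\psi$ have derivatives up to order $r$ and these derivatives have fast decay; in this case $\psi$ has a corresponding number of vanishing moments. Lacunary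 wavelet series: for $j\ge0$ let $\mathcal I_j=\{k\in\{0,\dots,2^j-1\}:[k2^{-j},(k+1)2^{-j})\cap\mathcal I\ne\emptyset\}$, and let $(\xi_{j,k})_{j,k}$ be independent Bernoulli random variables with $\mathbb P(\xi_{j,k}=1)=2^{(\eta-\dim_{\mathcal H}(\mathcal I))j}$. The lacunary wavelet series on $\mathcal I$ of parameters $(\alpha,\eta)$ is the random function $$f=\sum_{j\ge0}\sum_{k\in\mathcal I_j}2^{-\alpha j}\xi_{j,k}\,\psi(2^j\cdot-k).$$ Hölder exponent: for $x_0\in\mathbb R$ and $h>0$, a locally bounded function $f:\mathbb R\to\mathbb R$ belongs to $\mathcal C^h(x_0)$ if there exist $C>0$ and a polynomial $P_{x_0}$ of degree at most $\lfloor h\rfloor$ such that $|f(x)-P_{x_0}(x)|\le C|x-x_0|^h$ on a neighborhood of $x_0$. The pointwise Hölder exponent is $h_f(x_0)=\sup\{h>0:f\in\mathcal C^h(x_0)\}$ (equal to $0$ if this set is empty). *)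

theory Defs
  imports
    "HOL-Probability.Probability"
    "HOL-Computational_Algebra.Polynomial"
begin

section \<open>Dimensions of sets\<close>

text \<open>
  The \<open>s\<close>-th power of the diameter, with the usual conventions: the empty set contributes
  \<open>0\<close>, and every nonempty set contributes \<open>1\<close> when \<open>s = 0\<close> (in HOL, \<open>0 powr 0 = 0\<close>).
\<close>

definition diam_power :: "real \<Rightarrow> 'a::metric_space set \<Rightarrow> real" where
  "diam_power s U = (if U = {} then 0 else if s = 0 then 1 else diameter U powr s)"

text \<open>Boundedness is required because \<^const>\<open>diameter\<close> is meaningless on unbounded sets.\<close>

definition hausdorff_premeasure :: "real \<Rightarrow> real \<Rightarrow> 'a::metric_space set \<Rightarrow> ennreal" where
  "hausdorff_premeasure s \<delta> A =
     (INF U \<in> {U :: nat \<Rightarrow> 'a set. A \<subseteq> (\<Union>i. U i) \<and> (\<forall>i. bounded (U i) \<and> diameter (U i) \<le> \<delta>)}.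
        \<Sum>i. ennreal (diam_power s (U i)))"

definition hausdorff_measure :: "real \<Rightarrow> 'a::metric_space set \<Rightarrow> ennreal" where
  "hausdorff_measure s A = (SUP \<delta> \<in> {0<..}. hausdorff_premeasure s \<delta> A)"

text \<open>
  For subsets of the real line every \<open>s > 1\<close> belongs to the set below, so the infimum
  can be taken in the reals. The empty set has dimension \<open>0\<close>.
\<close>

definition hausdorff_dim :: "real set \<Rightarrow> real" where
  "hausdorff_dim A = Inf {s. 0 \<le> s \<and> hausdorff_measure s A = 0}"

text \<open>
  Closed intervals suffice: the closure of an interval of length \<open>r\<close> is again one.
  Meaningful for bounded \<open>A\<close> and \<open>r > 0\<close>, when a finite cover exists.
\<close>

definition covering_number :: "real set \<Rightarrow> real \<Rightarrow> nat" where
  "covering_number A r =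
     (LEAST n. \<exists>C. finite C \<and> card C = n \<and> A \<subseteq> (\<Union>a\<in>C. {a..a + r}))"

definition upper_box_dim :: "real set \<Rightarrow> ereal" where
  "upper_box_dim A =
     Limsup (at_right 0) (\<lambda>r. ereal (ln (real (covering_number A r)) / - ln r))"


section \<open>Wavelet bases\<close>

definition square_integrable :: "(real \<Rightarrow> real) \<Rightarrow> bool" where
  "square_integrable f \<longleftrightarrow> f \<in> borel_measurable lborel \<and> integrable lborel (\<lambda>x. (f x)\<^sup>2)"

text \<open>
  An orthonormal family whose finite linear combinations are dense in \<open>L\<^sup>2\<close>.
  Restricting to Borel functions is harmless, since every class in \<open>L\<^sup>2\<close> has a Borel
  representative.
\<close>

definition L2_orthonormal_basis :: "('i \<Rightarrow> real \<Rightarrow> real) \<Rightarrow> bool" where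
  "L2_orthonormal_basis e \<longleftrightarrow>
     (\<forall>i. square_integrable (e i)) \<and>
     (\<forall>i i'. (\<integral>x. e i x * e i' x \<partial>lborel) = (if i = i' then 1 else 0)) \<and>
     (\<forall>f. square_integrable f \<longrightarrow>
        (\<forall>\<epsilon>>0. \<exists>J c. finite J \<and>
           sqrt (\<integral>x. (f x - (\<Sum>i\<in>J. c i * e i x))\<^sup>2 \<partial>lborel) < \<epsilon>))"

fun wavelet_system ::
  "(real \<Rightarrow> real) \<Rightarrow> (real \<Rightarrow> real) \<Rightarrow> int + nat \<times> int \<Rightarrow> real \<Rightarrow> real" where
  "wavelet_system \<phi> \<psi> (Inl k) = (\<lambda>x. \<phi> (x - of_int k))"
| "wavelet_system \<phi> \<psi> (Inr (j, k)) = (\<lambda>x. 2 powr (real j / 2) * \<psi> (2 ^ j * x - of_int k))"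

definition wavelet_basis :: "(real \<Rightarrow> real) \<Rightarrow> (real \<Rightarrow> real) \<Rightarrow> bool" where
  "wavelet_basis \<phi> \<psi> \<longleftrightarrow> L2_orthonormal_basis (wavelet_system \<phi> \<psi>)"

definition fast_decay :: "(real \<Rightarrow> real) \<Rightarrow> bool" where
  "fast_decay u \<longleftrightarrow> (\<forall>N::nat. \<exists>C. \<forall>x. \<bar>u x\<bar> \<le> C / (1 + \<bar>x\<bar>) ^ N)"

definition smooth_fast_decay :: "nat \<Rightarrow> (real \<Rightarrow> real) \<Rightarrow> bool" where
  "smooth_fast_decay r g \<longleftrightarrow>
     (\<forall>s<r. \<forall>x. (deriv ^^ s) g field_differentiable at x) \<and>
     (\<forall>s\<le>r. fast_decay ((deriv ^^ s) g))"

text \<open>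
  The vanishing moments of \<open>\<psi>\<close> follow from smoothness, decay and orthonormality,
  hence they are not part of the definition.
\<close>

definition smooth_wavelet_basis :: "nat \<Rightarrow> (real \<Rightarrow> real) \<Rightarrow> (real \<Rightarrow> real) \<Rightarrow> bool" where
  "smooth_wavelet_basis r \<phi> \<psi> \<longleftrightarrow>
     wavelet_basis \<phi> \<psi> \<and> smooth_fast_decay r \<phi> \<and> smooth_fast_decay r \<psi>"


section \<open>Lacunary wavelet series\<close>

definition dyadic_indices :: "real set \<Rightarrow> nat \<Rightarrow> nat set" where
  "dyadic_indices I j =
     {k. k < 2 ^ j \<and> {real k / 2 ^ j ..< (real k + 1) / 2 ^ j} \<inter> I \<noteq> {}}"

text \<open>Only the variables that occur in the series are constrained.\<close>

definition lacunary_coefficients ::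
  "'w measure \<Rightarrow> real set \<Rightarrow> real \<Rightarrow> (nat \<Rightarrow> nat \<Rightarrow> 'w \<Rightarrow> bool) \<Rightarrow> bool" where
  "lacunary_coefficients M I \<eta> \<xi> \<longleftrightarrow>
     prob_space.indep_vars M (\<lambda>_. count_space UNIV) (\<lambda>(j, k). \<xi> j k)
       (SIGMA j:UNIV. dyadic_indices I j) \<and>
     (\<forall>j. \<forall>k\<in>dyadic_indices I j.
        distr M (count_space UNIV) (\<xi> j k) =
          measure_pmf (bernoulli_pmf (2 powr ((\<eta> - hausdorff_dim I) * real j))))"

definition lacunary_wavelet_series ::
  "(real \<Rightarrow> real) \<Rightarrow> real set \<Rightarrow> real \<Rightarrow> (nat \<Rightarrow> nat \<Rightarrow> 'w \<Rightarrow> bool) \<Rightarrow> 'w \<Rightarrow> real \<Rightarrow> real" where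
  "lacunary_wavelet_series \<psi> I \<alpha> \<xi> \<omega> x =
     (\<Sum>j. \<Sum>k\<in>dyadic_indices I j.
        2 powr (- \<alpha> * real j) * of_bool (\<xi> j k \<omega>) * \<psi> (2 ^ j * x - real k))"


section \<open>Pointwise regularity\<close>

definition locally_bounded :: "(real \<Rightarrow> real) \<Rightarrow> bool" where
  "locally_bounded f \<longleftrightarrow> (\<forall>x. \<exists>U. open U \<and> x \<in> U \<and> bounded (f ` U))"

definition pointwise_holder_space :: "real \<Rightarrow> real \<Rightarrow> (real \<Rightarrow> real) set" where
  "pointwise_holder_space h x0 =
     {f. locally_bounded f \<and>
         (\<exists>C>0. \<exists>P :: real poly. degree P \<le> nat \<lfloor>h\<rfloor> \<and>
            (\<forall>\<^sub>F x in nhds x0. \<bar>f x - poly P x\<bar> \<le> C * \<bar>x - x0\<bar> powr h))}"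

definition holder_exponent :: "(real \<Rightarrow> real) \<Rightarrow> real \<Rightarrow> ereal" where
  "holder_exponent f x0 = Sup (insert 0 (ereal ` {h. 0 < h \<and> f \<in> pointwise_holder_space h x0}))"

end

theory Submission
  imports Defs "HOL-Real_Asymp.Real_Asymp"
begin

text \<open>
  Whether \<open>h\<^sub>f(x) \<le> h\<close> is decided by how well \<open>x\<close> is approximated by the dyadic points
  \<open>k2\<^bsup>-j\<^esup>\<close> carrying a nonzero coefficient: with \<open>\<delta> = \<alpha>/h\<close> the set in question is, up to an
  arbitrarily small change of \<open>\<delta>\<close>, the limsup set of the balls \<open>B(k2\<^bsup>-j\<^esup>, 2\<^bsup>-\<delta>j\<^esup>)\<close>. If \<open>x\<close> avoids these
  balls, Taylor expansion of the individual scales shows that \<open>f\<close> is regular at \<open>x\<close>; if \<open>x\<close> lies in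
  infinitely many of them, the vanishing moments of \<open>\<psi>\<close> bound the coefficients of a regular function and
  give the converse. There are about \<open>2\<^bsup>\<eta>j\<^esup>\<close> balls of scale \<open>j\<close>, so the limsup set has
  dimension at most \<open>\<eta>/\<delta>\<close>.

  For the lower bound take a Frostman measure \<open>\<mu>\<close> on \<open>I\<close> of exponent \<open>s\<close> close to the dimension. The
  masses \<open>\<mu>\<close> of the selected intervals of generation \<open>j\<close>, divided by the selection probability, form a
  sum of independent variables whose exponential moments show that almost surely, for all large \<open>j\<close>, they
  reproduce \<open>\<mu>\<close> up to constants on all larger dyadic intervals. Moving this mass to the surrounding
  dyadic intervals of length \<open>2\<^bsup>-\<delta>j\<^esup>\<close>, and iterating inside these along a rapidly increasing
  sequence of generations, yields a Cantor subset of the limsup set that carries a measure of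
  exponent \<open>t\<close>, for any \<open>t < \<eta>/\<delta>\<close>. Since \<open>I\<close> need not be Ahlfors regular, the equality with the upper
  box dimension is what allows one to discard the intervals of atypically small \<open>\<mu>\<close>-measure.
\<close>

section \<open>Hausdorff measures and box counting\<close>

text \<open>No measure on the line is ever built. The Frostman measure, the random masses and the
  Cantor measure are nonnegative weights on the dyadic tree; compactness reduces a countable cover
  of the Cantor set to finitely many dyadic intervals, whose masses are added at a single level. The
  delicate point is that the selected masses resemble \<open>\<mu>\<close> only down to a certain
  scale: below it a single atom, inflated by the inverse selection probability, dominates. Hence the
  upper bound on random masses has two terms, \<open>2 powr (- s * real l)\<close> where the average
  governs and \<open>2 powr (- \<beta> * real j)\<close> for the atoms. Upper bounds lose a factor 4
  and lower bounds a factor 8, which would multiply at every refinement. The factor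
  \<open>32\<close> in \<open>admissible\<close> pays for them in advance, and it is earned back
  because \<open>s\<close> and \<open>\<beta>\<close> leave room above \<open>t\<close>. The
  exceptional null set has to serve all \<open>h\<close> at once. The random statements are
  therefore made for countably many parameters, and for the lower bound each \<open>h\<close> is
  given rational ones satisfying the inequalities needed.\<close>

lemma hausdorff_measure_eq_0_iff:
  "hausdorff_measure s A = 0 \<longleftrightarrow> (\<forall>\<delta>>0. hausdorff_premeasure s \<delta> A = 0)"
proof -
  have "hausdorff_measure s A \<le> 0 \<longleftrightarrow> (\<forall>\<delta>>0. hausdorff_premeasure s \<delta> A \<le> 0)"
    unfolding hausdorff_measure_def SUP_le_iff by auto
  then show ?thesis by simp
qed

lemma hausdorff_premeasure_less_iff:
  "hausdorff_premeasure s \<delta> A < e \<longleftrightarrow>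
     (\<exists>U :: nat \<Rightarrow> 'a::metric_space set. A \<subseteq> (\<Union>i. U i) \<and> (\<forall>i. bounded (U i) \<and> diameter (U i) \<le> \<delta>)
        \<and> (\<Sum>i. ennreal (diam_power s (U i))) < e)"
  unfolding hausdorff_premeasure_def Inf_less_iff by auto

lemma diam_power_nonneg [simp]: "0 \<le> diam_power s U"
  by (simp add: diam_power_def)

lemma diam_power_empty [simp]: "diam_power s {} = 0"
  by (simp add: diam_power_def)

lemma le_suminf_ennreal: "f i \<le> (\<Sum>i. f i)" for f :: "nat \<Rightarrow> ennreal"
  using sum_le_suminf[of f "{i}"] by (simp add: summableI)

text \<open>When \<open>s > 0\<close>, a cover of small total cost consists of small sets: each
  single term is below the sum, so the diameter constraint of the premeasure comes for free.\<close>

lemma hausdorff_measure_eq_0I: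
  assumes s: "s > 0"
    and cov: "\<And>e. e > 0 \<Longrightarrow> \<exists>U :: nat \<Rightarrow> 'a::metric_space set. A \<subseteq> (\<Union>i. U i) \<and> (\<forall>i. bounded (U i)) \<and>
      (\<Sum>i. ennreal (diam_power s (U i))) < ennreal e"
  shows "hausdorff_measure s A = 0"
  unfolding hausdorff_measure_eq_0_iff
proof (intro allI impI)
  fix \<delta> :: real assume \<delta>: "\<delta> > 0"
  show "hausdorff_premeasure s \<delta> A = 0"
  proof (rule ccontr)
    assume "hausdorff_premeasure s \<delta> A \<noteq> 0"
    then have pos: "0 < hausdorff_premeasure s \<delta> A" by (simp add: zero_less_iff_neq_zero)
    obtain e0 where e0: "0 < e0" "ennreal e0 \<le> hausdorff_premeasure s \<delta> A"
    proof (cases "hausdorff_premeasure s \<delta> A")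
      case (real r)
      then show ?thesis using pos that[of r] by (auto simp: ennreal_less_zero_iff)
    next
      case top
      then show ?thesis using that[of 1] by auto
    qed
    \<comment> \<open>The bound \<open>\<delta> powr s\<close> keeps every diameter below
      \<open>\<delta>\<close>; \<open>e0\<close> is a finite positive lower bound even if the
      premeasure is infinite.\<close>
    define e where "e = min e0 (\<delta> powr s)"
    have e: "e > 0" using e0 \<delta> by (auto simp: e_def)
    obtain U :: "nat \<Rightarrow> 'a set" where U: "A \<subseteq> (\<Union>i. U i)" "\<And>i. bounded (U i)"
        "(\<Sum>i. ennreal (diam_power s (U i))) < ennreal e"
      using cov[OF e] by blast
    have "diameter (U i) \<le> \<delta>" for i
    proof (cases "U i = {}")
      case True
      then have "diameter (U i) = 0" by (simp only: diameter_empty)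
      then show ?thesis using \<delta> by linarith
    next
      case False
      have "ennreal (diam_power s (U i)) \<le> (\<Sum>i. ennreal (diam_power s (U i)))"
        by (rule le_suminf_ennreal)
      also note U(3)
      finally have "diam_power s (U i) < e" by (simp add: ennreal_less_iff)
      then have "diameter (U i) powr s < \<delta> powr s"
        using False s by (simp add: diam_power_def e_def)
      then show ?thesis
        using s \<delta> powr_mono2[of s \<delta> "diameter (U i)"] by linarith
    qed
    then have "hausdorff_premeasure s \<delta> A < ennreal e"
      unfolding hausdorff_premeasure_less_iff using U by blast
    also have "ennreal e \<le> ennreal e0" by (simp add: e_def ennreal_leI)
    finally show False using e0 by simp
  qed
qed

lemma hausdorff_measure_eq_0_mono:
  assumes "hausdorff_measure s A = 0" "0 \<le> s" "s \<le> t"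
  shows "hausdorff_measure t (A :: 'a::metric_space set) = 0"
proof (cases "s = t")
  case False
  then have t: "s < t" "0 < t" using assms by auto
  show ?thesis
  proof (rule hausdorff_measure_eq_0I[OF t(2)])
    fix e :: real assume "e > 0"
    then have "hausdorff_premeasure s 1 A < ennreal e"
      using assms(1) by (simp add: hausdorff_measure_eq_0_iff)
    then obtain U :: "nat \<Rightarrow> 'a set" where U: "A \<subseteq> (\<Union>i. U i)"
      "\<And>i. bounded (U i)" "\<And>i. diameter (U i) \<le> 1" 
      "(\<Sum>i. ennreal (diam_power s (U i))) < ennreal e"
      unfolding hausdorff_premeasure_less_iff by blast
    have "diam_power t (U i) \<le> diam_power s (U i)" for i
    proof -
      have "0 \<le> diameter (U i)" by (simp add: diameter_ge_0 U)
      then show ?thesis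
        using t U(3)[of i] powr_mono'[of s t "diameter (U i)"] powr_le1[of t "diameter (U i)"]
        by (auto simp: diam_power_def)
    qed
    then have "(\<Sum>i. ennreal (diam_power t (U i))) \<le> (\<Sum>i. ennreal (diam_power s (U i)))"
      by (intro suminf_le) (auto intro: ennreal_leI)
    then show "\<exists>U :: nat \<Rightarrow> 'a set. A \<subseteq> (\<Union>i. U i) \<and> (\<forall>i. bounded (U i)) \<and>
      (\<Sum>i. ennreal (diam_power t (U i))) < ennreal e"
      using U by (intro exI[of _ U]) auto
  qed
qed (use assms in simp)

lemma hausdorff_measure_mono:
  assumes "A \<subseteq> B" shows "hausdorff_measure s A \<le> hausdorff_measure s B"
  unfolding hausdorff_measure_def hausdorff_premeasure_def using assms
  by (intro SUP_mono' INF_superset_mono) auto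

lemma hausdorff_measure_nonzero:
  assumes "0 \<le> s" "s < hausdorff_dim A" shows "hausdorff_measure s A \<noteq> 0"
proof
  assume "hausdorff_measure s A = 0"
  then have "hausdorff_dim A \<le> s"
    unfolding hausdorff_dim_def using assms by (intro cInf_lower) (auto intro: bdd_belowI[of _ 0])
  then show False using assms by simp
qed

lemma hausdorff_dim_eqI:
  assumes T: "0 \<le> T"
    and up: "\<And>t. t > T \<Longrightarrow> hausdorff_measure t A = 0"
    and low: "\<And>t. 0 \<le> t \<Longrightarrow> t < T \<Longrightarrow> hausdorff_measure t A \<noteq> 0"
  shows "hausdorff_dim A = T"
proof (rule antisym)
  let ?S = "{s. 0 \<le> s \<and> hausdorff_measure s A = 0}"
  have mem: "T + e \<in> ?S" if "e > 0" for e using T up that by auto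
  show "T \<le> hausdorff_dim A"
    unfolding hausdorff_dim_def
    by (rule cInf_greatest) (use mem[of 1] low in \<open>auto simp: not_less[symmetric]\<close>)
  show "hausdorff_dim A \<le> T"
  proof (rule field_le_epsilon)
    fix e :: real assume "e > 0"
    then show "hausdorff_dim A \<le> T + e"
      unfolding hausdorff_dim_def using mem[of e] by (intro cInf_lower) (auto intro: bdd_belowI[of _ 0])
  qed
qed

lemma finite_dyadic_indices [simp]: "finite (dyadic_indices I j)"
  by (rule finite_subset[of _ "{..<2^j}"]) (auto simp: dyadic_indices_def)

lemma covering_number_cover:
  assumes "bounded A" "r > 0"
  obtains C where "finite C" "card C = covering_number A r" "A \<subseteq> (\<Union>a\<in>C. {a..a + r})"
proof -
  obtain B where B: "\<And>x. x \<in> A \<Longrightarrow> \<bar>x\<bar> \<le> B"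
    using assms(1) unfolding bounded_iff by auto
  define C where "C = (\<lambda>i::int. of_int i * r) ` {\<lfloor>- B / r\<rfloor>..\<lfloor>B / r\<rfloor>}"
  have "A \<subseteq> (\<Union>a\<in>C. {a..a + r})"
  proof
    fix x assume "x \<in> A"
    then have x: "- B \<le> x" "x \<le> B" using B[of x] by (auto simp: abs_le_iff)
    have "of_int \<lfloor>x / r\<rfloor> \<le> x / r" "x / r \<le> of_int \<lfloor>x / r\<rfloor> + 1" by linarith+
    then have "of_int \<lfloor>x / r\<rfloor> * r \<le> x" "x \<le> of_int \<lfloor>x / r\<rfloor> * r + r"
      using assms(2) by (simp_all only: pos_le_divide_eq pos_divide_le_eq distrib_right mult_1)
    moreover have "\<lfloor>x / r\<rfloor> \<in> {\<lfloor>- B / r\<rfloor>..\<lfloor>B / r\<rfloor>}"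
      using floor_mono[OF divide_right_mono[OF x(1), of r]] floor_mono[OF divide_right_mono[OF x(2), of r]] assms(2)
      by simp
    ultimately show "x \<in> (\<Union>a\<in>C. {a..a + r})"
      unfolding C_def by (auto intro!: bexI[of _ "\<lfloor>x / r\<rfloor>"])
  qed
  moreover have "finite C" by (simp add: C_def)
  ultimately have "\<exists>n C. finite C \<and> card C = n \<and> A \<subseteq> (\<Union>a\<in>C. {a..a + r})" by blast
  then have "\<exists>C. finite C \<and> card C = covering_number A r \<and> A \<subseteq> (\<Union>a\<in>C. {a..a + r})"
    unfolding covering_number_def by (rule LeastI_ex)
  with that show ?thesis by blast
qed

text \<open>A closed interval of length \<open>1 / 2 ^ j\<close> meets at most three half-open
  dyadic intervals of generation \<open>j\<close>: the one containing its left end and the next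
  two.\<close>

lemma card_dyadic_indices_le:
  assumes "bounded I"
  shows "card (dyadic_indices I j) \<le> 3 * covering_number I (1 / 2 ^ j)"
proof -
  obtain C where C: "finite C" "card C = covering_number I (1 / 2 ^ j)" "I \<subseteq> (\<Union>a\<in>C. {a..a + 1 / 2 ^ j})"
    using covering_number_cover[OF assms, of "1 / 2 ^ j"] by auto
  define D where "D a = nat ` {\<lfloor>a * 2 ^ j\<rfloor>..\<lfloor>a * 2 ^ j\<rfloor> + 2}" for a :: real
  have "dyadic_indices I j \<subseteq> (\<Union>a\<in>C. D a)"
  proof
    fix k assume "k \<in> dyadic_indices I j"
    then obtain x where x: "x \<in> I" "real k / 2 ^ j \<le> x" "x < (real k + 1) / 2 ^ j"
      by (auto simp: dyadic_indices_def)
    then obtain a where a: "a \<in> C" "a \<le> x" "x \<le> a + 1 / 2 ^ j" using C(3) by fastforce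
    have "real k \<le> a * 2 ^ j + 1" "a * 2 ^ j < real k + 1"
    proof -
      have "real k / 2 ^ j \<le> a + 1 / 2 ^ j" using x a by linarith
      then show "real k \<le> a * 2 ^ j + 1" by (simp add: field_simps)
      have "a < (real k + 1) / 2 ^ j" using x a by linarith
      then show "a * 2 ^ j < real k + 1" by (simp add: field_simps)
    qed
    then have "\<lfloor>a * 2 ^ j\<rfloor> \<le> int k" "int k \<le> \<lfloor>a * 2 ^ j\<rfloor> + 2" by linarith+
    then have "k \<in> D a" unfolding D_def by (auto intro!: image_eqI[of _ _ "int k"])
    then show "k \<in> (\<Union>a\<in>C. D a)" using a by blast
  qed
  moreover have "card (D a) \<le> 3" for a
    unfolding D_def using card_image_le[of "{\<lfloor>a * 2 ^ j\<rfloor>..\<lfloor>a * 2 ^ j\<rfloor> + 2}" nat] by simp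
  ultimately have "card (dyadic_indices I j) \<le> card (\<Union>a\<in>C. D a)"
    by (intro card_mono) (auto simp: C D_def)
  also have "\<dots> \<le> (\<Sum>a\<in>C. card (D a))" using C by (intro card_UN_le) auto
  also have "\<dots> \<le> (\<Sum>a\<in>C. 3)" using \<open>\<And>a. card (D a) \<le> 3\<close> by (intro sum_mono)
  finally show ?thesis using C(2) by (simp add: mult.commute)
qed

text \<open>The slack \<open>e\<close> is spent in two halves: one makes the limit superior a strict
  bound at the radii \<open>1 / 2 ^ j\<close>, the other absorbs the factor 3 between dyadic and
  covering intervals.\<close>

lemma eventually_card_dyadic_indices_le:
  assumes "bounded I" "upper_box_dim I \<le> ereal d" "e > 0"
  shows "\<forall>\<^sub>F j in sequentially. real (card (dyadic_indices I j)) \<le> 2 powr ((d + e) * real j)"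
proof -
  have "upper_box_dim I < ereal (d + e / 2)"
    by (rule le_less_trans[OF assms(2)]) (use assms(3) in simp)
  then have ev: "\<forall>\<^sub>F r in at_right 0. ereal (ln (real (covering_number I r)) / - ln r) < ereal (d + e / 2)"
    unfolding upper_box_dim_def by (rule Limsup_lessD)
  have lim: "filterlim (\<lambda>j::nat. 1 / 2 ^ j :: real) (at_right 0) sequentially"
    by real_asymp
  have "filterlim (\<lambda>j::nat. 2 powr (e / 2 * real j)) at_top sequentially"
    using assms(3) by real_asymp
  then have "\<forall>\<^sub>F j in sequentially. 3 \<le> 2 powr (e / 2 * real j)"
    by (simp add: filterlim_at_top)
  moreover have "\<forall>\<^sub>F j::nat in sequentially. ereal (ln (real (covering_number I (1 / 2 ^ j))) / - ln (1 / 2 ^ j)) < ereal (d + e / 2)"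
    using filterlim_iff[THEN iffD1, OF lim] ev by blast
  ultimately show ?thesis using eventually_gt_at_top[of 0]
  proof eventually_elim
    case (elim j)
    let ?N = "covering_number I (1 / 2 ^ j)"
    have l: "- ln (1 / 2 ^ j :: real) = real j * ln 2" by (simp add: ln_div ln_realpow)
    have "real ?N \<le> 2 powr ((d + e / 2) * real j)"
    proof (cases "?N = 0")
      case False
      have "ln (real ?N) < (d + e / 2) * (real j * ln 2)"
        using elim unfolding l by (simp add: divide_less_eq)
      then have "real ?N < exp ((d + e / 2) * (real j * ln 2))"
        using False by (metis exp_less_cancel_iff exp_ln of_nat_0_less_iff neq0_conv)
      then show ?thesis by (simp add: powr_def mult_ac)
    qed auto
    then have "3 * real ?N \<le> 2 powr (e / 2 * real j) * 2 powr ((d + e / 2) * real j)"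
      using elim by (intro mult_mono) auto
    also have "\<dots> = 2 powr ((d + e) * real j)"
      by (simp add: powr_add[symmetric] algebra_simps)
    finally show ?case
      using card_dyadic_indices_le[OF assms(1), of j] by linarith
  qed
qed

section \<open>A Frostman measure on the dyadic tree\<close>

definition dyadic :: "nat \<Rightarrow> nat \<Rightarrow> real set" where
  "dyadic l k = {real k / 2 ^ l ..< (real k + 1) / 2 ^ l}"

lemma dyadic_indices_eq: "dyadic_indices I l = {k. k < 2 ^ l \<and> dyadic l k \<inter> I \<noteq> {}}"
  by (simp add: dyadic_indices_def dyadic_def)

lemma dyadic_split: "dyadic l k = dyadic (Suc l) (2 * k) \<union> dyadic (Suc l) (Suc (2 * k))"
proof -
  define a b c where "a = real k / 2 ^ l" and "b = (2 * real k + 1) / 2 ^ Suc l" and "c = (real k + 1) / 2 ^ l"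
  have "(2 + 2 * real k) / 2 ^ Suc l = c" by (simp add: c_def field_simps)
  then have "dyadic l k = {a..<c}" "dyadic (Suc l) (2 * k) = {a..<b}" "dyadic (Suc l) (Suc (2 * k)) = {b..<c}"
    by (simp_all add: dyadic_def a_def b_def c_def add_ac)
  moreover have "a \<le> b" "b \<le> c" by (simp_all add: a_def b_def c_def field_simps)
  ultimately show ?thesis by (simp add: ivl_disj_un_two(3))
qed

lemma dyadic_indices_children:
  "k \<in> dyadic_indices I l \<longleftrightarrow> 2 * k \<in> dyadic_indices I (Suc l) \<or> Suc (2 * k) \<in> dyadic_indices I (Suc l)"
  by (auto simp: dyadic_indices_eq dyadic_split[of l k])

text \<open>The cost of the cheapest cover of a part of \<open>I\<close> by dyadic intervals at most \<open>n\<close> generations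
  below it, an interval of level \<open>l\<close> having cost \<open>2\<^bsup>-sl\<^esup>\<close>.\<close>

fun tree_content :: "real set \<Rightarrow> real \<Rightarrow> nat \<Rightarrow> nat \<Rightarrow> nat \<Rightarrow> real" where
  "tree_content I s 0 l k = (if k \<in> dyadic_indices I l then 2 powr (- s * real l) else 0)"
| "tree_content I s (Suc n) l k = min (2 powr (- s * real l))
     (tree_content I s n (Suc l) (2 * k) + tree_content I s n (Suc l) (Suc (2 * k)))"

lemma tree_content_nonneg: "0 \<le> tree_content I s n l k"
  by (induction n arbitrary: l k) auto

lemma tree_content_Suc_le:
  assumes "s > 0" shows "tree_content I s (Suc n) l k \<le> tree_content I s n l k"
proof (induction n arbitrary: l k)
  case 0
  then show ?case using dyadic_indices_children[of k I l] by auto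
next
  case (Suc n)
  have "tree_content I s (Suc n) (Suc l) (2 * k) + tree_content I s (Suc n) (Suc l) (Suc (2 * k)) \<le>
    tree_content I s n (Suc l) (2 * k) + tree_content I s n (Suc l) (Suc (2 * k))"
    by (intro add_mono Suc.IH)
  then show ?case unfolding tree_content.simps(2)[of I s "Suc n" l k] tree_content.simps(2)[of I s n l k]
    by (intro min.mono order_refl)
qed

text \<open>Each branch of the minimum names a cover: the interval itself, or the covers of its two
  halves put together. A list keeps repetitions, so the costs simply add.\<close>

lemma tree_content_cover:
  assumes "k < 2 ^ l"
  shows "\<exists>xs. I \<inter> dyadic l k \<subseteq> (\<Union>(l', k') \<in> set xs. dyadic l' k') \<and>
    (\<Sum>(l', k') \<leftarrow> xs. 2 powr (- s * real l')) \<le> tree_content I s n l k"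
  using assms
proof (induction n arbitrary: l k)
  case 0
  then show ?case
    by (cases "k \<in> dyadic_indices I l")
       (auto simp: dyadic_indices_eq intro: exI[of _ "[]"] exI[of _ "[(l, k)]"])
next
  case (Suc n)
  from Suc.IH[of "2 * k" "Suc l"] Suc.prems obtain xs where
    xs: "I \<inter> dyadic (Suc l) (2 * k) \<subseteq> (\<Union>(l', k') \<in> set xs. dyadic l' k')"
    "(\<Sum>(l', k') \<leftarrow> xs. 2 powr (- s * real l')) \<le> tree_content I s n (Suc l) (2 * k)" by auto
  from Suc.IH[of "Suc (2 * k)" "Suc l"] Suc.prems obtain ys where
    ys: "I \<inter> dyadic (Suc l) (Suc (2 * k)) \<subseteq> (\<Union>(l', k') \<in> set ys. dyadic l' k')"
    "(\<Sum>(l', k') \<leftarrow> ys. 2 powr (- s * real l')) \<le> tree_content I s n (Suc l) (Suc (2 * k))" by auto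
  show ?case
  proof (cases "tree_content I s (Suc n) l k = 2 powr (- s * real l)")
    case True
    then show ?thesis by (intro exI[of _ "[(l, k)]"]) auto
  next
    case False
    then have "tree_content I s (Suc n) l k = 
      tree_content I s n (Suc l) (2 * k) + tree_content I s n (Suc l) (Suc (2 * k))"
      by (auto simp: min_def split: if_splits)
    moreover have "I \<inter> dyadic l k \<subseteq> (\<Union>(l', k') \<in> set (xs @ ys). dyadic l' k')"
      using xs(1) ys(1) by (subst dyadic_split) auto
    ultimately show ?thesis using xs(2) ys(2) by (intro exI[of _ "xs @ ys"]) auto
  qed
qed

lemma diameter_interval_real:
  assumes "a \<le> b" shows "diameter {a..<b} \<le> b - (a :: real)"
  by (rule diameter_le; use assms in \<open>auto simp: dist_real_def\<close>)

lemma diam_power_le: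
  assumes "s > 0" "diameter U \<le> D" "bounded U" shows "diam_power s U \<le> D powr s"
  using assms powr_mono2[of s "diameter U" D] diameter_ge_0[of U] by (auto simp: diam_power_def)

lemma diam_power_dyadic_le:
  assumes "s > 0" shows "diam_power s (dyadic l k) \<le> 2 powr (- s * real l)"
proof -
  have "(real k + 1) / 2 ^ l - real k / 2 ^ l = 2 powr (- real l)"
    by (simp add: powr_minus powr_realpow field_simps diff_divide_distrib[symmetric])
  moreover have "real k / 2 ^ l \<le> (real k + 1) / 2 ^ l" by (simp add: divide_right_mono)
  ultimately have "diameter (dyadic l k) \<le> 2 powr (- real l)"
    unfolding dyadic_def using diameter_interval_real[of "real k / 2 ^ l" "(real k + 1) / 2 ^ l"] by simp
  then have "diam_power s (dyadic l k) \<le> (2 powr (- real l)) powr s"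
    by (intro diam_power_le assms) (auto simp: dyadic_def)
  then show ?thesis by (simp add: powr_powr mult.commute)
qed

text \<open>If the contents of the root came arbitrarily close to 0, the dyadic covers realising
  them would make the Hausdorff measure vanish.\<close>

lemma tree_content_root_bound:
  assumes s: "s > 0" and H: "hausdorff_measure s I \<noteq> 0" and I: "I \<subseteq> {0..1}"
  obtains \<rho> where "\<rho> > 0" "\<And>n. \<rho> \<le> tree_content I s n 0 0"
proof -
  have "\<exists>\<rho>>0. \<forall>n. \<rho> \<le> tree_content I s n 0 0"
  proof (rule ccontr)
    assume neg: "\<not> (\<exists>\<rho>>0. \<forall>n. \<rho> \<le> tree_content I s n 0 0)"
    have "hausdorff_measure s I = 0"
    proof (rule hausdorff_measure_eq_0I[OF s])
      fix e :: real assume "e > 0"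
      with neg obtain n where n: "tree_content I s n 0 0 < e" by (auto simp: not_le)
      obtain xs where xs: "I \<inter> dyadic 0 0 \<subseteq> (\<Union>(l', k') \<in> set xs. dyadic l' k')"
        "(\<Sum>(l', k') \<leftarrow> xs. 2 powr (- s * real l')) \<le> tree_content I s n 0 0"
        using tree_content_cover[of 0 0 I s n] by auto
      \<comment> \<open>the half-open dyadic intervals miss the point 1\<close>
      define U where "U i = (if i < length xs then dyadic (fst (xs ! i)) (snd (xs ! i))
        else if i = length xs then {1} else {})" for i
      have sub: "I \<subseteq> (\<Union>i. U i)"
      proof
        fix x assume x: "x \<in> I"
        show "x \<in> (\<Union>i. U i)"
        proof (cases "x = 1")
          case True
          then show ?thesis by (auto simp: U_def intro!: exI[of _ "length xs"])
        next
          case False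
          then have "x \<in> dyadic 0 0" using x I by (force simp: dyadic_def)
          then obtain p where "p \<in> set xs" "x \<in> dyadic (fst p) (snd p)" using xs(1) x by fastforce
          then obtain i where "i < length xs" "x \<in> dyadic (fst (xs ! i)) (snd (xs ! i))"
            by (metis in_set_conv_nth)
          then show ?thesis by (auto simp: U_def intro!: exI[of _ i])
        qed
      qed
      have bd: "bounded (U i)" for i by (simp add: U_def dyadic_def)
      have "(\<Sum>i. ennreal (diam_power s (U i))) = (\<Sum>i<Suc (length xs). ennreal (diam_power s (U i)))"
        by (rule suminf_finite) (auto simp: U_def)
      also have "\<dots> = (\<Sum>i<length xs. ennreal (diam_power s (U i)))"
        using s by (simp add: U_def[of "length xs"] diam_power_def[of s "{1}"])
      also have "\<dots> \<le> (\<Sum>i<length xs. ennreal (2 powr (- s * real (fst (xs ! i)))))"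
        by (intro sum_mono ennreal_leI) (use diam_power_dyadic_le[OF s] in \<open>simp add: U_def\<close>)
      also have "\<dots> = ennreal (\<Sum>i<length xs. 2 powr (- s * real (fst (xs ! i))))" by simp
      also have "(\<Sum>i<length xs. 2 powr (- s * real (fst (xs ! i)))) = (\<Sum>(l', k') \<leftarrow> xs. 2 powr (- s * real l'))"
        by (simp add: sum_list_sum_nth atLeast0LessThan case_prod_beta)
      also have "ennreal \<dots> < ennreal e" using xs(2) n tree_content_nonneg[of I s n 0 0]
        by (intro ennreal_lessI) (use \<open>e > 0\<close> in auto)
      finally show "\<exists>U :: nat \<Rightarrow> real set. I \<subseteq> (\<Union>i. U i) \<and> (\<forall>i. bounded (U i)) \<and>
          (\<Sum>i. ennreal (diam_power s (U i))) < ennreal e"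
        using sub bd by blast
    qed
    with H show False by simp
  qed
  then obtain \<rho> where "\<rho> > 0" "\<forall>n. \<rho> \<le> tree_content I s n 0 0" by blast
  with that[of \<rho>] show ?thesis by simp
qed

text \<open>Every interval hands its mass on to its halves in proportion to their contents
  \<open>c\<close>.\<close>

fun split_mass :: "(nat \<Rightarrow> nat \<Rightarrow> real) \<Rightarrow> nat \<Rightarrow> nat \<Rightarrow> real" where
  "split_mass c 0 k = (if k = 0 then c 0 0 else 0)"
| "split_mass c (Suc l) k = split_mass c l (k div 2) * c (Suc l) k /
     (c (Suc l) (2 * (k div 2)) + c (Suc l) (Suc (2 * (k div 2))))"

text \<open>The limits \<open>c\<close> of the tree contents obey the Frostman bound and are
  subadditive, but in general not additive. Splitting the content of the root proportionally gives
  additive masses, and subadditivity keeps each share at most \<open>c\<close>.\<close>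

theorem dyadic_frostman:
  assumes s: "s > 0" and H: "hausdorff_measure s I \<noteq> 0" and I: "I \<subseteq> {0..1}"
  obtains \<mu> :: "nat \<Rightarrow> nat \<Rightarrow> real" where
    "\<And>l k. 0 \<le> \<mu> l k" "\<And>l k. \<mu> l k = \<mu> (Suc l) (2 * k) + \<mu> (Suc l) (Suc (2 * k))"
    "\<And>l k. \<mu> l k \<le> 2 powr (- s * real l)" "\<And>l k. k \<notin> dyadic_indices I l \<Longrightarrow> \<mu> l k = 0" "\<mu> 0 0 > 0"
proof -
  define c where "c l k = lim (\<lambda>n. tree_content I s n l k)" for l k
  have dec: "decseq (\<lambda>n. tree_content I s n l k)" for l k
    by (intro decseq_SucI tree_content_Suc_le s)
  have lim: "(\<lambda>n. tree_content I s n l k) \<longlonglongrightarrow> c l k" for l k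
  proof -
    obtain L where "(\<lambda>n. tree_content I s n l k) \<longlonglongrightarrow> L"
      using decseq_convergent[OF dec, of 0 l k] tree_content_nonneg by metis
    then show ?thesis unfolding c_def by (simp add: limI)
  qed
  have c_nonneg: "0 \<le> c l k" for l k
    by (rule LIMSEQ_le_const[OF lim]) (auto intro: tree_content_nonneg)
  have c_le0: "c l k \<le> tree_content I s 0 l k" for l k
    by (rule decseq_ge[OF dec lim])
  have c_le: "c l k \<le> 2 powr (- s * real l)" for l k
    using c_le0[of l k] by (cases "k \<in> dyadic_indices I l") (simp_all add: order_trans[OF _ powr_ge_zero])
  have c_out: "c l k = 0" if "k \<notin> dyadic_indices I l" for l k
    using c_le0[of l k] c_nonneg[of l k] that by simp
  \<comment> \<open>The minimum in \<open>tree_content\<close> is at most its second entry; the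
    limit of this inequality is subadditivity.\<close>
  have c_sub: "c l k \<le> c (Suc l) (2 * k) + c (Suc l) (Suc (2 * k))" for l k
  proof (rule LIMSEQ_le[OF _ tendsto_add[OF lim lim]])
    show "(\<lambda>n. tree_content I s (Suc n) l k) \<longlonglongrightarrow> c l k" using lim LIMSEQ_Suc by blast
  qed auto
  have c_root: "c 0 0 > 0"
  proof -
    obtain \<rho> where "\<rho> > 0" "\<And>n. \<rho> \<le> tree_content I s n 0 0" using tree_content_root_bound[OF assms] by metis
    moreover from this have "\<rho> \<le> c 0 0" by (intro LIMSEQ_le_const[OF lim]) auto
    ultimately show ?thesis by simp
  qed
  let ?\<mu> = "split_mass c"
  have nonneg: "0 \<le> ?\<mu> l k" for l k
    by (induction l arbitrary: k) (auto simp: c_nonneg)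
  have le_c: "?\<mu> l k \<le> c l k" for l k
  proof (induction l arbitrary: k)
    case (Suc l)
    define S where "S = c (Suc l) (2 * (k div 2)) + c (Suc l) (Suc (2 * (k div 2)))"
    have S: "?\<mu> l (k div 2) \<le> S" using Suc[of "k div 2"] c_sub[of l "k div 2"] by (simp add: S_def)
    show ?case
    proof (cases "S = 0")
      case True
      then show ?thesis by (simp add: S_def[symmetric] c_nonneg)
    next
      case False
      then have "S > 0" using S nonneg[of l "k div 2"] by linarith
      moreover have "?\<mu> l (k div 2) * c (Suc l) k \<le> S * c (Suc l) k" by (intro mult_right_mono S c_nonneg)
      ultimately show ?thesis by (simp add: S_def[symmetric] divide_le_eq mult.commute)
    qed
  qed (auto simp: c_nonneg)
  \<comment> \<open>If \<open>S = 0\<close>, the mass of the parent, being at most \<open>S\<close>,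
    is 0 as well, so the value 0 of a quotient by zero loses nothing.\<close>
  have add: "?\<mu> l k = ?\<mu> (Suc l) (2 * k) + ?\<mu> (Suc l) (Suc (2 * k))" for l k
  proof -
    define S where "S = c (Suc l) (2 * k) + c (Suc l) (Suc (2 * k))"
    have S: "?\<mu> l k \<le> S" using le_c[of l k] c_sub[of l k] by (simp add: S_def)
    have "?\<mu> (Suc l) (2 * k) + ?\<mu> (Suc l) (Suc (2 * k)) = ?\<mu> l k * S / S"
      by (simp add: S_def[symmetric] add_divide_distrib[symmetric] distrib_left[symmetric])
    then show ?thesis using S nonneg[of l k] by (cases "S = 0") auto
  qed
  show ?thesis
  proof (rule that[of ?\<mu>])
    show "?\<mu> l k \<le> 2 powr (- s * real l)" for l k using le_c c_le order_trans by blast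
    show "?\<mu> l k = 0" if "k \<notin> dyadic_indices I l" for l k
      using le_c[of l k] nonneg[of l k] c_out[OF that] by simp
    show "?\<mu> l k = ?\<mu> (Suc l) (2 * k) + ?\<mu> (Suc l) (Suc (2 * k))" for l k by (rule add)
    show "0 < ?\<mu> 0 0" using c_root by simp
  qed (rule nonneg)
qed

section \<open>Cantor sets with prescribed masses\<close>

text \<open>If \<open>y\<close> gives the masses of the dyadic intervals of level \<open>m\<close>, then \<open>mass m y l q\<close> is the mass
  of the \<open>q\<close>-th interval of level \<open>l \<le> m\<close>.\<close>

definition mass :: "nat \<Rightarrow> (nat \<Rightarrow> real) \<Rightarrow> nat \<Rightarrow> nat \<Rightarrow> real" where
  "mass m y l q = (\<Sum>k | k < 2 ^ m \<and> k div 2 ^ (m - l) = q. y k)"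

lemma mass_cong: "(\<And>k. k < 2 ^ m \<Longrightarrow> y k = z k) \<Longrightarrow> mass m y l q = mass m z l q"
  unfolding mass_def by (intro sum.cong) auto

lemma mass_self: "k < 2 ^ m \<Longrightarrow> mass m y m k = y k"
proof -
  assume "k < 2 ^ m"
  then have "{k'. k' < 2 ^ m \<and> k' div 2 ^ (m - m) = k} = {k}" by auto
  then show ?thesis by (simp add: mass_def)
qed

lemma finite_mass_index [simp]: "finite {k::nat. k < 2 ^ m \<and> P k}"
  by (rule finite_subset[of _ "{..<2^m}"]) auto

lemma mass_nonneg: "(\<And>k. k < 2 ^ m \<Longrightarrow> 0 \<le> y k) \<Longrightarrow> 0 \<le> mass m y l q"
  unfolding mass_def by (intro sum_nonneg) auto

lemma mass_ge: "(\<And>k. k < 2 ^ m \<Longrightarrow> 0 \<le> y k) \<Longrightarrow> k < 2 ^ m \<Longrightarrow> y k \<le> mass m y l (k div 2 ^ (m - l))"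
  unfolding mass_def by (intro member_le_sum) auto

lemma div_pow_div_pow:
  fixes k :: nat assumes "l \<le> l'" "l' \<le> m"
  shows "k div 2 ^ (m - l') div 2 ^ (l' - l) = k div 2 ^ (m - l)"
proof -
  have "m - l = (m - l') + (l' - l)" using assms by simp
  then show ?thesis by (simp add: div_mult2_eq power_add)
qed

lemma div_pow_less:
  fixes k :: nat assumes "l \<le> m" "k < 2 ^ m" shows "k div 2 ^ (m - l) < 2 ^ l"
proof -
  have "(2::nat) ^ m = 2 ^ l * 2 ^ (m - l)" using assms by (simp add: power_add[symmetric])
  then show ?thesis using assms by (simp add: less_mult_imp_div_less)
qed

lemma mass_mass:
  assumes "l \<le> l'" "l' \<le> m"
  shows "mass l' (mass m y l') l q = mass m y l q"
proof -
  have "mass l' (mass m y l') l q = 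
    (\<Sum>q' | q' < 2 ^ l' \<and> q' div 2 ^ (l' - l) = q. \<Sum>k | k < 2 ^ m \<and> k div 2 ^ (m - l) = q \<and> k div 2 ^ (m - l') = q'. y k)"
    unfolding mass_def using div_pow_div_pow[OF assms] by (intro sum.cong refl) auto
  also have "\<dots> = (\<Sum>k | k < 2 ^ m \<and> k div 2 ^ (m - l) = q. y k)"
    using sum.group[of "{k. k < 2 ^ m \<and> k div 2 ^ (m - l) = q}" "{q'. q' < 2 ^ l' \<and> q' div 2 ^ (l' - l) = q}"
        "\<lambda>k. k div 2 ^ (m - l')" y] div_pow_less[OF assms(2)] div_pow_div_pow[OF assms]
    by (simp add: conj_ac image_subset_iff)
  finally show ?thesis by (simp add: mass_def)
qed

definition closed_dyadic :: "nat \<Rightarrow> nat \<Rightarrow> real set" where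
  "closed_dyadic l k = {real k / 2 ^ l .. (real k + 1) / 2 ^ l}"

lemma closed_dyadic_parent:
  assumes "l \<le> m" shows "closed_dyadic m k \<subseteq> closed_dyadic l (k div 2 ^ (m - l))"
proof -
  define n where "n = m - l"
  have m: "m = l + n" using assms by (simp add: n_def)
  have "2 ^ n * (k div 2 ^ n) \<le> k" "k + 1 \<le> 2 ^ n * (k div 2 ^ n) + 2 ^ n"
    using dividend_less_div_times[of "2 ^ n" k] by (auto simp: mult.commute Suc_le_eq)
  then have "real (2 ^ n * (k div 2 ^ n)) \<le> real k" "real (k + 1) \<le> real (2 ^ n * (k div 2 ^ n) + 2 ^ n)"
    by (simp_all only: of_nat_le_iff)
  then have "real (k div 2 ^ n) * 2 ^ n / 2 ^ m \<le> real k / 2 ^ m"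
    "(real k + 1) / 2 ^ m \<le> (real (k div 2 ^ n) + 1) * 2 ^ n / 2 ^ m"
    by (intro divide_right_mono; simp add: algebra_simps)+
  then have "real (k div 2 ^ n) / 2 ^ l \<le> real k / 2 ^ m" "(real k + 1) / 2 ^ m \<le> (real (k div 2 ^ n) + 1) / 2 ^ l"
    by (simp_all add: m power_add)
  then show ?thesis unfolding closed_dyadic_def n_def by auto
qed

lemma card_closed_dyadic_meeting_ball:
  "finite {q. closed_dyadic l q \<inter> ball u (2 powr (- real l)) \<noteq> {}}"
  "card {q. closed_dyadic l q \<inter> ball u (2 powr (- real l)) \<noteq> {}} \<le> 4"
proof -
  let ?S = "{q. closed_dyadic l q \<inter> ball u (2 powr (- real l)) \<noteq> {}}"
  let ?T = "nat ` {\<lfloor>u * 2 ^ l\<rfloor> - 2..\<lfloor>u * 2 ^ l\<rfloor> + 1}"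
  have "?S \<subseteq> ?T"
  proof
    fix q assume "q \<in> ?S"
    then obtain x where x: "real q / 2 ^ l \<le> x" "x \<le> (real q + 1) / 2 ^ l" "\<bar>u - x\<bar> < 1 / 2 ^ l"
      by (auto simp: closed_dyadic_def dist_real_def powr_minus powr_realpow divide_inverse)
    then have "real q / 2 ^ l < u + 1 / 2 ^ l" "u < (real q + 1) / 2 ^ l + 1 / 2 ^ l" by linarith+
    then have "real q < u * 2 ^ l + 1" "u * 2 ^ l < real q + 2"
      by (simp_all add: add_divide_distrib[symmetric] pos_less_divide_eq pos_divide_less_eq distrib_right)
    then have "\<lfloor>u * 2 ^ l\<rfloor> - 2 \<le> int q" "int q \<le> \<lfloor>u * 2 ^ l\<rfloor> + 1" by linarith+
    then show "q \<in> ?T" by (auto intro!: image_eqI[of _ _ "int q"])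
  qed
  moreover have "card ?T \<le> 4" using card_image_le[of "{\<lfloor>u * 2 ^ l\<rfloor> - 2..\<lfloor>u * 2 ^ l\<rfloor> + 1}" nat] by simp
  moreover have fin: "finite ?T" by simp
  ultimately show "finite ?S" "card ?S \<le> 4"
    using card_mono[of ?T ?S] by (blast intro: finite_subset, linarith)
qed

text \<open>Replaces the diameter \<open>D\<close> of a covering set by a dyadic scale just above
  it. A set of diameter 0 has no comparable scale; the extra \<open>e\<close> pays for it.\<close>

lemma dyadic_scale_exists:
  assumes t: "t > 0" and D: "0 \<le> D" "D \<le> 1 / 2" and e: "e > 0"
  shows "\<exists>l::nat. D < 2 powr (- real l) \<and> 2 powr (- t * real l) \<le> 2 powr t * D powr t + e"
proof (cases "D = 0")
  case True
  have "((\<lambda>l::nat. 2 powr (- t * real l)) \<longlongrightarrow> 0) sequentially" using t by real_asymp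
  then have "\<forall>\<^sub>F l::nat in sequentially. 2 powr (- t * real l) < e" using e by (rule order_tendstoD(2))
  then obtain l :: nat where "2 powr (- t * real l) < e" by (auto simp: eventually_sequentially)
  then show ?thesis using True by (intro exI[of _ l]) auto
next
  case False
  then have D0: "D > 0" using D by simp
  \<comment> \<open>The largest integer strictly below \<open>- log 2 D\<close>; it is nonnegative
    because \<open>D \<le> 1 / 2\<close>.\<close>
  define z where "z = \<lceil>- log 2 D\<rceil> - 1"
  have "log 2 D \<le> log 2 (1 / 2)" using D D0 by simp
  then have "- log 2 D \<ge> 1" by (simp add: log_divide)
  then have z: "z \<ge> 0" "real_of_int z < - log 2 D" "- log 2 D \<le> real_of_int z + 1" unfolding z_def by linarith+
  define l where "l = nat z"
  have l: "real l < - log 2 D" "- log 2 D \<le> real l + 1" using z by (simp_all add: l_def)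
  have "2 powr (log 2 D) < 2 powr (- real l)" using l by simp
  then have 1: "D < 2 powr (- real l)" using D0 by simp
  have "2 powr (- real l) \<le> 2 powr (1 + log 2 D)" using l by simp
  also have "\<dots> = 2 * D" using D0 by (simp add: powr_add)
  finally have "(2 powr (- real l)) powr t \<le> (2 * D) powr t" using t by (intro powr_mono2) auto
  then have "2 powr (- t * real l) \<le> 2 powr t * D powr t" using D0 by (simp add: powr_powr powr_mult mult.commute)
  then show ?thesis using 1 e by (intro exI[of _ l]) auto
qed

lemma sum_UN_le_sum:
  fixes f :: "'a \<Rightarrow> real"
  assumes "finite A" "\<And>a. a \<in> A \<Longrightarrow> finite (B a)" "\<And>x. 0 \<le> f x"
  shows "sum f (\<Union>a\<in>A. B a) \<le> (\<Sum>a\<in>A. sum f (B a))"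
  using assms(1,2)
proof (induction A)
  case (insert a A)
  have "sum f (B a \<union> \<Union> (B ` A)) + sum f (B a \<inter> \<Union> (B ` A)) = sum f (B a) + sum f (\<Union> (B ` A))"
    using insert by (intro sum.union_inter) auto
  moreover have "0 \<le> sum f (B a \<inter> \<Union> (B ` A))" by (intro sum_nonneg assms)
  ultimately show ?case using insert by simp
qed auto

text \<open>This is the mass distribution principle with compatible masses in place of a measure. By
  compactness, finitely many slightly enlarged sets of a cheap cover would already cover some
  \<open>K n\<close>, and the total mass \<open>c0\<close> would be at most the sum of the masses of
  the dyadic intervals meeting them.\<close>

lemma cantor_hausdorff_measure_nonzero:
  fixes m :: "nat \<Rightarrow> nat" and \<nu> :: "nat \<Rightarrow> nat \<Rightarrow> real"
  assumes t: "t > 0" and m: "strict_mono m"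
    and nonneg: "\<And>n k. 0 \<le> \<nu> n k"
    and cons: "\<And>n l q. l \<le> m n \<Longrightarrow> q < 2 ^ l \<Longrightarrow> mass (m (Suc n)) (\<nu> (Suc n)) l q = mass (m n) (\<nu> n) l q"
    and bd: "\<And>n l q. l \<le> m n \<Longrightarrow> q < 2 ^ l \<Longrightarrow> mass (m n) (\<nu> n) l q \<le> B * 2 powr (- t * real l)"
    and pos: "mass (m 0) (\<nu> 0) 0 0 > 0"
  shows "hausdorff_measure t (\<Inter>n. \<Union>k\<in>{k. k < 2 ^ m n \<and> \<nu> n k > 0}. closed_dyadic (m n) k) \<noteq> 0"
proof
  define K where "K n = (\<Union>k\<in>{k. k < 2 ^ m n \<and> \<nu> n k > 0}. closed_dyadic (m n) k)" for n
  define c0 where "c0 = mass (m 0) (\<nu> 0) 0 0"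
  assume "hausdorff_measure t (\<Inter>n. \<Union>k\<in>{k. k < 2 ^ m n \<and> \<nu> n k > 0}. closed_dyadic (m n) k) = 0"
  then have H: "hausdorff_measure t (\<Inter>n. K n) = 0" by (simp add: K_def)
  have mm: "m n \<le> m (Suc n)" for n using m by (simp add: strict_mono_def less_imp_le)
  have total: "mass (m n) (\<nu> n) 0 0 = c0" for n
    by (induction n) (use cons[of 0] in \<open>auto simp: c0_def\<close>)
  have B: "B > 0"
  proof -
    have "c0 \<le> B" using bd[of 0 0 0] by (simp add: c0_def)
    then show ?thesis using pos by (simp add: c0_def)
  qed
  have KSuc: "K (Suc n) \<subseteq> K n" for n
  proof
    fix x assume "x \<in> K (Suc n)"
    then obtain k where k: "k < 2 ^ m (Suc n)" "\<nu> (Suc n) k > 0" "x \<in> closed_dyadic (m (Suc n)) k"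
      by (auto simp: K_def)
    define a where "a = k div 2 ^ (m (Suc n) - m n)"
    have a: "a < 2 ^ m n" unfolding a_def by (rule div_pow_less[OF mm k(1)])
    have "\<nu> (Suc n) k \<le> mass (m (Suc n)) (\<nu> (Suc n)) (m n) a"
      unfolding a_def by (intro mass_ge nonneg k)
    also have "\<dots> = \<nu> n a" using cons[OF order_refl a] mass_self[OF a] by simp
    finally have "\<nu> n a > 0" using k by simp
    moreover have "x \<in> closed_dyadic (m n) a" using closed_dyadic_parent[OF mm[of n], of k] k by (auto simp: a_def)
    ultimately show "x \<in> K n" using a by (auto simp: K_def)
  qed
  have Kmono: "K n' \<subseteq> K n" if "n \<le> n'" for n n'
    by (rule lift_Suc_antimono_le[of K]) (use KSuc that in auto)
  have Kc: "compact (K n)" for n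
    unfolding K_def by (intro compact_UN) (auto simp: closed_dyadic_def)
  \<comment> \<open>At most four dyadic intervals meet each enlarged set, each of mass at most
    \<open>B\<close> times the power of its length. The final estimate is thus
    \<open>4 * B * (2 powr t + 1) * e\<close>, and this choice makes it
    \<open>c0 / 2\<close>.\<close>
  define e where "e = c0 / (8 * B * (2 powr t + 1))"
  have e: "e > 0" using pos B by (simp add: e_def c0_def add_pos_pos)
  have "hausdorff_premeasure t (1 / 2) (\<Inter>n. K n) < ennreal e"
    using H e by (simp add: hausdorff_measure_eq_0_iff)
  then obtain U :: "nat \<Rightarrow> real set" where U: "(\<Inter>n. K n) \<subseteq> (\<Union>i. U i)"
      "\<And>i. bounded (U i)" "\<And>i. diameter (U i) \<le> 1 / 2"
      "(\<Sum>i. ennreal (diam_power t (U i))) < ennreal e"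
    unfolding hausdorff_premeasure_less_iff by blast
  have "\<exists>l::nat. diameter (U i) < 2 powr (- real l) \<and>
    2 powr (- t * real l) \<le> 2 powr t * diameter (U i) powr t + e * (1 / 2) ^ Suc i" for i
    by (intro dyadic_scale_exists t diameter_ge_0 U) (use e in auto)
  then obtain l :: "nat \<Rightarrow> nat" where l: "\<And>i. diameter (U i) < 2 powr (- real (l i))"
    "\<And>i. 2 powr (- t * real (l i)) \<le> 2 powr t * diameter (U i) powr t + e * (1 / 2) ^ Suc i" by metis
  \<comment> \<open>Open enlargements, for the sake of compactness. The strict inequality in
    \<open>l\<close> gives \<open>U i \<subseteq> V i\<close>; an empty \<open>U i\<close> stays
    empty and is charged nothing.\<close>
  define V where "V i = (if U i = {} then {} else ball (SOME u. u \<in> U i) (2 powr (- real (l i))))" for i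
  have UV: "U i \<subseteq> V i" for i
  proof
    fix x assume x: "x \<in> U i"
    then have "(SOME u. u \<in> U i) \<in> U i" by (rule someI)
    then have "dist (SOME u. u \<in> U i) x \<le> diameter (U i)" using x U(2) by (intro diameter_bounded_bound)
    then show "x \<in> V i" using x l(1)[of i] by (auto simp: V_def)
  qed
  have Vo: "open (V i)" for i by (simp add: V_def)
  \<comment> \<open>The compact sets \<open>K n\<close> minus the open cover decrease to the empty
    set, so one of them is already empty.\<close>
  have "\<exists>N. K N - (\<Union>i. V i) = {}"
  proof (rule ccontr)
    assume "\<not> (\<exists>N. K N - (\<Union>i. V i) = {})"
    then have "(\<Inter>n. K n - (\<Union>i. V i)) \<noteq> {}"
      by (intro compact_nest compact_diff Kc Diff_mono Kmono) (use Vo in auto)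
    then show False using U(1) UV by fastforce
  qed
  then obtain N where N: "K N \<subseteq> (\<Union>i. V i)" by auto
  obtain F where F: "finite F" "K N \<subseteq> (\<Union>i\<in>F. V i)"
    using compactE_image[OF Kc[of N], of UNIV V] Vo N by auto
  \<comment> \<open>Level \<open>m n\<close> must be at least as fine as every scale
    \<open>l i\<close> of the finite subcover, since masses at level \<open>l i\<close> are sums
    over level \<open>m n\<close>.\<close>
  define n where "n = max N (Max (insert 0 (l ` F)))"
  have nl: "l i \<le> m n" if "i \<in> F" for i
  proof -
    have "l i \<le> n" using that F by (auto simp: n_def intro!: le_max_iff_disj[THEN iffD2] Max_ge)
    also have "n \<le> m n" using m by (rule strict_mono_imp_increasing)
    finally show ?thesis .
  qed
  have KF: "K n \<subseteq> (\<Union>i\<in>F. V i)" using Kmono[of N n] F(2) by (auto simp: n_def)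
  define G where "G i = {q. closed_dyadic (l i) q \<inter> V i \<noteq> {}}" for i
  have G: "finite (G i)" "card (G i) \<le> 4" for i
    using card_closed_dyadic_meeting_ball[of "l i" "SOME u. u \<in> U i"] by (auto simp: G_def V_def)
  define S where "S i q = {k::nat. k < 2 ^ m n \<and> k div 2 ^ (m n - l i) = q}" for i and q :: nat
  have "c0 = (\<Sum>k | k < 2 ^ m n \<and> \<nu> n k > 0. \<nu> n k)"
  proof -
    have "c0 = (\<Sum>k | k < 2 ^ m n. \<nu> n k)"
      unfolding total[of n, symmetric] mass_def by (intro sum.cong) auto
    also have "\<dots> = (\<Sum>k | k < 2 ^ m n \<and> \<nu> n k > 0. \<nu> n k)"
      using finite_mass_index[of "m n" "\<lambda>_. True"]
      by (intro sum.mono_neutral_right) (auto simp: not_less intro: antisym nonneg)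
    finally show ?thesis .
  qed
  also have "\<dots> \<le> (\<Sum>k\<in>(\<Union>i\<in>F. \<Union>q\<in>G i \<inter> {..<2 ^ l i}. S i q). \<nu> n k)"
  proof (intro sum_mono2)
    show "finite (\<Union>i\<in>F. \<Union>q\<in>G i \<inter> {..<2 ^ l i}. S i q)" using F G by (auto simp: S_def)
    show "{k. k < 2 ^ m n \<and> \<nu> n k > 0} \<subseteq> (\<Union>i\<in>F. \<Union>q\<in>G i \<inter> {..<2 ^ l i}. S i q)"
    proof
      fix k assume "k \<in> {k. k < 2 ^ m n \<and> \<nu> n k > 0}"
      then have k: "k < 2 ^ m n" "\<nu> n k > 0" by auto
      define x where "x = real k / 2 ^ m n"
      have x: "x \<in> closed_dyadic (m n) k" by (auto simp: closed_dyadic_def x_def divide_right_mono)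
      then have "x \<in> K n" using k by (auto simp: K_def)
      then obtain i where i: "i \<in> F" "x \<in> V i" using KF by auto
      define q where "q = k div 2 ^ (m n - l i)"
      have "x \<in> closed_dyadic (l i) q"
        using x closed_dyadic_parent[OF nl[OF i(1)], of k] by (auto simp: q_def)
      then have "q \<in> G i" using i by (auto simp: G_def)
      moreover have "q < 2 ^ l i" unfolding q_def by (rule div_pow_less[OF nl[OF i(1)] k(1)])
      moreover have "k \<in> S i q" using k by (simp add: S_def q_def)
      ultimately show "k \<in> (\<Union>i\<in>F. \<Union>q\<in>G i \<inter> {..<2 ^ l i}. S i q)" using i(1) by blast
    qed
  qed (rule nonneg)
  also have "\<dots> \<le> (\<Sum>i\<in>F. \<Sum>k\<in>(\<Union>q\<in>G i \<inter> {..<2 ^ l i}. S i q). \<nu> n k)"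
    using F G by (intro sum_UN_le_sum) (auto simp: S_def nonneg)
  also have "\<dots> \<le> (\<Sum>i\<in>F. \<Sum>q\<in>G i \<inter> {..<2 ^ l i}. \<Sum>k\<in>S i q. \<nu> n k)"
    using F G by (intro sum_mono sum_UN_le_sum) (auto simp: S_def nonneg)
  also have "\<dots> = (\<Sum>i\<in>F. \<Sum>q\<in>G i \<inter> {..<2 ^ l i}. mass (m n) (\<nu> n) (l i) q)"
    by (simp add: mass_def S_def)
  also have "\<dots> \<le> (\<Sum>i\<in>F. \<Sum>q\<in>G i \<inter> {..<2 ^ l i}. B * 2 powr (- t * real (l i)))"
    using nl by (intro sum_mono bd) auto
  also have "\<dots> = (\<Sum>i\<in>F. real (card (G i \<inter> {..<2 ^ l i})) * (B * 2 powr (- t * real (l i))))" by simp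
  also have "\<dots> \<le> (\<Sum>i\<in>F. (4 * B) * (2 powr t * diam_power t (U i) + e * (1 / 2) ^ Suc i))"
  proof (intro sum_mono)
    fix i assume "i \<in> F"
    show "real (card (G i \<inter> {..<2 ^ l i})) * (B * 2 powr (- t * real (l i)))
       \<le> (4 * B) * (2 powr t * diam_power t (U i) + e * (1 / 2) ^ Suc i)"
    proof (cases "U i = {}")
      case True
      then have "G i = {}" by (simp add: G_def V_def)
      then show ?thesis using True B e by simp
    next
      case False
      have "card (G i \<inter> {..<2 ^ l i}) \<le> 4"
        using G[of i] by (meson card_mono inf_le1 order_trans)
      then have "real (card (G i \<inter> {..<2 ^ l i})) * (B * 2 powr (- t * real (l i))) \<le> 4 * (B * 2 powr (- t * real (l i)))"
        using B by (intro mult_right_mono) auto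
      also have "\<dots> = (4 * B) * 2 powr (- t * real (l i))" by simp
      also have "\<dots> \<le> (4 * B) * (2 powr t * diameter (U i) powr t + e * (1 / 2) ^ Suc i)"
        using B l(2)[of i] by (intro mult_left_mono) auto
      finally show ?thesis using False t by (simp add: diam_power_def)
    qed
  qed
  also have "\<dots> = 4 * B * (2 powr t * (\<Sum>i\<in>F. diam_power t (U i)) + e * (\<Sum>i\<in>F. (1 / 2) ^ Suc i))"
    by (simp add: sum_distrib_left sum.distrib distrib_left)
  also have "\<dots> \<le> 4 * B * (2 powr t * e + e * 1)"
  proof (intro mult_left_mono add_mono)
    have "ennreal (\<Sum>i\<in>F. diam_power t (U i)) = (\<Sum>i\<in>F. ennreal (diam_power t (U i)))" by simp
    also have "\<dots> \<le> (\<Sum>i. ennreal (diam_power t (U i)))" by (intro sum_le_suminf F summableI) auto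
    also note U(4)
    finally show "(\<Sum>i\<in>F. diam_power t (U i)) \<le> e" using e by (simp add: ennreal_less_iff sum_nonneg)
    have "(\<Sum>i\<in>F. (1 / 2 :: real) ^ Suc i) \<le> (\<Sum>i. (1 / 2) ^ Suc i)"
      using power_half_series by (intro sum_le_suminf F) (auto simp: sums_iff)
    also have "\<dots> = 1" using power_half_series by (simp add: sums_iff)
    finally show "(\<Sum>i\<in>F. (1 / 2 :: real) ^ Suc i) \<le> 1" .
  qed (use B e in auto)
  also have "\<dots> = 4 * B * (2 powr t + 1) * e" by (simp add: algebra_simps)
  also have "\<dots> = c0 / 2"
  proof -
    define w where "w = 2 powr t + 1"
    have "w \<noteq> 0" unfolding w_def by (smt (verit) powr_ge_zero)
    then show ?thesis using B unfolding e_def w_def[symmetric] by simp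
  qed
  finally show False using pos by (simp add: c0_def)
qed

section \<open>Cantor subsets of limsup sets\<close>

lemma hausdorff_measure_nonzero_mono:
  assumes "A \<subseteq> B" "hausdorff_measure s A \<noteq> 0" shows "hausdorff_measure s B \<noteq> 0"
  using hausdorff_measure_mono[OF assms(1), of s] assms(2) by auto

lemma eventually_exponential_le:
  fixes a b C :: real assumes "a < b"
  shows "\<forall>\<^sub>F j in sequentially. C * 2 powr (- b * real j) \<le> 2 powr (- a * real j)"
proof -
  define c where "c = b - a"
  have "c > 0" using assms by (simp add: c_def)
  then have "((\<lambda>j::nat. C * 2 powr (- c * real j)) \<longlongrightarrow> 0) sequentially" by real_asymp
  then have "\<forall>\<^sub>F j::nat in sequentially. C * 2 powr (- c * real j) < 1" by (rule order_tendstoD(2)) simp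
  then show ?thesis
  proof eventually_elim
    case (elim j)
    have "C * 2 powr (- b * real j) = (C * 2 powr (- c * real j)) * 2 powr (- a * real j)"
      by (simp add: c_def powr_add[symmetric] algebra_simps)
    also have "\<dots> \<le> 1 * 2 powr (- a * real j)" using elim by (intro mult_right_mono) auto
    finally show ?case by simp
  qed
qed

lemma mass_mono: "(\<And>k. k < 2 ^ m \<Longrightarrow> y k \<le> z k) \<Longrightarrow> mass m y l q \<le> mass m z l q"
  unfolding mass_def by (intro sum_mono) auto

lemma mass_additive:
  assumes split: "\<And>l k. \<mu> l k = \<mu> (Suc l) (2 * k) + \<mu> (Suc l) (Suc (2 * k))"
    and "l \<le> m" "q < 2 ^ l"
  shows "mass m (\<mu> m) l q = \<mu> l q"
  using \<open>l \<le> m\<close>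
proof (induction rule: dec_induct)
  case base
  then show ?case using assms(3) by (rule mass_self)
next
  case (step m)
  have "mass (Suc m) (\<mu> (Suc m)) m k = \<mu> m k" if "k < 2 ^ m" for k
  proof -
    have "{k'. k' < 2 ^ Suc m \<and> k' div 2 ^ (Suc m - m) = k} = {2 * k, Suc (2 * k)}"
      using that by auto
    then show ?thesis unfolding mass_def using split[of m k] by simp
  qed
  then have "mass m (mass (Suc m) (\<mu> (Suc m)) m) l q = mass m (\<mu> m) l q" by (rule mass_cong)
  then show ?case using step mass_mass[of l m "Suc m"] by simp
qed

text \<open>In the application \<open>X j k\<close> is the mass given to the selected interval
  \<open>k\<close> of generation \<open>j\<close>, \<open>s\<close> is the Frostman exponent of
  \<open>\<mu>\<close>, \<open>2 powr (- \<beta> * real j)\<close> is the tolerance for random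
  atoms, and \<open>\<theta>\<close> is the margin that pays for all losses. The last two
  assumptions say that both \<open>s\<close> and \<open>\<beta> / \<delta>\<close> exceed the target
  exponent \<open>t\<close> by more than \<open>2 * \<theta>\<close>.\<close>

locale cantor_construction =
  fixes \<mu> X :: "nat \<Rightarrow> nat \<Rightarrow> real" and s t \<delta> \<beta> \<theta> :: real
  assumes \<mu>_nonneg: "0 \<le> \<mu> l k" and \<mu>_root: "0 < \<mu> 0 0"
    and X_nonneg: "0 \<le> X j k"
    and t_pos: "0 < t" and \<delta>: "0 < \<delta>" "\<delta> \<le> 1" and \<theta>_pos: "0 < \<theta>"
    and s_large: "t + 2 * \<theta> < s" and \<beta>_large: "(t + 2 * \<theta>) * \<delta> < \<beta>"
begin

text \<open>The floor makes an interval of this level at most twice as long as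
  \<open>2 powr (- \<delta> * real j)\<close>, whence the factor 2 in the limsup sets.\<close>

definition lev :: "nat \<Rightarrow> nat" where "lev j = nat \<lfloor>\<delta> * real j\<rfloor>"

text \<open>The mass which the selected intervals of generation \<open>j\<close> give to the intervals of level \<open>lev j\<close>,
  except for those whose \<open>\<mu>\<close>-measure is so small that the density of the new mass with respect
  to \<open>\<mu>\<close> could not be controlled.\<close>

definition kept :: "nat \<Rightarrow> nat \<Rightarrow> real" where
  "kept j k = (if 2 powr (- (s + 2 * \<theta>) * real (lev j)) \<le> \<mu> (lev j) k then mass j (X j) (lev j) k else 0)"

lemma lev_le: "real (lev j) \<le> \<delta> * real j" "\<delta> * real j - 1 \<le> real (lev j)"
  using \<delta> by (simp_all add: lev_def)

lemma lev_le_self: "lev j \<le> j"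
proof -
  have "\<delta> * real j \<le> 1 * real j" using \<delta> by (intro mult_right_mono) auto
  then show ?thesis using lev_le(1)[of j] by linarith
qed

lemma kept_nonneg: "0 \<le> kept j k"
  by (simp add: kept_def mass_nonneg X_nonneg)

lemma mass_kept_le:
  assumes "l \<le> lev j" shows "mass (lev j) (kept j) l q \<le> mass j (X j) l q"
proof -
  have "mass (lev j) (kept j) l q \<le> mass (lev j) (mass j (X j) (lev j)) l q"
    by (intro mass_mono) (simp add: kept_def mass_nonneg X_nonneg)
  also have "\<dots> = mass j (X j) l q" by (rule mass_mass[OF assms lev_le_self])
  finally show ?thesis .
qed

text \<open>The bound on the density of \<open>\<nu>\<close> with respect to \<open>\<mu>\<close> leaves room for the constants lost on the
  scales just below \<open>m\<close> when \<open>\<nu>\<close> is refined; on much finer scales the exponent \<open>s > t\<close> absorbs them.\<close>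

definition admissible :: "nat \<Rightarrow> (nat \<Rightarrow> real) \<Rightarrow> bool" where
  "admissible m \<nu> \<longleftrightarrow> (\<forall>k. 0 \<le> \<nu> k) \<and> (\<forall>k<2 ^ m. 32 * \<nu> k \<le> 2 powr ((s - t) * real m) * \<mu> m k) \<and>
     (\<forall>l\<le>m. \<forall>q<2 ^ l. mass m \<nu> l q \<le> 2 * 2 powr (- t * real l))"

text \<open>The first clause makes successive masses compatible; the second places the limiting
  Cantor set near selected points.\<close>

definition refines :: "nat \<Rightarrow> nat \<Rightarrow> (nat \<Rightarrow> real) \<Rightarrow> (nat \<Rightarrow> real) \<Rightarrow> bool" where
  "refines j m \<nu> \<nu>' \<longleftrightarrow> (\<forall>l\<le>m. \<forall>q<2 ^ l. mass (lev j) \<nu>' l q = mass m \<nu> l q) \<and>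
     (\<forall>k<2 ^ lev j. \<nu>' k > 0 \<longrightarrow> (\<exists>k'<2 ^ j. X j k' > 0 \<and> k' div 2 ^ (j - lev j) = k))"

text \<open>The mass \<open>\<nu> a\<close> is redistributed inside the interval \<open>a\<close> in
  proportion to the kept masses. The density bound on \<open>\<nu>\<close> together with
  \<open>H1\<close> limits the ratio of new to kept mass by
  \<open>8 * 2 powr ((s - t) * real m) / 32\<close>, and the factor 4 of \<open>H2\<close> then
  cancels exactly.\<close>

lemma refine:
  assumes adm: "admissible m \<nu>" and ml: "m \<le> lev j"
    and H1: "\<And>a. a < 2 ^ m \<Longrightarrow> \<mu> m a > 0 \<Longrightarrow> \<mu> m a / 8 \<le> mass (lev j) (kept j) m a"
    and H2: "\<And>l q. l \<le> lev j \<Longrightarrow> q < 2 ^ l \<Longrightarrow> 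
      mass j (X j) l q \<le> 4 * (2 powr (- s * real l) + 2 powr (- \<beta> * real j))"
    and S1: "2 powr ((s - t) * real m) * 2 powr (- \<beta> * real j) \<le> 2 powr (- t * real (lev j))"
    and S2: "32 * 2 powr ((s - t) * real m) * (2 powr (- s * real (lev j)) + 2 powr (- \<beta> * real j))
      \<le> 2 powr (- (t + 2 * \<theta>) * real (lev j))"
  obtains \<nu>' where "admissible (lev j) \<nu>'" "refines j m \<nu> \<nu>'"
proof -
  let ?L = "lev j" and ?Y = "kept j"
  let ?par = "\<lambda>k. k div 2 ^ (?L - m)"
  define Z where "Z a = mass ?L ?Y m a" for a
  define \<nu>' where "\<nu>' k = \<nu> (?par k) * ?Y k / Z (?par k)" for k
  have \<nu>: "0 \<le> \<nu> k" for k using adm by (simp add: admissible_def)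
  have \<nu>\<mu>: "32 * \<nu> k \<le> 2 powr ((s - t) * real m) * \<mu> m k" if "k < 2 ^ m" for k
    using adm that by (simp add: admissible_def)
  have Z_nonneg: "0 \<le> Z a" for a unfolding Z_def by (intro mass_nonneg kept_nonneg)
  have ratio: "32 * \<nu> a / Z a \<le> 8 * 2 powr ((s - t) * real m)" if a: "a < 2 ^ m" for a
  proof (cases "\<mu> m a > 0")
    case True
    then have Z: "\<mu> m a / 8 \<le> Z a" unfolding Z_def by (rule H1[OF a])
    then have "Z a > 0" using True by simp
    have "32 * \<nu> a \<le> 2 powr ((s - t) * real m) * (8 * Z a)"
      by (rule order_trans[OF \<nu>\<mu>[OF a]]) (use Z in \<open>auto intro!: mult_left_mono\<close>)
    then show ?thesis using \<open>Z a > 0\<close> by (simp add: divide_le_eq mult_ac)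
  next
    case False
    then have "\<mu> m a = 0" using \<mu>_nonneg[of m a] by simp
    then have "\<nu> a = 0" using \<nu>\<mu>[OF a] \<nu>[of a] by simp
    then show ?thesis by simp
  qed
  have Z_pos: "Z a > 0" if "a < 2 ^ m" "\<nu> a > 0" for a
  proof -
    have "\<mu> m a > 0" 
    proof (rule ccontr)
      assume "\<not> \<mu> m a > 0"
      then have "\<mu> m a = 0" using \<mu>_nonneg[of m a] by simp
      then show False using \<nu>\<mu>[OF that(1)] that(2) by simp
    qed
    then show ?thesis using H1[OF that(1)] by (simp add: Z_def)
  qed
  have par_less: "?par k < 2 ^ m" if "k < 2 ^ ?L" for k :: nat by (rule div_pow_less[OF ml that])
  have \<nu>'_nonneg: "0 \<le> \<nu>' k" for k by (simp add: \<nu>'_def \<nu> kept_nonneg Z_nonneg)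
  have mass_\<nu>': "mass ?L \<nu>' l q = \<nu> (q div 2 ^ (l - m)) / Z (q div 2 ^ (l - m)) * mass ?L ?Y l q"
    if "m \<le> l" "l \<le> ?L" for l q
  proof -
    have "?par k = q div 2 ^ (l - m)" if "k div 2 ^ (?L - l) = q" for k
      using div_pow_div_pow[OF \<open>m \<le> l\<close> \<open>l \<le> ?L\<close>, of k] that by simp
    then show ?thesis unfolding mass_def \<nu>'_def sum_distrib_left
      by (intro sum.cong) auto
  qed
  have mass_m: "mass ?L \<nu>' m a = \<nu> a" if "a < 2 ^ m" for a
  proof (cases "\<nu> a = 0")
    case False
    then have "Z a > 0" using Z_pos[OF that] \<nu>[of a] by simp
    then show ?thesis using mass_\<nu>'[OF order_refl ml, of a] by (simp add: Z_def)
  qed (use mass_\<nu>'[OF order_refl ml, of a] in simp)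
  have mass_small: "mass ?L \<nu>' l q = mass m \<nu> l q" if "l \<le> m" for l q
  proof -
    have "mass ?L \<nu>' l q = mass m (mass ?L \<nu>' m) l q" by (rule mass_mass[OF that ml, symmetric])
    also have "\<dots> = mass m \<nu> l q" by (rule mass_cong[OF mass_m])
    finally show ?thesis .
  qed
  have main: "mass ?L \<nu>' l q \<le> 2 powr ((s - t) * real m) * (2 powr (- s * real l) + 2 powr (- \<beta> * real j))"
    if l: "m \<le> l" "l \<le> ?L" and q: "q < 2 ^ l" for l q
  proof -
    let ?a = "q div 2 ^ (l - m)"
    have a: "?a < 2 ^ m" by (rule div_pow_less[OF l(1) q])
    have "mass ?L \<nu>' l q = \<nu> ?a / Z ?a * mass ?L ?Y l q" by (rule mass_\<nu>'[OF l])
    also have "\<dots> \<le> (8 * 2 powr ((s - t) * real m) / 32) * (4 * (2 powr (- s * real l) + 2 powr (- \<beta> * real j)))"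
    proof (intro mult_mono)
      show "\<nu> ?a / Z ?a \<le> 8 * 2 powr ((s - t) * real m) / 32" using ratio[OF a] by simp
      show "mass ?L ?Y l q \<le> 4 * (2 powr (- s * real l) + 2 powr (- \<beta> * real j))"
        using mass_kept_le[OF l(2)] H2[OF l(2) q] by (rule order_trans)
    qed (auto intro!: mass_nonneg kept_nonneg)
    also have "8 * A / 32 * (4 * B) = A * B" for A B :: real by simp
    finally show ?thesis .
  qed
  have "admissible ?L \<nu>'"
    unfolding admissible_def
  proof (intro conjI allI impI)
    fix k :: nat assume k: "k < 2 ^ ?L"
    \<comment> \<open>Only kept intervals carry new mass, and their lower bound on
      \<open>\<mu>\<close> is just what turns \<open>S2\<close> into the density bound required for
      the next refinement.\<close>
    show "32 * \<nu>' k \<le> 2 powr ((s - t) * real ?L) * \<mu> ?L k"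
    proof (cases "2 powr (- (s + 2 * \<theta>) * real ?L) \<le> \<mu> ?L k")
      case True
      have "32 * \<nu>' k \<le> 32 * (2 powr ((s - t) * real m) * (2 powr (- s * real ?L) + 2 powr (- \<beta> * real j)))"
        using main[OF ml order_refl k] mass_self[OF k, of \<nu>'] by simp
      also have "\<dots> \<le> 2 powr (- (t + 2 * \<theta>) * real ?L)" using S2 by simp
      also have "\<dots> = 2 powr ((s - t) * real ?L) * 2 powr (- (s + 2 * \<theta>) * real ?L)"
        by (simp add: powr_add[symmetric] algebra_simps)
      also have "\<dots> \<le> 2 powr ((s - t) * real ?L) * \<mu> ?L k" using True by (intro mult_left_mono) auto
      finally show ?thesis .
    next
      case False
      then show ?thesis using \<mu>_nonneg[of ?L k] by (simp add: \<nu>'_def kept_def)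
    qed
  next
    fix l q :: nat assume l: "l \<le> ?L" and q: "q < 2 ^ l"
    show "mass ?L \<nu>' l q \<le> 2 * 2 powr (- t * real l)"
    proof (cases "l \<le> m")
      case True
      then show ?thesis using adm q mass_small[OF True, of q] by (simp add: admissible_def)
    next
      case False
      \<comment> \<open>Beyond level \<open>m\<close> the factor
        \<open>2 powr ((s - t) * real m)\<close> is absorbed by passing from the exponent
        \<open>s\<close> to \<open>t\<close>; \<open>S1\<close> absorbs it in the atom term. Each of
        the two terms contributes one unit of the factor 2.\<close>
      have "(s - t) * real m \<le> (s - t) * real l" using s_large \<theta>_pos False by (intro mult_left_mono) auto
      then have "2 powr ((s - t) * real m) * 2 powr (- s * real l) \<le> 2 powr (- t * real l)"
        by (simp add: powr_add[symmetric] algebra_simps)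
      moreover have "2 powr (- t * real ?L) \<le> 2 powr (- t * real l)" using l t_pos by simp
      moreover have "mass ?L \<nu>' l q \<le> 2 powr ((s - t) * real m) * (2 powr (- s * real l) + 2 powr (- \<beta> * real j))"
        using False by (intro main l q) auto
      ultimately show ?thesis using S1 unfolding distrib_left by linarith
    qed
  qed (rule \<nu>'_nonneg)
  moreover have "refines j m \<nu> \<nu>'"
    unfolding refines_def
  proof (intro conjI allI impI mass_small)
    fix k :: nat assume k: "k < 2 ^ ?L" "\<nu>' k > 0"
    then have "?Y k > 0" using kept_nonneg[of j k] by (cases "?Y k = 0") (auto simp: \<nu>'_def)
    then have "mass j (X j) ?L k > 0" by (simp add: kept_def split: if_splits)
    then have "\<exists>k'\<in>{k'. k' < 2 ^ j \<and> k' div 2 ^ (j - ?L) = k}. X j k' > 0"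
      unfolding mass_def using sum_nonpos[of "{k'. k' < 2 ^ j \<and> k' div 2 ^ (j - ?L) = k}" "X j"]
      by (meson not_le)
    then show "\<exists>k'<2 ^ j. X j k' > 0 \<and> k' div 2 ^ (j - ?L) = k" by auto
  qed
  ultimately show ?thesis by (rule that)
qed

lemma eventually_small_1:
  "\<forall>\<^sub>F j in sequentially. C * 2 powr (- \<beta> * real j) \<le> 2 powr (- t * real (lev j))"
proof -
  have "t * \<delta> < \<beta>" using \<beta>_large \<theta>_pos \<delta> by (smt (verit) mult_pos_pos distrib_right)
  from eventually_exponential_le[OF this, of C] show ?thesis
  proof (eventually_elim)
    case (elim j)
    have "t * real (lev j) \<le> t * (\<delta> * real j)" using t_pos lev_le by (intro mult_left_mono) auto
    then have "2 powr (- (t * \<delta>) * real j) \<le> 2 powr (- t * real (lev j))" by (simp add: mult_ac)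
    then show ?case using elim by linarith
  qed
qed

text \<open>Rounding in \<open>lev\<close> costs a factor \<open>2 powr s\<close>. It is absorbed,
  like \<open>2 * C\<close>, by the strict gaps between \<open>t + 2 * \<theta>\<close> and
  \<open>s\<close> and between \<open>(t + 2 * \<theta>) * \<delta>\<close> and
  \<open>\<beta>\<close>.\<close>

lemma eventually_small_2:
  assumes "C > 0"
  shows "\<forall>\<^sub>F j in sequentially. C * (2 powr (- s * real (lev j)) + 2 powr (- \<beta> * real j))
    \<le> 2 powr (- (t + 2 * \<theta>) * real (lev j))"
proof -
  define u where "u = t + 2 * \<theta>"
  have u: "u > 0" "u * \<delta> < s * \<delta>" using t_pos \<theta>_pos s_large \<delta> by (auto simp: u_def)
  show ?thesis using eventually_exponential_le[OF u(2), of "2 * C * 2 powr s"]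
      eventually_exponential_le[OF \<beta>_large, of "2 * C"] unfolding u_def[symmetric]
  proof (eventually_elim)
    case (elim j)
    have "u * real (lev j) \<le> u * (\<delta> * real j)" using u(1) lev_le by (intro mult_left_mono) auto
    then have 1: "2 powr (- (u * \<delta>) * real j) \<le> 2 powr (- u * real (lev j))" by (simp add: mult_ac)
    have "s * (\<delta> * real j - 1) \<le> s * real (lev j)"
      using s_large t_pos \<theta>_pos lev_le by (intro mult_left_mono) auto
    then have "2 powr (- s * real (lev j)) \<le> 2 powr (s + - (s * \<delta>) * real j)" by (simp add: algebra_simps)
    also have "\<dots> = 2 powr s * 2 powr (- (s * \<delta>) * real j)" by (rule powr_add)
    finally have "2 * C * 2 powr (- s * real (lev j)) \<le> 2 * C * (2 powr s * 2 powr (- (s * \<delta>) * real j))"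
      using assms by (intro mult_left_mono) auto
    then show ?case using elim 1 unfolding distrib_left mult.assoc by linarith
  qed
qed

lemma filterlim_lev: "filterlim lev at_top sequentially"
proof -
  have "filterlim (\<lambda>j::nat. \<delta> * real j - 1) at_top sequentially" using \<delta> by real_asymp
  then have "filterlim (\<lambda>j. real (lev j)) at_top sequentially"
    by (rule filterlim_at_top_mono) (simp add: lev_le)
  then show ?thesis using filterlim_sequentially_iff_filterlim_real by blast
qed

text \<open>At each stage the mass on level \<open>m\<close> is already fixed, so only finitely many
  instances of \<open>H1\<close> are required, and all conditions of \<open>refine\<close> hold at
  one sufficiently late generation. Dependent choice iterates this.\<close>

theorem limsup_set_measure_nonzero:
  assumes H1: "\<And>m a. a < 2 ^ m \<Longrightarrow> \<mu> m a > 0 \<Longrightarrow>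
      \<forall>\<^sub>F j in sequentially. \<mu> m a / 8 \<le> mass (lev j) (kept j) m a"
    and H2: "\<forall>\<^sub>F j in sequentially. \<forall>l\<le>j. \<forall>q<2 ^ l.
      mass j (X j) l q \<le> 4 * (2 powr (- s * real l) + 2 powr (- \<beta> * real j))"
  shows "hausdorff_measure t {x \<in> {0..1}. \<forall>J. \<exists>j\<ge>J. \<exists>k<2 ^ j. X j k > 0 \<and>
     \<bar>x - real k / 2 ^ j\<bar> \<le> 2 * 2 powr (- \<delta> * real j)} \<noteq> 0"
proof -
  \<comment> \<open>The starting mass meets both bounds of \<open>admissible 0\<close>:
    \<open>\<mu> 0 0 / 32\<close> for the density and 2 for the size. In the transition relation,
    \<open>j > i\<close> drives the generations to infinity.\<close>
  let ?P = "\<lambda>(i::nat) (p :: nat \<times> (nat \<Rightarrow> real)). admissible (fst p) (snd p) \<and> (i = 0 \<longrightarrow> p = (0, \<lambda>k. if k = 0 then min 2 (\<mu> 0 0 / 32) else 0))"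
  let ?Q = "\<lambda>i p p'. \<exists>j>i. fst p' = lev j \<and> fst p < lev j \<and> refines j (fst p) (snd p) (snd p')"
  have "\<exists>f. \<forall>i. ?P i (f i) \<and> ?Q i (f i) (f (Suc i))"
  proof (rule dependent_nat_choice)
    have "admissible 0 (\<lambda>k. if k = 0 then min 2 (\<mu> 0 0 / 32) else 0)"
      using \<mu>_root by (auto simp: admissible_def mass_self)
    then show "\<exists>x. ?P 0 x" by auto
  next
    fix p i assume "?P i p"
    then have adm: "admissible (fst p) (snd p)" by simp
    let ?m = "fst p"
    have "\<forall>\<^sub>F j in sequentially. \<forall>a\<in>{a. a < 2 ^ ?m \<and> \<mu> ?m a > 0}. \<mu> ?m a / 8 \<le> mass (lev j) (kept j) ?m a"
      using H1 by (intro eventually_ball_finite) auto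
    moreover have "\<forall>\<^sub>F j in sequentially. ?m < lev j"
      by (rule eventually_compose_filterlim[OF eventually_gt_at_top filterlim_lev])
    moreover have "\<forall>\<^sub>F j in sequentially. 32 * 2 powr ((s - t) * real ?m) * (2 powr (- s * real (lev j)) + 2 powr (- \<beta> * real j))
      \<le> 2 powr (- (t + 2 * \<theta>) * real (lev j))" by (rule eventually_small_2) simp
    ultimately have "\<forall>\<^sub>F j in sequentially. (\<forall>a\<in>{a. a < 2 ^ ?m \<and> \<mu> ?m a > 0}. \<mu> ?m a / 8 \<le> mass (lev j) (kept j) ?m a)
        \<and> ?m < lev j \<and> (\<forall>l\<le>j. \<forall>q<2 ^ l. mass j (X j) l q \<le> 4 * (2 powr (- s * real l) + 2 powr (- \<beta> * real j)))
        \<and> 2 powr ((s - t) * real ?m) * 2 powr (- \<beta> * real j) \<le> 2 powr (- t * real (lev j))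
        \<and> 32 * 2 powr ((s - t) * real ?m) * (2 powr (- s * real (lev j)) + 2 powr (- \<beta> * real j))
          \<le> 2 powr (- (t + 2 * \<theta>) * real (lev j)) \<and> i < j"
      using H2 eventually_small_1[of "2 powr ((s - t) * real ?m)"] eventually_gt_at_top[of i] by eventually_elim blast
    then obtain j where j: "\<And>a. a < 2 ^ ?m \<Longrightarrow> \<mu> ?m a > 0 \<Longrightarrow> \<mu> ?m a / 8 \<le> mass (lev j) (kept j) ?m a"
       "?m < lev j" "\<And>l q. l \<le> j \<Longrightarrow> q < 2 ^ l \<Longrightarrow> mass j (X j) l q \<le> 4 * (2 powr (- s * real l) + 2 powr (- \<beta> * real j))"
       "2 powr ((s - t) * real ?m) * 2 powr (- \<beta> * real j) \<le> 2 powr (- t * real (lev j))"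
       "32 * 2 powr ((s - t) * real ?m) * (2 powr (- s * real (lev j)) + 2 powr (- \<beta> * real j))
          \<le> 2 powr (- (t + 2 * \<theta>) * real (lev j))" "i < j"
      unfolding eventually_sequentially by blast
    obtain \<nu>' where "admissible (lev j) \<nu>'" "refines j ?m (snd p) \<nu>'"
      by (rule refine[OF adm, of j]) (use j lev_le_self[of j] in auto)
    then show "\<exists>y. ?P (Suc i) y \<and> ?Q i p y" using j by (intro exI[of _ "(lev j, \<nu>')"]) auto
  qed
  then obtain f where f: "\<And>i. ?P i (f i)" "\<And>i. ?Q i (f i) (f (Suc i))" by blast
  define m where "m i = fst (f i)" for i
  define \<nu> where "\<nu> i = snd (f i)" for i
  have adm: "admissible (m i) (\<nu> i)" for i using f(1)[of i] by (simp add: m_def \<nu>_def)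
  have ref: "\<exists>j>i. m (Suc i) = lev j \<and> m i < lev j \<and> refines j (m i) (\<nu> i) (\<nu> (Suc i))" for i
    using f(2)[of i] by (simp add: m_def \<nu>_def)
  have "hausdorff_measure t (\<Inter>n. \<Union>k\<in>{k. k < 2 ^ m n \<and> \<nu> n k > 0}. closed_dyadic (m n) k) \<noteq> 0"
  proof (rule cantor_hausdorff_measure_nonzero[OF t_pos])
    show "strict_mono m" unfolding strict_mono_Suc_iff using ref by metis
    show "0 \<le> \<nu> n k" for n k using adm[of n] by (simp add: admissible_def)
    show "mass (m (Suc n)) (\<nu> (Suc n)) l q = mass (m n) (\<nu> n) l q" if "l \<le> m n" "q < 2 ^ l" for n l q
      using ref[of n] that unfolding refines_def by auto
    show "mass (m n) (\<nu> n) l q \<le> 2 * 2 powr (- t * real l)" if "l \<le> m n" "q < 2 ^ l" for n l q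
      using adm[of n] that by (simp add: admissible_def)
    show "mass (m 0) (\<nu> 0) 0 0 > 0" using f(1)[of 0] \<mu>_root by (simp add: m_def \<nu>_def mass_self)
  qed
  moreover have "(\<Inter>n. \<Union>k\<in>{k. k < 2 ^ m n \<and> \<nu> n k > 0}. closed_dyadic (m n) k) \<subseteq>
    {x \<in> {0..1}. \<forall>J. \<exists>j\<ge>J. \<exists>k<2 ^ j. X j k > 0 \<and> \<bar>x - real k / 2 ^ j\<bar> \<le> 2 * 2 powr (- \<delta> * real j)}" (is "?K \<subseteq> ?E")
  proof
    fix x assume x: "x \<in> ?K"
    have "\<exists>j\<ge>J. \<exists>k<2 ^ j. X j k > 0 \<and> \<bar>x - real k / 2 ^ j\<bar> \<le> 2 * 2 powr (- \<delta> * real j)" for J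
    proof -
      obtain j where j: "j > J" "m (Suc J) = lev j" "refines j (m J) (\<nu> J) (\<nu> (Suc J))" using ref[of J] by blast
      obtain k where k: "k < 2 ^ lev j" "\<nu> (Suc J) k > 0" "x \<in> closed_dyadic (lev j) k"
        using INT_D[OF x UNIV_I, of "Suc J"] unfolding j(2) by blast
      obtain k' where k': "k' < 2 ^ j" "X j k' > 0" "k' div 2 ^ (j - lev j) = k"
        using j(3) k(1,2) unfolding refines_def by blast
      \<comment> \<open>Both \<open>x\<close> and the selected point lie in one closed interval of
        level \<open>lev j\<close>, so their distance is at most its length.\<close>
      have "real k' / 2 ^ j \<in> closed_dyadic j k'" by (auto simp: closed_dyadic_def divide_right_mono)
      then have "real k' / 2 ^ j \<in> closed_dyadic (lev j) k"
        using closed_dyadic_parent[OF lev_le_self, of j k'] k'(3) by auto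
      then have "\<bar>x - real k' / 2 ^ j\<bar> \<le> (real k + 1) / 2 ^ lev j - real k / 2 ^ lev j"
        using k(3) unfolding closed_dyadic_def by auto
      also have "\<dots> = 2 powr (- real (lev j))"
        by (simp add: diff_divide_distrib[symmetric] powr_minus powr_realpow field_simps)
      also have "\<dots> \<le> 2 powr (1 + - \<delta> * real j)" using lev_le(2)[of j] by simp
      also have "\<dots> = 2 * 2 powr (- \<delta> * real j)" by (simp only: powr_add) simp
      finally show ?thesis using j k' by (intro exI[of _ j]) auto
    qed
    moreover have "x \<in> {0..1}"
    proof -
      obtain k where "k < 2 ^ m 0" "x \<in> closed_dyadic (m 0) k" using INT_D[OF x UNIV_I, of 0] by blast
      then show ?thesis using f(1)[of 0] by (simp add: m_def closed_dyadic_def)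
    qed
    ultimately show "x \<in> ?E" by blast
  qed
  ultimately show ?thesis
    by (rule hausdorff_measure_nonzero_mono[rotated])
qed

end

section \<open>Random selections\<close>

context prob_space
begin

text \<open>Independence turns the moment into a product of factors
  \<open>1 + p * (exp (w a) - 1)\<close>, and \<open>1 + x \<le> exp x\<close> collects them into a
  single exponential.\<close>

lemma exp_moment_bernoulli_sum:
  fixes \<xi> :: "'i \<Rightarrow> 'a \<Rightarrow> bool" and w :: "'i \<Rightarrow> real"
  assumes A: "finite A" and ind: "indep_vars (\<lambda>_. count_space UNIV) \<xi> A"
    and distr: "\<And>a. a \<in> A \<Longrightarrow> distr M (count_space UNIV) (\<xi> a) = measure_pmf (bernoulli_pmf p)"
    and p: "0 \<le> p" "p \<le> 1"
  shows "integrable M (\<lambda>\<omega>. exp (\<Sum>a\<in>A. w a * of_bool (\<xi> a \<omega>)))"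
    and "expectation (\<lambda>\<omega>. exp (\<Sum>a\<in>A. w a * of_bool (\<xi> a \<omega>))) \<le> exp (p * (\<Sum>a\<in>A. exp (w a) - 1))"
proof -
  define g where "g a \<omega> = exp (w a * of_bool (\<xi> a \<omega>))" for a \<omega>
  have eq: "exp (\<Sum>a\<in>A. w a * of_bool (\<xi> a \<omega>)) = (\<Prod>a\<in>A. g a \<omega>)" for \<omega>
    unfolding g_def by (rule exp_sum[OF A])
  have ind_g: "indep_vars (\<lambda>_. borel) g A"
    unfolding g_def by (rule indep_vars_compose2[OF ind]) auto
  have meas: "\<xi> a \<in> measurable M (count_space UNIV)" if "a \<in> A" for a
    using ind that by (auto simp: indep_vars_def)
  have int: "integrable M (g a)" if "a \<in> A" for a
  proof (rule integrable_const_bound[of _ "exp \<bar>w a\<bar>"])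
    show "g a \<in> borel_measurable M" unfolding g_def using meas[OF that] by measurable
  qed (auto simp: g_def)
  have exp_g: "expectation (g a) = 1 + p * (exp (w a) - 1)" if "a \<in> A" for a
  proof -
    have "expectation (g a) = (\<integral>x. exp (w a * of_bool x) \<partial>distr M (count_space UNIV) (\<xi> a))"
      unfolding g_def by (rule integral_distr[symmetric]) (use meas[OF that] in auto)
    also have "\<dots> = 1 + p * (exp (w a) - 1)" by (simp add: distr[OF that] p algebra_simps)
    finally show ?thesis .
  qed
  show "integrable M (\<lambda>\<omega>. exp (\<Sum>a\<in>A. w a * of_bool (\<xi> a \<omega>)))"
    unfolding eq by (rule indep_vars_integrable[OF A ind_g int])
  have "expectation (\<lambda>\<omega>. exp (\<Sum>a\<in>A. w a * of_bool (\<xi> a \<omega>))) = (\<Prod>a\<in>A. 1 + p * (exp (w a) - 1))"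
    unfolding eq using indep_vars_lebesgue_integral[OF A ind_g int] exp_g by simp
  also have "\<dots> \<le> (\<Prod>a\<in>A. exp (p * (exp (w a) - 1)))"
  proof (intro prod_mono conjI)
    fix a assume "a \<in> A"
    have "0 \<le> (1 - p) + p * exp (w a)" using p by (intro add_nonneg_nonneg) auto
    then show "0 \<le> 1 + p * (exp (w a) - 1)" by (simp add: algebra_simps)
  qed simp
  also have "\<dots> = exp (p * (\<Sum>a\<in>A. exp (w a) - 1))" by (simp add: exp_sum A sum_distrib_left)
  finally show "expectation (\<lambda>\<omega>. exp (\<Sum>a\<in>A. w a * of_bool (\<xi> a \<omega>))) \<le> exp (p * (\<Sum>a\<in>A. exp (w a) - 1))" .
qed

text \<open>Chernoff's method with parameter \<open>1 / b\<close>: the scaled weights lie between 0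
  and 1, where \<open>exp x - 1 \<le> 2 * x\<close> and \<open>exp (- x) - 1 \<le> - x / 2\<close>.
  Passing beyond twice or below half the mean thus costs an exponent measured in units of the
  largest weight.\<close>

lemma bernoulli_sum_tails:
  fixes \<xi> :: "'i \<Rightarrow> 'a \<Rightarrow> bool" and w :: "'i \<Rightarrow> real"
  assumes A: "finite A" and ind: "indep_vars (\<lambda>_. count_space UNIV) \<xi> A"
    and distr: "\<And>a. a \<in> A \<Longrightarrow> distr M (count_space UNIV) (\<xi> a) = measure_pmf (bernoulli_pmf p)"
    and p: "0 \<le> p" "p \<le> 1" and b: "0 < b" and w: "\<And>a. a \<in> A \<Longrightarrow> 0 \<le> w a" "\<And>a. a \<in> A \<Longrightarrow> w a \<le> b"
  shows "prob {\<omega> \<in> space M. T \<le> (\<Sum>a\<in>A. w a * of_bool (\<xi> a \<omega>))} \<le> exp ((2 * (p * (\<Sum>a\<in>A. w a)) - T) / b)"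
    and "prob {\<omega> \<in> space M. (\<Sum>a\<in>A. w a * of_bool (\<xi> a \<omega>)) \<le> T} \<le> exp ((T - p * (\<Sum>a\<in>A. w a) / 2) / b)"
proof -
  let ?S = "\<lambda>\<omega>. \<Sum>a\<in>A. w a * of_bool (\<xi> a \<omega>)"
  have wb: "0 \<le> w a / b" "w a / b \<le> 1" if "a \<in> A" for a using w[OF that] b by auto
  have S: "(\<Sum>a\<in>A. (w a / b) * of_bool (\<xi> a \<omega>)) = ?S \<omega> / b"
    "(\<Sum>a\<in>A. (- w a / b) * of_bool (\<xi> a \<omega>)) = - ?S \<omega> / b" for \<omega>
    by (simp_all add: sum_divide_distrib sum_negf)
  note m1 = exp_moment_bernoulli_sum[OF A ind distr p, of "\<lambda>a. w a / b", unfolded S]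
  note m2 = exp_moment_bernoulli_sum[OF A ind distr p, of "\<lambda>a. - w a / b", unfolded S]
  have e1: "exp (w a / b) - 1 \<le> 2 * w a / b" if "a \<in> A" for a
  proof -
    have "(w a / b)\<^sup>2 \<le> w a / b * 1" unfolding power2_eq_square using wb[OF that] by (intro mult_left_mono) auto
    then show ?thesis using exp_bound[OF wb[OF that]] by simp
  qed
  have e2: "exp (- w a / b) - 1 \<le> - (w a / b) / 2" if "a \<in> A" for a
  proof -
    let ?x = "w a / b"
    \<comment> \<open>The product equals \<open>1 + x * (1 - x) / 2\<close>.\<close>
    have "1 \<le> (1 - x / 2) * (1 + x)" if "0 \<le> x" "x \<le> 1" for x :: real
    proof -
      have "0 \<le> x * (1 - x)" using that by (intro mult_nonneg_nonneg) auto
      then show ?thesis by (simp add: field_simps)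
    qed
    from this[OF wb[OF that]] have "1 \<le> (1 - ?x / 2) * (1 + ?x)" .
    also have "\<dots> \<le> (1 - ?x / 2) * exp ?x" using wb[OF that] exp_ge_add_one_self[of ?x] by (intro mult_left_mono) auto
    finally have "exp (- ?x) \<le> 1 - ?x / 2" by (simp add: exp_minus field_simps)
    then show ?thesis by simp
  qed
  have "prob {\<omega> \<in> space M. T \<le> ?S \<omega>} = prob {\<omega> \<in> space M. exp (T / b) \<le> exp (?S \<omega> / b)}"
    using b by (simp add: divide_le_cancel)
  also have "\<dots> \<le> expectation (\<lambda>\<omega>. exp (?S \<omega> / b)) / exp (T / b)"
    by (rule integral_Markov_inequality_measure[OF m1(1), of "{}"]) auto
  also have "\<dots> \<le> exp (p * (\<Sum>a\<in>A. 2 * w a / b)) / exp (T / b)"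
    by (intro divide_right_mono order_trans[OF m1(2)]) (auto intro!: mult_left_mono sum_mono e1 p)
  also have "(\<Sum>a\<in>A. 2 * w a / b) = 2 * (\<Sum>a\<in>A. w a) / b" by (simp add: sum_distrib_left sum_divide_distrib)
  also have "exp (p * (2 * (\<Sum>a\<in>A. w a) / b)) / exp (T / b) = exp ((2 * (p * (\<Sum>a\<in>A. w a)) - T) / b)"
    by (simp add: exp_diff[symmetric] diff_divide_distrib mult_ac)
  finally show "prob {\<omega> \<in> space M. T \<le> ?S \<omega>} \<le> exp ((2 * (p * (\<Sum>a\<in>A. w a)) - T) / b)" .
  have "prob {\<omega> \<in> space M. ?S \<omega> \<le> T} = prob {\<omega> \<in> space M. exp (- T / b) \<le> exp (- ?S \<omega> / b)}"
    using b by (simp add: divide_le_cancel)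
  also have "\<dots> \<le> expectation (\<lambda>\<omega>. exp (- ?S \<omega> / b)) / exp (- T / b)"
    by (rule integral_Markov_inequality_measure[OF m2(1), of "{}"]) auto
  also have "\<dots> \<le> exp (p * (\<Sum>a\<in>A. - (w a / b) / 2)) / exp (- T / b)"
  proof (intro divide_right_mono order_trans[OF m2(2)])
    have "p * (\<Sum>a\<in>A. exp (- w a / b) - 1) \<le> p * (\<Sum>a\<in>A. - (w a / b) / 2)"
      by (intro mult_left_mono sum_mono e2 p)
    then show "exp (p * (\<Sum>a\<in>A. exp (- w a / b) - 1)) \<le> exp (p * (\<Sum>a\<in>A. - (w a / b) / 2))" by simp
  qed auto
  also have "(\<Sum>a\<in>A. - (w a / b) / 2) = - (\<Sum>a\<in>A. w a) / 2 / b"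
    by (simp add: sum_divide_distrib sum_negf mult.commute)
  also have "exp (p * (- (\<Sum>a\<in>A. w a) / 2 / b)) / exp (- T / b) = exp ((T - p * (\<Sum>a\<in>A. w a) / 2) / b)"
    by (simp add: exp_diff[symmetric] diff_divide_distrib mult_ac)
  finally show "prob {\<omega> \<in> space M. ?S \<omega> \<le> T} \<le> exp ((T - p * (\<Sum>a\<in>A. w a) / 2) / b)" .
qed

lemma borel_cantelli_bigo:
  assumes "\<And>n. {\<omega> \<in> space M. P n \<omega>} \<in> events" and "\<And>n. prob {\<omega> \<in> space M. P n \<omega>} \<le> f n"
    and "f \<in> O(\<lambda>n. (1 / 2) ^ n)"
  shows "AE \<omega> in M. \<forall>\<^sub>F n in sequentially. \<not> P n \<omega>"
proof -
  have "summable f"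
    by (rule summable_comparison_test_bigo[OF _ assms(3)]) (simp add: summable_geometric norm_power)
  then have "summable (\<lambda>n. prob {\<omega> \<in> space M. P n \<omega>})"
    by (rule summable_comparison_test'[where N = 0]) (use assms(2) in auto)
  then have "AE \<omega> in M. \<forall>\<^sub>F n in sequentially. \<omega> \<in> space M - {\<omega> \<in> space M. P n \<omega>}"
    by (intro borel_cantelli_AE1 assms(1)) (auto simp: emeasure_eq_measure)
  then show ?thesis by eventually_elim (auto elim: eventually_mono)
qed

end

locale lacunary_row = prob_space M for M :: "'w measure" +
  fixes I :: "real set" and \<eta> :: real and \<xi> :: "nat \<Rightarrow> nat \<Rightarrow> 'w \<Rightarrow> bool"
  assumes lac: "lacunary_coefficients M I \<eta> \<xi>" and \<eta>_le: "\<eta> \<le> hausdorff_dim I"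
begin

definition p where "p j = 2 powr ((\<eta> - hausdorff_dim I) * real j)"

lemma p_bounds: "0 \<le> p j" "p j \<le> 1"
proof -
  show "p j \<le> 1" using \<eta>_le powr_mono[of "(\<eta> - hausdorff_dim I) * real j" 0 2]
    by (simp add: p_def mult_nonpos_nonneg)
qed (simp add: p_def)

lemma row_measurable:
  assumes "k \<in> dyadic_indices I j" shows "\<xi> j k \<in> measurable M (count_space UNIV)"
proof -
  have "(case (j, k) of (j, k) \<Rightarrow> \<xi> j k) \<in> measurable M (count_space UNIV)"
    using lac assms unfolding lacunary_coefficients_def indep_vars_def by blast
  then show ?thesis by simp
qed

lemma row_sum_measurable:
  assumes "B \<subseteq> dyadic_indices I j"
  shows "(\<lambda>\<omega>. \<Sum>k\<in>B. w k * of_bool (\<xi> j k \<omega>) :: real) \<in> borel_measurable M"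
proof (intro borel_measurable_sum borel_measurable_times)
  fix k assume "k \<in> B"
  then have "\<xi> j k \<in> measurable M (count_space UNIV)" using assms by (intro row_measurable) auto
  then show "(\<lambda>\<omega>. of_bool (\<xi> j k \<omega>) :: real) \<in> borel_measurable M" by measurable
qed simp

lemma row_tails:
  assumes B: "B \<subseteq> dyadic_indices I j" and b: "0 < b"
    and w: "\<And>k. k \<in> B \<Longrightarrow> 0 \<le> w k" "\<And>k. k \<in> B \<Longrightarrow> w k \<le> b"
  shows "prob {\<omega> \<in> space M. T \<le> (\<Sum>k\<in>B. w k * of_bool (\<xi> j k \<omega>))} \<le> exp ((2 * (p j * (\<Sum>k\<in>B. w k)) - T) / b)"
    and "prob {\<omega> \<in> space M. (\<Sum>k\<in>B. w k * of_bool (\<xi> j k \<omega>)) \<le> T} \<le> exp ((T - p j * (\<Sum>k\<in>B. w k) / 2) / b)"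
proof -
  let ?A = "Pair j ` B" and ?\<xi> = "\<lambda>(j, k). \<xi> j k" and ?w = "\<lambda>a :: nat \<times> nat. w (snd a)"
  have fin: "finite ?A" using B by (intro finite_imageI) (auto intro: finite_subset)
  have ind: "indep_vars (\<lambda>_. count_space UNIV) ?\<xi> ?A"
    using lac B unfolding lacunary_coefficients_def by (auto intro: indep_vars_subset)
  have dist: "distr M (count_space UNIV) (?\<xi> a) = measure_pmf (bernoulli_pmf (p j))" if "a \<in> ?A" for a
    using lac B that unfolding lacunary_coefficients_def p_def by auto
  have sums: "(\<Sum>a\<in>?A. ?w a * of_bool (?\<xi> a \<omega>)) = (\<Sum>k\<in>B. w k * of_bool (\<xi> j k \<omega>))"
    "(\<Sum>a\<in>?A. ?w a) = (\<Sum>k\<in>B. w k)" for \<omega>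
    by (simp_all add: sum.reindex inj_on_def)
  have w': "0 \<le> ?w a" "?w a \<le> b" if "a \<in> ?A" for a using that w by auto
  note T = bernoulli_sum_tails[where w = ?w and T = T, OF fin ind dist p_bounds b w', unfolded sums]
  show "prob {\<omega> \<in> space M. T \<le> (\<Sum>k\<in>B. w k * of_bool (\<xi> j k \<omega>))} \<le> exp ((2 * (p j * (\<Sum>k\<in>B. w k)) - T) / b)"
    using T(1) by simp
  show "prob {\<omega> \<in> space M. (\<Sum>k\<in>B. w k * of_bool (\<xi> j k \<omega>)) \<le> T} \<le> exp ((T - p j * (\<Sum>k\<in>B. w k) / 2) / b)"
    using T(2) by simp
qed

text \<open>Box counting eventually bounds the mean by
  \<open>2 powr ((\<eta> + e) * real j)\<close>. A threshold of three times this exceeds twice the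
  mean by an amount that makes the tails summable.\<close>

lemma AE_eventually_count_le:
  assumes I: "bounded I" "upper_box_dim I \<le> ereal (hausdorff_dim I)" and e: "e > 0" and \<eta>: "0 < \<eta>"
  shows "AE \<omega> in M. \<forall>\<^sub>F j in sequentially.
    real (card {k \<in> dyadic_indices I j. \<xi> j k \<omega>}) \<le> 3 * 2 powr ((\<eta> + e) * real j)"
proof -
  let ?d = "hausdorff_dim I"
  define c where "c = \<eta> + e"
  have c: "c > 0" using e \<eta> by (simp add: c_def)
  define q where "q j = 3 * 2 powr (c * real j)" for j
  \<comment> \<open>The counting bound holds only eventually, whereas Borel-Cantelli is used with an
    estimate for every \<open>j\<close>. Making the bound part of the event leaves the event empty
    whenever it fails.\<close>
  define ok where "ok j \<longleftrightarrow> real (card (dyadic_indices I j)) \<le> 2 powr ((?d + e) * real j)" for j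
  have ev: "\<forall>\<^sub>F j in sequentially. ok j" unfolding ok_def by (rule eventually_card_dyadic_indices_le[OF I e])
  have card_eq: "real (card {k \<in> dyadic_indices I j. \<xi> j k \<omega>}) = (\<Sum>k\<in>dyadic_indices I j. 1 * of_bool (\<xi> j k \<omega>))" for j \<omega>
    by (simp add: of_bool_def sum.If_cases Int_def)
  have "AE \<omega> in M. \<forall>\<^sub>F j in sequentially. \<not> (ok j \<and> q j \<le> real (card {k \<in> dyadic_indices I j. \<xi> j k \<omega>}))"
  proof (rule borel_cantelli_bigo)
    fix j
    show "{\<omega> \<in> space M. ok j \<and> q j \<le> real (card {k \<in> dyadic_indices I j. \<xi> j k \<omega>})} \<in> events"
      unfolding card_eq using row_sum_measurable[OF order_refl, where w = "\<lambda>_. 1"] by measurable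
    show "prob {\<omega> \<in> space M. ok j \<and> q j \<le> real (card {k \<in> dyadic_indices I j. \<xi> j k \<omega>})} \<le> exp (- (2 powr (c * real j)))"
    proof (cases "ok j")
      case True
      have "p j * real (card (dyadic_indices I j)) \<le> p j * 2 powr ((?d + e) * real j)"
        using True p_bounds by (intro mult_left_mono) (auto simp: ok_def)
      also have "\<dots> = 2 powr (c * real j)" by (simp add: p_def c_def powr_add[symmetric] algebra_simps)
      finally have "(2 * (p j * (\<Sum>k\<in>dyadic_indices I j. 1)) - q j) / 1 \<le> - (2 powr (c * real j))" by (simp add: q_def)
      then show ?thesis unfolding card_eq
        using row_tails(1)[OF order_refl zero_less_one, where j = j and w = "\<lambda>_. 1" and T = "q j"] True
        by (simp del: sum_constant) (meson exp_le_cancel_iff order_trans)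
    qed simp
  next
    show "(\<lambda>j::nat. exp (- (2 powr (c * real j)))) \<in> O(\<lambda>n. (1 / 2) ^ n)" using c by real_asymp
  qed
  then show ?thesis
  proof eventually_elim
    case (elim \<omega>)
    from elim ev show ?case by eventually_elim (auto simp: q_def c_def)
  qed
qed

end

context lacunary_row
begin

lemma p_inverse: "p j * 2 powr ((hausdorff_dim I - \<eta>) * real j) = 1"
  by (simp add: p_def powr_add[symmetric] algebra_simps)

text \<open>The condition \<open>t < hausdorff_dim I\<close> leaves room for a Frostman exponent
  above \<open>t\<close>. The condition \<open>t * \<delta> < \<eta>\<close> says that atoms of size
  about \<open>2 powr (- \<eta> * real j)\<close> are small against the mass allowed to an interval
  of length \<open>2 powr (- \<delta> * real j)\<close>.\<close>

theorem AE_limsup_set_measure_nonzero: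
  assumes I: "I \<subseteq> {0..1}" "upper_box_dim I \<le> ereal (hausdorff_dim I)"
    and \<delta>: "0 < \<delta>" "\<delta> \<le> 1" and t: "0 < t" "t < hausdorff_dim I" "t * \<delta> < \<eta>"
  shows "AE \<omega> in M. hausdorff_measure t {x \<in> {0..1}. \<forall>J. \<exists>j\<ge>J. \<exists>k\<in>dyadic_indices I j. \<xi> j k \<omega> \<and>
     \<bar>x - real k / 2 ^ j\<bar> \<le> 2 * 2 powr (- \<delta> * real j)} \<noteq> 0"
proof -
  let ?d = "hausdorff_dim I"
  \<comment> \<open>With \<open>s\<close> and \<open>\<beta>\<close> as below it suffices that
    \<open>3 * \<theta> < ?d - t\<close> and, as \<open>\<delta> \<le> 1\<close>, that
    \<open>4 * \<theta> < \<eta> - t * \<delta>\<close>; a fifth of the smaller gap meets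
    both.\<close>
  define \<theta> where "\<theta> = min (?d - t) (\<eta> - t * \<delta>) / 5"
  define s where "s = ?d - \<theta>"
  define \<beta> where "\<beta> = \<eta> - 2 * \<theta>"
  have \<theta>: "\<theta> > 0" "5 * \<theta> \<le> ?d - t" "5 * \<theta> \<le> \<eta> - t * \<delta>" using t by (auto simp: \<theta>_def)
  have "t * \<delta> > 0" using t \<delta> by simp
  have "\<theta> * \<delta> \<le> \<theta> * 1" using \<theta> \<delta> by (intro mult_left_mono) auto
  then have params: "t + 2 * \<theta> < s" "(t + 2 * \<theta>) * \<delta> < \<beta>" "s > 0" "\<eta> - \<theta> > 0"
    using \<theta> t \<open>t * \<delta> > 0\<close> unfolding s_def \<beta>_def distrib_right by linarith+
  have "hausdorff_measure s I \<noteq> 0" using params \<theta> by (intro hausdorff_measure_nonzero) (auto simp: s_def)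
  then obtain \<mu> :: "nat \<Rightarrow> nat \<Rightarrow> real" where \<mu>: "\<And>l k. 0 \<le> \<mu> l k"
    "\<And>l k. \<mu> l k = \<mu> (Suc l) (2 * k) + \<mu> (Suc l) (Suc (2 * k))"
    "\<And>l k. \<mu> l k \<le> 2 powr (- s * real l)" "\<And>l k. k \<notin> dyadic_indices I l \<Longrightarrow> \<mu> l k = 0" "\<mu> 0 0 > 0"
    using dyadic_frostman[OF params(3) _ I(1)] by metis
  define w where "w j k = 2 powr ((?d - \<eta>) * real j) * \<mu> j k" for j k
  define X where "X \<omega> j k = w j k * of_bool (\<xi> j k \<omega>)" for \<omega> j k
  \<comment> \<open>The largest possible weight: the factor
    \<open>2 powr ((?d - \<eta>) * real j)\<close> and the Frostman bound combine to the exponent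
    \<open>?d - \<eta> - s = - (\<eta> - \<theta>)\<close>.\<close>
  define b where "b j = 2 powr (- (\<eta> - \<theta>) * real j)" for j
  have w_nonneg: "0 \<le> w j k" for j k using \<mu>(1) by (simp add: w_def)
  have pw: "p j * (\<Sum>k\<in>B. w j k * c k) = (\<Sum>k\<in>B. \<mu> j k * c k)" for j B and c :: "nat \<Rightarrow> real"
  proof -
    have "p j * (w j k * c k) = (p j * 2 powr ((?d - \<eta>) * real j)) * (\<mu> j k * c k)" for k
      by (simp only: w_def mult_ac)
    then have "p j * (w j k * c k) = \<mu> j k * c k" for k unfolding p_inverse mult_1 .
    then show ?thesis by (simp only: sum_distrib_left)
  qed
  have w_le: "w j k \<le> b j" for j k
  proof -
    have "w j k \<le> 2 powr ((?d - \<eta>) * real j) * 2 powr (- s * real j)"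
      unfolding w_def by (intro mult_left_mono \<mu>) auto
    also have "\<dots> = b j" by (simp add: b_def s_def powr_add[symmetric] algebra_simps)
    finally show ?thesis .
  qed
  have b_pos: "0 < b j" for j by (simp add: b_def)
  have loc: "cantor_construction \<mu> (X \<omega>) s t \<delta> \<beta> \<theta>" for \<omega>
    by unfold_locales (use \<mu>(1,5) w_nonneg t \<delta> \<theta> params in \<open>auto simp: X_def\<close>)
  define B where "B j l q = {k \<in> dyadic_indices I j. k div 2 ^ (j - l) = q}" for j l q
  have B_sub: "B j l q \<subseteq> dyadic_indices I j" for j l q by (auto simp: B_def)
  have mass_B: "mass j y l q = (\<Sum>k\<in>B j l q. y k)" if "\<And>k. k \<notin> dyadic_indices I j \<Longrightarrow> y k = 0" for j y l q
    unfolding mass_def B_def by (rule sum.mono_neutral_right) (auto simp: that dyadic_indices_def)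

  \<comment> \<open>Upper bounds for the random masses of all dyadic intervals\<close>
  have H2: "AE \<omega> in M. \<forall>\<^sub>F j in sequentially. \<not> (\<exists>l\<in>{..j}. \<exists>q\<in>{..<2 ^ l}.
      4 * (2 powr (- s * real l) + 2 powr (- \<beta> * real j)) \<le> mass j (X \<omega> j) l q)"
  proof (rule borel_cantelli_bigo)
    fix j
    let ?T = "\<lambda>l. 4 * (2 powr (- s * real l) + 2 powr (- \<beta> * real j))"
    define E where "E l q = {\<omega> \<in> space M. ?T l \<le> (\<Sum>k\<in>B j l q. w j k * of_bool (\<xi> j k \<omega>))}" for l q
    have eq: "{\<omega> \<in> space M. \<exists>l\<in>{..j}. \<exists>q\<in>{..<2 ^ l}. ?T l \<le> mass j (X \<omega> j) l q} =
        (\<Union>l\<in>{..j}. \<Union>q\<in>{..<2 ^ l}. E l q)"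
      by (subst mass_B) (auto simp: X_def w_def \<mu>(4) E_def)
    have E_meas: "E l q \<in> events" for l q
      unfolding E_def
      using row_sum_measurable[OF B_sub[of j l q], where w = "w j"] by measurable
    show "{\<omega> \<in> space M. \<exists>l\<in>{..j}. \<exists>q\<in>{..<2 ^ l}. ?T l \<le> mass j (X \<omega> j) l q} \<in> events"
      unfolding eq by (intro sets.finite_UN E_meas finite_atMost finite_lessThan)
    \<comment> \<open>The first term of the threshold covers twice the mean. The second is
      \<open>4 * 2 powr (\<theta> * real j)\<close> times the largest weight, which gives a doubly
      exponential tail; this outweighs the at most \<open>(j + 1) * 2 ^ j\<close> events of
      generation \<open>j\<close>.\<close>
    have bound: "prob (E l q) \<le> exp (- 4 * 2 powr (\<theta> * real j))" if l: "l \<le> j" and q: "q < 2 ^ l" for l q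
    proof -
      have "p j * (\<Sum>k\<in>B j l q. w j k) = (\<Sum>k\<in>B j l q. \<mu> j k)" using pw[of j "\<lambda>_. 1"] by simp
      also have "\<dots> = mass j (\<mu> j) l q" by (simp add: mass_B \<mu>(4))
      also have "\<dots> = \<mu> l q" by (rule mass_additive[of \<mu>, OF \<mu>(2) l q])
      finally have sum: "p j * (\<Sum>k\<in>B j l q. w j k) \<le> 2 powr (- s * real l)" using \<mu>(3)[of l q] by simp
      have sum2: "p j * (\<Sum>k\<in>B j l q. w j k) \<le> 2 * 2 powr (- s * real l)"
        by (rule order_trans[OF sum]) simp
      have "prob (E l q) \<le> exp ((2 * (p j * (\<Sum>k\<in>B j l q. w j k)) - ?T l) / b j)"
        unfolding E_def by (rule row_tails(1)[OF B_sub b_pos w_nonneg w_le])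
      also have "\<dots> \<le> exp (- 4 * 2 powr (- \<beta> * real j) / b j)"
        unfolding exp_le_cancel_iff by (intro divide_right_mono less_imp_le[OF b_pos]) (use sum2 in simp)
      also have "2 powr (- \<beta> * real j) = 2 powr (\<theta> * real j) * b j"
        by (simp add: b_def \<beta>_def powr_add[symmetric] algebra_simps)
      also have "- 4 * (2 powr (\<theta> * real j) * b j) / b j = - 4 * 2 powr (\<theta> * real j)"
        using b_pos[of j] by simp
      finally show ?thesis .
    qed
    have "prob (\<Union>l\<in>{..j}. \<Union>q\<in>{..<2 ^ l}. E l q) \<le> (\<Sum>l\<in>{..j}. prob (\<Union>q\<in>{..<2 ^ l}. E l q))"
      by (rule finite_measure_subadditive_finite) (auto intro!: E_meas)
    also have "\<dots> \<le> (\<Sum>l\<in>{..j}. \<Sum>q\<in>{..<2 ^ l::nat}. prob (E l q))"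
      by (intro sum_mono finite_measure_subadditive_finite) (auto intro!: E_meas)
    also have "\<dots> \<le> (\<Sum>l\<in>{..j}. \<Sum>q\<in>{..<2 ^ l::nat}. exp (- 4 * 2 powr (\<theta> * real j)))"
      by (intro sum_mono bound) auto
    also have "\<dots> = (\<Sum>l\<in>{..j}. 2 ^ l * exp (- 4 * 2 powr (\<theta> * real j)))" by simp
    also have "\<dots> \<le> (\<Sum>l\<in>{..j}. 2 ^ j * exp (- 4 * 2 powr (\<theta> * real j)))"
      by (intro sum_mono mult_right_mono) auto
    also have "\<dots> = (real j + 1) * 2 ^ j * exp (- 4 * 2 powr (\<theta> * real j))" by simp
    finally show "prob {\<omega> \<in> space M. \<exists>l\<in>{..j}. \<exists>q\<in>{..<2 ^ l}. ?T l \<le> mass j (X \<omega> j) l q}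
        \<le> (real j + 1) * 2 ^ j * exp (- 4 * 2 powr (\<theta> * real j))"
      unfolding eq .
  next
    show "(\<lambda>j::nat. (real j + 1) * 2 ^ j * exp (- 4 * 2 powr (\<theta> * real j))) \<in> O(\<lambda>n. (1 / 2) ^ n)"
      using \<theta>(1) by real_asymp
  qed

  \<comment> \<open>Lower bounds for the kept masses\<close>
  define L where "L = cantor_construction.lev \<delta>"
  have L_le: "L j \<le> j" for j unfolding L_def by (rule cantor_construction.lev_le_self[OF loc])
  have L_lim: "filterlim L at_top sequentially" unfolding L_def by (rule cantor_construction.filterlim_lev[OF loc])
  \<comment> \<open>Whether an interval is kept depends on \<open>\<mu>\<close> alone. It is
    therefore a deterministic factor 0 or 1 in the weights, and the kept mass remains a weighted sum
    of independent selections.\<close>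
  define good :: "nat \<Rightarrow> nat \<Rightarrow> real" where
    "good j k = of_bool (2 powr (- (s + 2 * \<theta>) * real (L j)) \<le> \<mu> (L j) (k div 2 ^ (j - L j)))" for j k
  have kept_eq: "mass (L j) (cantor_construction.kept \<mu> (X \<omega>) s \<delta> \<theta> j) m a =
      (\<Sum>k\<in>B j m a. (w j k * good j k) * of_bool (\<xi> j k \<omega>))" if "m \<le> L j" for \<omega> j m a
  proof -
    have "cantor_construction.kept \<mu> (X \<omega>) s \<delta> \<theta> j k = mass j (\<lambda>k. X \<omega> j k * good j k) (L j) k" for k
      unfolding cantor_construction.kept_def[OF loc] L_def[symmetric] mass_def good_def by (auto intro!: sum.cong)
    then have "mass (L j) (cantor_construction.kept \<mu> (X \<omega>) s \<delta> \<theta> j) m a = mass j (\<lambda>k. X \<omega> j k * good j k) m a"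
      using mass_mass[OF that L_le] by presburger
    also have "\<dots> = (\<Sum>k\<in>B j m a. X \<omega> j k * good j k)" by (rule mass_B) (simp add: X_def w_def \<mu>(4))
    finally show ?thesis by (simp add: X_def mult_ac)
  qed
  have bI: "bounded I" using I(1) bounded_subset bounded_closed_interval by blast
  have H1: "AE \<omega> in M. \<forall>\<^sub>F j in sequentially.
      \<mu> m a / 8 \<le> mass (L j) (cantor_construction.kept \<mu> (X \<omega>) s \<delta> \<theta> j) m a"
    if a: "a < 2 ^ m" and pos: "\<mu> m a > 0" for m a
  proof -
    \<comment> \<open>Box counting shows that the intervals of level \<open>n\<close> with
      \<open>\<mu>\<close>-measure below \<open>2 powr (- (s + 2 * \<theta>) * real n)\<close> carry
      at most \<open>2 powr (- (\<theta> / 2) * real n)\<close> in total, because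
      \<open>s = ?d - \<theta>\<close>. Eventually at least half of \<open>\<mu> m a\<close>
      survives.\<close>
    have "\<forall>\<^sub>F n in sequentially. real (card (dyadic_indices I n)) \<le> 2 powr ((?d + \<theta> / 2) * real n)"
      using eventually_card_dyadic_indices_le[OF bI I(2), of "\<theta> / 2"] \<theta>(1) by simp
    moreover have "\<forall>\<^sub>F n::nat in sequentially. 2 powr (- (\<theta> / 2) * real n) < \<mu> m a / 2"
    proof -
      have "((\<lambda>n::nat. 2 powr (- (\<theta> / 2) * real n)) \<longlongrightarrow> 0) sequentially" using \<theta>(1) by real_asymp
      then show ?thesis by (rule order_tendstoD(2)) (use pos in simp)
    qed
    ultimately have "\<forall>\<^sub>F n in sequentially. real (card (dyadic_indices I n)) * 2 powr (- (s + 2 * \<theta>) * real n) \<le> \<mu> m a / 2"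
    proof eventually_elim
      case (elim n)
      have "real (card (dyadic_indices I n)) * 2 powr (- (s + 2 * \<theta>) * real n)
          \<le> 2 powr ((?d + \<theta> / 2) * real n) * 2 powr (- (s + 2 * \<theta>) * real n)"
        using elim by (intro mult_right_mono) auto
      also have "\<dots> = 2 powr (- (\<theta> / 2) * real n)" by (simp add: s_def powr_add[symmetric] algebra_simps)
      finally show ?case using elim by linarith
    qed
    then have "\<forall>\<^sub>F j in sequentially. real (card (dyadic_indices I (L j))) * 2 powr (- (s + 2 * \<theta>) * real (L j)) \<le> \<mu> m a / 2"
      by (rule eventually_compose_filterlim[OF _ L_lim])
    moreover have "\<forall>\<^sub>F j in sequentially. m \<le> L j"
      by (rule eventually_compose_filterlim[OF eventually_ge_at_top L_lim])
    ultimately have ok: "\<forall>\<^sub>F j in sequentially. m \<le> L j \<and> \<mu> m a / 2 \<le> p j * (\<Sum>k\<in>B j m a. w j k * good j k)"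
    proof eventually_elim
      case (elim j)
      let ?\<kappa> = "2 powr (- (s + 2 * \<theta>) * real (L j))"
      let ?g = "\<lambda>k. of_bool (?\<kappa> \<le> \<mu> (L j) k) * \<mu> (L j) k"
      have "\<mu> m a = mass (L j) (\<mu> (L j)) m a"
        by (rule mass_additive[of \<mu>, OF \<mu>(2) elim(2) a, symmetric])
      also have "\<dots> \<le> mass (L j) (\<lambda>k. ?g k + ?\<kappa> * of_bool (k \<in> dyadic_indices I (L j))) m a"
        by (rule mass_mono) (auto simp: \<mu>(4) not_le)
      also have "\<dots> = mass (L j) ?g m a + (\<Sum>k | k < 2 ^ L j \<and> k div 2 ^ (L j - m) = a. ?\<kappa> * of_bool (k \<in> dyadic_indices I (L j)))"
        by (simp only: mass_def sum.distrib)
      also have "(\<Sum>k | k < 2 ^ L j \<and> k div 2 ^ (L j - m) = a. ?\<kappa> * of_bool (k \<in> dyadic_indices I (L j)))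
          \<le> (\<Sum>k\<in>dyadic_indices I (L j). ?\<kappa>)"
        by (subst sum_mono2[THEN order_trans[rotated], of _ "{k \<in> {k. k < 2 ^ L j \<and> k div 2 ^ (L j - m) = a}. k \<in> dyadic_indices I (L j)}"])
           (auto simp: of_bool_def if_distrib sum.inter_filter[symmetric] cong: if_cong)
      also have "\<dots> \<le> \<mu> m a / 2" using elim(1) by simp
      finally have "\<mu> m a / 2 \<le> mass (L j) ?g m a" by simp
      also have "?g k = mass j (\<lambda>k. \<mu> j k * good j k) (L j) k" if "k < 2 ^ L j" for k
      proof -
        have "\<mu> (L j) k = mass j (\<mu> j) (L j) k" by (rule mass_additive[of \<mu>, OF \<mu>(2) L_le that, symmetric])
        then show ?thesis unfolding mass_def good_def sum_distrib_left by (auto intro!: sum.cong)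
      qed
      then have "mass (L j) ?g m a = mass (L j) (mass j (\<lambda>k. \<mu> j k * good j k) (L j)) m a" by (rule mass_cong)
      also have "\<dots> = mass j (\<lambda>k. \<mu> j k * good j k) m a" by (rule mass_mass[OF elim(2) L_le])
      also have "\<dots> = (\<Sum>k\<in>B j m a. \<mu> j k * good j k)" by (rule mass_B) (simp add: \<mu>(4))
      also have "\<dots> = p j * (\<Sum>k\<in>B j m a. w j k * good j k)" by (rule pw[symmetric])
      finally show ?case using elim(2) by simp
    qed
    define okj where "okj j \<longleftrightarrow> m \<le> L j \<and> \<mu> m a / 2 \<le> p j * (\<Sum>k\<in>B j m a. w j k * good j k)" for j
    \<comment> \<open>The mean is at least \<open>\<mu> m a / 2\<close>, so half of it exceeds the
      threshold \<open>c\<close> by at least \<open>c\<close>; this difference is the gain in the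
      exponent.\<close>
    define c where "c = \<mu> m a / 8"
    have c: "c > 0" using pos by (simp add: c_def)
    have wg: "0 \<le> w j k * good j k" "w j k * good j k \<le> b j" for j k
      using w_nonneg[of j k] w_le[of j k] b_pos[of j] by (auto simp: good_def)
    have "AE \<omega> in M. \<forall>\<^sub>F j in sequentially. \<not> (okj j \<and> (\<Sum>k\<in>B j m a. (w j k * good j k) * of_bool (\<xi> j k \<omega>)) \<le> c)"
    proof (rule borel_cantelli_bigo)
      fix j
      show "{\<omega> \<in> space M. okj j \<and> (\<Sum>k\<in>B j m a. (w j k * good j k) * of_bool (\<xi> j k \<omega>)) \<le> c} \<in> events"
        using row_sum_measurable[OF B_sub[of j m a], where w = "\<lambda>k. w j k * good j k"] by measurable
      show "prob {\<omega> \<in> space M. okj j \<and> (\<Sum>k\<in>B j m a. (w j k * good j k) * of_bool (\<xi> j k \<omega>)) \<le> c}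
        \<le> exp (- c * 2 powr ((\<eta> - \<theta>) * real j))"
      proof (cases "okj j")
        case True
        have "prob {\<omega> \<in> space M. (\<Sum>k\<in>B j m a. (w j k * good j k) * of_bool (\<xi> j k \<omega>)) \<le> c}
          \<le> exp ((c - p j * (\<Sum>k\<in>B j m a. w j k * good j k) / 2) / b j)"
          by (rule row_tails(2)[OF B_sub b_pos wg])
        also have "\<dots> \<le> exp (- c / b j)"
          unfolding exp_le_cancel_iff by (intro divide_right_mono less_imp_le[OF b_pos])
            (use True in \<open>simp add: okj_def c_def\<close>)
        also have "- c / b j = - c * 2 powr ((\<eta> - \<theta>) * real j)"
        proof -
          have "2 powr ((\<eta> - \<theta>) * real j) * b j = 1" by (simp add: b_def powr_add[symmetric] algebra_simps)
          then have "- c = - c * 2 powr ((\<eta> - \<theta>) * real j) * b j" by (simp only: mult.assoc mult_1_right)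
          then show ?thesis using b_pos[of j] by (simp add: divide_eq_eq)
        qed
        finally show ?thesis using True by simp
      qed simp
    next
      show "(\<lambda>j::nat. exp (- c * 2 powr ((\<eta> - \<theta>) * real j))) \<in> O(\<lambda>n. (1 / 2) ^ n)"
      proof -
        define u where "u = \<eta> - \<theta>"
        have "u > 0" using params(4) by (simp add: u_def)
        then show ?thesis unfolding u_def[symmetric] using c by real_asymp
      qed
    qed
    then show ?thesis
    proof eventually_elim
      case (elim \<omega>)
      from elim ok show ?case
      proof eventually_elim
        case (elim j)
        then show ?case using kept_eq[of m j \<omega> a] by (simp add: okj_def c_def)
      qed
    qed
  qed
  \<comment> \<open>There are countably many pairs of \<open>m\<close> and \<open>a\<close>, so a
    single null set suffices.\<close>
  have "AE \<omega> in M. \<forall>m. \<forall>a. a < 2 ^ m \<and> \<mu> m a > 0 \<longrightarrow> (\<forall>\<^sub>F j in sequentially.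
      \<mu> m a / 8 \<le> mass (L j) (cantor_construction.kept \<mu> (X \<omega>) s \<delta> \<theta> j) m a)"
    unfolding AE_all_countable using H1 by auto
  then show ?thesis using H2
  proof eventually_elim
    case (elim \<omega>)
    interpret cantor_construction \<mu> "X \<omega>" s t \<delta> \<beta> \<theta> by (rule loc)
    have "hausdorff_measure t {x \<in> {0..1}. \<forall>J. \<exists>j\<ge>J. \<exists>k<2 ^ j. X \<omega> j k > 0 \<and>
       \<bar>x - real k / 2 ^ j\<bar> \<le> 2 * 2 powr (- \<delta> * real j)} \<noteq> 0"
    proof (rule limsup_set_measure_nonzero)
      show "\<forall>\<^sub>F j in sequentially. \<mu> m a / 8 \<le> mass (lev j) (kept j) m a" if "a < 2 ^ m" "\<mu> m a > 0" for m a
        using elim(1) that unfolding L_def by blast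
      show "\<forall>\<^sub>F j in sequentially. \<forall>l\<le>j. \<forall>q<2 ^ l. mass j (X \<omega> j) l q \<le> 4 * (2 powr (- s * real l) + 2 powr (- \<beta> * real j))"
        using elim(2) by eventually_elim (force simp: not_le intro: less_imp_le)
    qed
    moreover have "k \<in> dyadic_indices I j \<and> \<xi> j k \<omega>" if "X \<omega> j k > 0" for j k
      using that \<mu>(4)[of k j] by (cases "k \<in> dyadic_indices I j") (auto simp: X_def w_def of_bool_def split: if_splits)
    then have "{x \<in> {0..1}. \<forall>J. \<exists>j\<ge>J. \<exists>k<2 ^ j. X \<omega> j k > 0 \<and> \<bar>x - real k / 2 ^ j\<bar> \<le> 2 * 2 powr (- \<delta> * real j)}
      \<subseteq> {x \<in> {0..1}. \<forall>J. \<exists>j\<ge>J. \<exists>k\<in>dyadic_indices I j. \<xi> j k \<omega> \<and>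
        \<bar>x - real k / 2 ^ j\<bar> \<le> 2 * 2 powr (- \<delta> * real j)}"
      by blast
    ultimately show ?case by (rule hausdorff_measure_nonzero_mono[rotated])
  qed
qed

end

section \<open>Regularity away from the selected points\<close>

lemma fast_decayD:
  assumes "fast_decay u" shows "\<exists>C>0. \<forall>x. \<bar>u x\<bar> \<le> C / (1 + \<bar>x\<bar>) ^ N"
proof -
  obtain C where C: "\<And>x. \<bar>u x\<bar> \<le> C / (1 + \<bar>x\<bar>) ^ N" using assms unfolding fast_decay_def by blast
  have "\<bar>u x\<bar> \<le> (\<bar>C\<bar> + 1) / (1 + \<bar>x\<bar>) ^ N" for x
    by (rule order_trans[OF C]) (intro divide_right_mono, auto)
  then show ?thesis by (intro exI[of _ "\<bar>C\<bar> + 1"]) auto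
qed

lemma sum_int_inverse_square_le:
  assumes "finite (N :: int set)"
  shows "(\<Sum>n\<in>N. 1 / (1 + \<bar>real_of_int n\<bar>)\<^sup>2) \<le> 2 * (\<Sum>m. 1 / (1 + real m)\<^sup>2)"
proof -
  let ?g = "\<lambda>m::nat. 1 / (1 + real m)\<^sup>2"
  have sm: "summable ?g"
    using inverse_power_summable[of 2, where 'a = real] summable_Suc_iff[of "\<lambda>m. inverse (real m ^ 2)"]
    by (simp add: inverse_eq_divide add_ac)
  have *: "(\<Sum>n\<in>N'. 1 / (1 + \<bar>real_of_int n\<bar>)\<^sup>2) \<le> suminf ?g"
    if "finite N'" "inj_on (\<lambda>n. nat \<bar>n\<bar>) N'" for N' :: "int set"
  proof -
    have "(\<Sum>n\<in>N'. 1 / (1 + \<bar>real_of_int n\<bar>)\<^sup>2) = sum ?g ((\<lambda>n. nat \<bar>n\<bar>) ` N')"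
      by (simp add: sum.reindex[OF that(2)])
    also have "\<dots> \<le> suminf ?g" using that sm by (intro sum_le_suminf) auto
    finally show ?thesis .
  qed
  have "(\<Sum>n\<in>N. 1 / (1 + \<bar>real_of_int n\<bar>)\<^sup>2) =
      (\<Sum>n\<in>{n\<in>N. 0 \<le> n}. 1 / (1 + \<bar>real_of_int n\<bar>)\<^sup>2) + (\<Sum>n\<in>{n\<in>N. \<not> 0 \<le> n}. 1 / (1 + \<bar>real_of_int n\<bar>)\<^sup>2)"
    using assms by (subst sum.union_disjoint[symmetric]) (auto intro: sum.cong)
  also have "\<dots> \<le> suminf ?g + suminf ?g"
    using assms by (intro add_mono *) (auto simp: inj_on_def)
  finally show ?thesis by simp
qed

text \<open>Of \<open>N + 2\<close> orders of decay, two make the sum over integer translates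
  bounded uniformly in \<open>y\<close>, and \<open>N\<close> remain as the gain from the distance
  \<open>R\<close>.\<close>

lemma fast_decay_translates_sum:
  assumes "fast_decay u"
  shows "\<exists>C>0. \<forall>A y R. finite A \<longrightarrow> 0 \<le> R \<longrightarrow> (\<forall>k\<in>A. R \<le> \<bar>y - real k\<bar>) \<longrightarrow>
    (\<Sum>k\<in>A. \<bar>u (y - real k)\<bar>) \<le> C / (1 + R) ^ N"
proof -
  obtain C0 where C0: "C0 > 0" "\<And>x. \<bar>u x\<bar> \<le> C0 / (1 + \<bar>x\<bar>) ^ (N + 2)"
    using fast_decayD[OF assms, of "N + 2"] by blast
  define G where "G = 2 * (\<Sum>m. 1 / (1 + real m)\<^sup>2)"
  show ?thesis
  proof (intro exI[of _ "C0 * 4 * (\<bar>G\<bar> + 1)"] conjI allI impI)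
    show "0 < C0 * 4 * (\<bar>G\<bar> + 1)" using C0 by simp
    fix A :: "nat set" and y R :: real
    assume A: "finite A" and R: "0 \<le> R" and far: "\<forall>k\<in>A. R \<le> \<bar>y - real k\<bar>"
    let ?n = "\<lambda>k::nat. int k - \<lfloor>y\<rfloor>"
    have "\<bar>u (y - real k)\<bar> \<le> C0 * 4 / (1 + R) ^ N * (1 / (1 + \<bar>real_of_int (?n k)\<bar>)\<^sup>2)" if k: "k \<in> A" for k
    proof -
      let ?x = "\<bar>y - real k\<bar>"
      \<comment> \<open>Replacing \<open>y\<close> by its floor changes distances by at most 1,
        which reduces the sum to one over distinct integers.\<close>
      have "1 + \<bar>real_of_int (?n k)\<bar> \<le> 2 * (1 + ?x)"
      proof -
        have *: "1 + a \<le> 2 * (1 + b)" if "a \<le> 1 + b" "0 \<le> b" for a b :: real using that by simp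
        have "\<bar>real_of_int (?n k)\<bar> \<le> 1 + ?x" by simp linarith
        then show ?thesis by (rule * [OF _ abs_ge_zero])
      qed
      then have "(1 + \<bar>real_of_int (?n k)\<bar>)\<^sup>2 \<le> (2 * (1 + ?x))\<^sup>2" by (intro power_mono) auto
      moreover have "(1 + R) ^ N \<le> (1 + ?x) ^ N" using far k R by (intro power_mono) auto
      ultimately have "(1 + R) ^ N * (1 + \<bar>real_of_int (?n k)\<bar>)\<^sup>2 \<le> (1 + ?x) ^ N * (2 * (1 + ?x))\<^sup>2"
        by (intro mult_mono) auto
      also have "z ^ N * (2 * z)\<^sup>2 = 4 * z ^ (N + 2)" for z :: real by (simp add: power_add power_mult_distrib power2_eq_square)
      finally have "C0 * 4 / (4 * (1 + ?x) ^ (N + 2)) \<le> C0 * 4 / ((1 + R) ^ N * (1 + \<bar>real_of_int (?n k)\<bar>)\<^sup>2)"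
        using C0 R by (intro divide_left_mono) (auto intro!: mult_pos_pos zero_less_power)
      then show ?thesis using C0(2)[of "y - real k"] by simp
    qed
    then have "(\<Sum>k\<in>A. \<bar>u (y - real k)\<bar>) \<le> (\<Sum>k\<in>A. C0 * 4 / (1 + R) ^ N * (1 / (1 + \<bar>real_of_int (?n k)\<bar>)\<^sup>2))"
      by (intro sum_mono)
    also have "\<dots> = C0 * 4 / (1 + R) ^ N * (\<Sum>k\<in>A. 1 / (1 + \<bar>real_of_int (?n k)\<bar>)\<^sup>2)"
      by (simp only: sum_distrib_left)
    also have "(\<Sum>k\<in>A. 1 / (1 + \<bar>real_of_int (?n k)\<bar>)\<^sup>2) = (\<Sum>n\<in>?n ` A. 1 / (1 + \<bar>real_of_int n\<bar>)\<^sup>2)"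
      by (subst sum.reindex) (auto simp: inj_on_def)
    also have "C0 * 4 / (1 + R) ^ N * \<dots> \<le> C0 * 4 / (1 + R) ^ N * (\<bar>G\<bar> + 1)"
    proof (intro mult_left_mono)
      have "(\<Sum>n\<in>?n ` A. 1 / (1 + \<bar>real_of_int n\<bar>)\<^sup>2) \<le> G"
        unfolding G_def using A by (intro sum_int_inverse_square_le) auto
      then show "(\<Sum>n\<in>?n ` A. 1 / (1 + \<bar>real_of_int n\<bar>)\<^sup>2) \<le> \<bar>G\<bar> + 1" by linarith
    qed (use C0 R in auto)
    finally show "(\<Sum>k\<in>A. \<bar>u (y - real k)\<bar>) \<le> C0 * 4 * (\<bar>G\<bar> + 1) / (1 + R) ^ N" by simp
  qed
qed

lemma summable_powr_geometric:
  assumes "\<kappa> > 0" shows "summable (\<lambda>j::nat. 2 powr (- \<kappa> * real j))"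
proof -
  have "2 powr (- \<kappa> * real j) = (2 powr (- \<kappa>)) ^ j" for j
    using powr_realpow[of "2 powr (- \<kappa>)" j] powr_powr[of 2 "- \<kappa>" "real j"] by simp
  moreover have "2 powr (- \<kappa>) < 1" using assms by (simp add: powr_less_one)
  ultimately show ?thesis by (simp add: summable_geometric)
qed

text \<open>Layers with \<open>2 powr (- \<delta> * real j) \<ge> 2 * \<bar>x - x0\<bar>\<close> are
  expanded to order \<open>n\<close>. In the finer ones the layer and its Taylor polynomial are
  estimated separately, since there \<open>2 powr (- (\<alpha> - \<kappa>) * real j)\<close> is
  already bounded by a multiple of
  \<open>\<bar>x - x0\<bar> powr ((\<alpha> - \<kappa>) / \<delta>)\<close>. The part
  \<open>\<kappa>\<close> of the exponent is given up to sum the errors over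
  \<open>j\<close>.\<close>

lemma multiscale_taylor:
  fixes F :: "nat \<Rightarrow> nat \<Rightarrow> real \<Rightarrow> real"
  assumes n: "n > 0" and \<delta>: "\<delta> > 0" and \<kappa>: "0 < \<kappa>" "\<kappa> < \<alpha>" and h: "(\<alpha> - \<kappa>) / \<delta> \<le> real n"
    and deriv: "\<And>j i x. i < n \<Longrightarrow> (F j i has_real_derivative F j (Suc i) x) (at x)"
    and loc: "\<And>j i y. i \<le> n \<Longrightarrow> \<bar>y - x0\<bar> \<le> 2 powr (- \<delta> * real j) / 2 \<Longrightarrow> \<bar>F j i y\<bar> \<le> C * 2 powr (- \<alpha> * real j)"
    and glob: "\<And>j y. \<bar>F j 0 y\<bar> \<le> C * 2 powr (- \<alpha> * real j)"
  shows "\<exists>C'>0. \<exists>P :: real poly. degree P \<le> n - 1 \<and>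
    (\<forall>x. \<bar>x - x0\<bar> \<le> 1 \<longrightarrow> \<bar>(\<Sum>j. F j 0 x) - poly P x\<bar> \<le> C' * \<bar>x - x0\<bar> powr ((\<alpha> - \<kappa>) / \<delta>))"
proof -
  define h where "h = (\<alpha> - \<kappa>) / \<delta>"
  have h_pos: "h > 0" "h \<le> real n" using assms by (auto simp: h_def)
  have \<alpha>: "\<alpha> > 0" using \<kappa> by simp
  define T where "T j x = (\<Sum>i<n. F j i x0 / fact i * (x - x0) ^ i)" for j x
  define K where "K = C * (real n + 1) * 2 powr h"
  have C: "C \<ge> 0" using glob[of 0 0] by (simp add: order_trans[OF abs_ge_zero])
  have x0_bound: "\<bar>F j i x0\<bar> \<le> C * 2 powr (- \<alpha> * real j)" if "i \<le> n" for i j using loc[OF that, of x0 j] by simp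
  have KC: "C \<le> K"
  proof -
    have "1 * 1 \<le> (real n + 1) * 2 powr h" using h_pos by (intro mult_mono) (auto simp: ge_one_powr_ge_zero)
    then show ?thesis using C by (simp add: K_def mult.assoc mult_le_cancel_left1)
  qed
  have layer_error: "\<bar>F j 0 x - T j x\<bar> \<le> K * \<bar>x - x0\<bar> powr h * 2 powr (- \<kappa> * real j)" if x: "\<bar>x - x0\<bar> \<le> 1" for j x
  proof (cases "x = x0")
    case True
    have "T j x0 = (\<Sum>i\<in>{0}. F j i x0 / fact i * (x0 - x0) ^ i)"
      unfolding T_def using n by (intro sum.mono_neutral_right) auto
    then show ?thesis using True by simp
  next
    case neq: False
    show ?thesis
    proof (cases "\<bar>x - x0\<bar> \<le> 2 powr (- \<delta> * real j) / 2")
      case True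
      obtain t where t: "if x < x0 then x < t \<and> t < x0 else x0 < t \<and> t < x"
        "F j 0 x = (\<Sum>i<n. F j i x0 / fact i * (x - x0) ^ i) + F j n t / fact n * (x - x0) ^ n"
        using Taylor[OF n, of "F j" "F j 0" "min x x0" "max x x0" x0 x] deriv neq by auto
      have "\<bar>t - x0\<bar> \<le> 2 powr (- \<delta> * real j) / 2" using t(1) True by (auto split: if_splits)
      then have Fn: "\<bar>F j n t\<bar> \<le> C * 2 powr (- \<alpha> * real j)" by (intro loc) auto
      have "\<bar>F j 0 x - T j x\<bar> = \<bar>F j n t\<bar> / fact n * \<bar>x - x0\<bar> ^ n"
        unfolding T_def t(2) by (simp add: abs_mult power_abs)
      also have "\<dots> \<le> (K * 2 powr (- \<kappa> * real j)) * \<bar>x - x0\<bar> powr h"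
      proof (intro mult_mono)
        have "\<bar>F j n t\<bar> / fact n \<le> \<bar>F j n t\<bar> / 1" by (intro divide_left_mono) auto
        also have "\<dots> \<le> C * 2 powr (- \<alpha> * real j)" using Fn by simp
        also have "\<dots> \<le> K * 2 powr (- \<kappa> * real j)"
          using KC C \<kappa> by (intro mult_mono) (auto intro!: mult_right_mono)
        finally show "\<bar>F j n t\<bar> / fact n \<le> K * 2 powr (- \<kappa> * real j)" .
        have "\<bar>x - x0\<bar> ^ n = \<bar>x - x0\<bar> powr real n" using neq by (simp add: powr_realpow)
        also have "\<dots> \<le> \<bar>x - x0\<bar> powr h" using h_pos x neq by (intro powr_mono') auto
        finally show "\<bar>x - x0\<bar> ^ n \<le> \<bar>x - x0\<bar> powr h" .
      qed (use C KC in auto)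
      finally show ?thesis by (simp add: mult_ac)
    next
      case False
      have "\<bar>T j x\<bar> \<le> (\<Sum>i<n. \<bar>F j i x0 / fact i * (x - x0) ^ i\<bar>)" unfolding T_def by (rule sum_abs)
      also have "\<dots> \<le> (\<Sum>i<n. C * 2 powr (- \<alpha> * real j))"
      proof (intro sum_mono)
        fix i assume i: "i \<in> {..<n}"
        have "\<bar>F j i x0 / fact i * (x - x0) ^ i\<bar> = \<bar>F j i x0\<bar> / fact i * \<bar>x - x0\<bar> ^ i"
          by (simp add: abs_mult power_abs)
        also have "\<dots> \<le> \<bar>F j i x0\<bar> / 1 * 1"
          using x by (intro mult_mono divide_left_mono power_le_one) auto
        finally show "\<bar>F j i x0 / fact i * (x - x0) ^ i\<bar> \<le> C * 2 powr (- \<alpha> * real j)"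
          using x0_bound[of i j] i by simp
      qed
      finally have T: "\<bar>T j x\<bar> \<le> real n * (C * 2 powr (- \<alpha> * real j))" by simp
      have "\<bar>F j 0 x - T j x\<bar> \<le> \<bar>F j 0 x\<bar> + \<bar>T j x\<bar>" by (rule abs_triangle_ineq4)
      also have "\<dots> \<le> C * (real n + 1) * 2 powr (- \<alpha> * real j)"
        using T glob[of j x] by (simp add: algebra_simps)
      also have "2 powr (- \<alpha> * real j) = (2 powr (- \<delta> * real j)) powr h * 2 powr (- \<kappa> * real j)"
      proof -
        have "\<alpha> = \<delta> * h + \<kappa>" using \<delta> by (simp add: h_def)
        then show ?thesis by (simp add: powr_powr powr_add[symmetric] algebra_simps)
      qed
      also have "C * (real n + 1) * ((2 powr (- \<delta> * real j)) powr h * 2 powr (- \<kappa> * real j)) \<le>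
          C * (real n + 1) * ((2 * \<bar>x - x0\<bar>) powr h * 2 powr (- \<kappa> * real j))"
        using False h_pos C by (intro mult_left_mono mult_right_mono powr_mono2) auto
      also have "\<dots> = K * \<bar>x - x0\<bar> powr h * 2 powr (- \<kappa> * real j)" by (simp add: K_def powr_mult)
      finally show ?thesis .
    qed
  qed
  \<comment> \<open>The approximating polynomial adds the Taylor coefficients of all layers; their
    series converge by \<open>loc\<close> at \<open>x0\<close> itself.\<close>
  define a where "a i = (\<Sum>j. F j i x0 / fact i)" for i
  have sm_a: "summable (\<lambda>j. F j i x0 / fact i)" if "i \<le> n" for i
  proof (rule summable_comparison_test'[where N = 0])
    show "summable (\<lambda>j. C * 2 powr (- \<alpha> * real j))" by (intro summable_mult summable_powr_geometric \<alpha>)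
    fix j
    have "\<bar>F j i x0\<bar> / fact i \<le> \<bar>F j i x0\<bar> / 1" by (intro divide_left_mono) auto
    then show "norm (F j i x0 / fact i) \<le> C * 2 powr (- \<alpha> * real j)" using x0_bound[OF that, of j] by simp
  qed
  define P where "P = (\<Sum>i<n. smult (a i) ([:- x0, 1:] ^ i))"
  have P: "poly P x = (\<Sum>i<n. a i * (x - x0) ^ i)" for x by (simp add: P_def poly_sum)
  have deg: "degree P \<le> n - 1"
    unfolding P_def
  proof (intro degree_sum_le)
    fix i assume "i \<in> {..<n}"
    then show "degree (smult (a i) ([:- x0, 1:] ^ i)) \<le> n - 1"
      using degree_smult_le[of "a i" "[:- x0, 1:] ^ i"] by (simp add: degree_linear_power)
  qed simp
  have T_sums: "(\<lambda>j. T j x) sums poly P x" for x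
    unfolding T_def P a_def by (intro sums_sum sums_mult2 summable_sums sm_a) auto
  have F_sm: "summable (\<lambda>j. F j 0 x)" for x
    by (rule summable_comparison_test'[where N = 0, OF summable_mult[OF summable_powr_geometric[OF \<alpha>], of C]])
       (use glob in auto)
  define S where "S = (\<Sum>j::nat. 2 powr (- \<kappa> * real j))"
  have K: "K \<ge> 0" using KC C by simp
  have S: "S \<ge> 0" unfolding S_def by (intro suminf_nonneg summable_powr_geometric \<kappa>) auto
  show ?thesis
  proof (intro exI[of _ "K * S + 1"] exI[of _ P] conjI allI impI)
    show "K * S + 1 > 0" using K S by (simp add: add_nonneg_pos)
    fix x assume x: "\<bar>x - x0\<bar> \<le> 1"
    let ?b = "\<lambda>j::nat. K * \<bar>x - x0\<bar> powr h * 2 powr (- \<kappa> * real j)"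
    have sm_b: "summable ?b" by (intro summable_mult summable_powr_geometric \<kappa>)
    have sm_abs: "summable (\<lambda>j. \<bar>F j 0 x - T j x\<bar>)"
      by (rule summable_comparison_test'[where N = 0, OF sm_b]) (use layer_error[OF x] in auto)
    have "(\<Sum>j. F j 0 x) - poly P x = (\<Sum>j. F j 0 x - T j x)"
      using suminf_diff[OF F_sm sums_summable[OF T_sums]] sums_unique[OF T_sums] by simp
    also have "\<bar>\<dots>\<bar> \<le> (\<Sum>j. \<bar>F j 0 x - T j x\<bar>)" by (rule summable_rabs[OF sm_abs])
    also have "\<dots> \<le> (\<Sum>j. ?b j)" by (intro suminf_le sm_abs sm_b layer_error x)
    also have "\<dots> = K * \<bar>x - x0\<bar> powr h * S"
      unfolding S_def by (intro suminf_mult summable_powr_geometric \<kappa>)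
    also have "\<dots> \<le> (K * S + 1) * \<bar>x - x0\<bar> powr h" by (simp add: algebra_simps)
    finally show "\<bar>(\<Sum>j. F j 0 x) - poly P x\<bar> \<le> (K * S + 1) * \<bar>x - x0\<bar> powr ((\<alpha> - \<kappa>) / \<delta>)"
      unfolding h_def .
  qed (rule deg)
qed

text \<open>For a fixed outcome the random series is the sum of these layers, with
  \<open>A j\<close> the set of selected indices; the regularity analysis is thus
  deterministic.\<close>

definition wavelet_layer :: "(real \<Rightarrow> real) \<Rightarrow> real \<Rightarrow> (nat \<Rightarrow> nat set) \<Rightarrow> nat \<Rightarrow> real \<Rightarrow> real" where
  "wavelet_layer \<psi> \<alpha> A j x = 2 powr (- \<alpha> * real j) * (\<Sum>k\<in>A j. \<psi> (2 ^ j * x - real k))"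

lemma wavelet_layer_bound:
  assumes "fast_decay \<psi>" "\<And>j. finite (A j)"
  shows "\<exists>C>0. \<forall>j x. \<bar>wavelet_layer \<psi> \<alpha> A j x\<bar> \<le> C * 2 powr (- \<alpha> * real j)"
proof -
  obtain C where C: "C > 0" "\<And>A y R. finite A \<Longrightarrow> 0 \<le> R \<Longrightarrow> \<forall>k\<in>A. R \<le> \<bar>y - real k\<bar> \<Longrightarrow>
    (\<Sum>k\<in>A. \<bar>\<psi> (y - real k)\<bar>) \<le> C / (1 + R) ^ 0"
    using fast_decay_translates_sum[OF assms(1), of 0] by blast
  have "\<bar>wavelet_layer \<psi> \<alpha> A j x\<bar> \<le> C * 2 powr (- \<alpha> * real j)" for j x
  proof -
    have "\<bar>\<Sum>k\<in>A j. \<psi> (2 ^ j * x - real k)\<bar> \<le> (\<Sum>k\<in>A j. \<bar>\<psi> (2 ^ j * x - real k)\<bar>)" by (rule sum_abs)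
    also have "\<dots> \<le> C" using C(2)[OF assms(2), of 0 j "2 ^ j * x"] by simp
    finally show ?thesis unfolding wavelet_layer_def abs_mult by (simp add: mult.commute mult_right_mono)
  qed
  with C(1) show ?thesis by blast
qed

lemma summable_wavelet_layer:
  assumes "fast_decay \<psi>" "\<And>j. finite (A j)" "\<alpha> > 0"
  shows "summable (\<lambda>j. \<bar>wavelet_layer \<psi> \<alpha> A j x\<bar>)"
proof -
  obtain C where C: "C > 0" "\<And>j x. \<bar>wavelet_layer \<psi> \<alpha> A j x\<bar> \<le> C * 2 powr (- \<alpha> * real j)"
    using wavelet_layer_bound[where A = A, OF assms(1,2), of \<alpha>] by blast
  show ?thesis
    by (rule summable_comparison_test'[where N = 0, OF summable_mult[OF summable_powr_geometric[OF assms(3)], of C]])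
       (use C in auto)
qed

lemma wavelet_series_bounded:
  assumes "fast_decay \<psi>" "\<And>j. finite (A j)" "\<alpha> > 0"
  shows "\<exists>C>0. \<forall>x. \<bar>\<Sum>j. wavelet_layer \<psi> \<alpha> A j x\<bar> \<le> C"
proof -
  obtain C where C: "C > 0" "\<And>j x. \<bar>wavelet_layer \<psi> \<alpha> A j x\<bar> \<le> C * 2 powr (- \<alpha> * real j)"
    using wavelet_layer_bound[where A = A, OF assms(1,2), of \<alpha>] by blast
  let ?S = "\<Sum>j::nat. C * 2 powr (- \<alpha> * real j)"
  have sm: "summable (\<lambda>j::nat. C * 2 powr (- \<alpha> * real j))"
    by (intro summable_mult summable_powr_geometric assms)
  have "\<bar>\<Sum>j. wavelet_layer \<psi> \<alpha> A j x\<bar> \<le> ?S" for x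
  proof -
    have "\<bar>\<Sum>j. wavelet_layer \<psi> \<alpha> A j x\<bar> \<le> (\<Sum>j. \<bar>wavelet_layer \<psi> \<alpha> A j x\<bar>)"
      by (rule summable_rabs[OF summable_wavelet_layer[OF assms]])
    also have "\<dots> \<le> ?S" by (intro suminf_le C summable_wavelet_layer assms sm)
    finally show ?thesis .
  qed
  then have "\<bar>\<Sum>j. wavelet_layer \<psi> \<alpha> A j x\<bar> \<le> \<bar>?S\<bar> + 1" for x
    by (rule order_trans) linarith
  then show ?thesis by (intro exI[of _ "\<bar>?S\<bar> + 1"]) auto
qed

lemma locally_bounded_wavelet_series:
  assumes "fast_decay \<psi>" "\<And>j. finite (A j)" "\<alpha> > 0"
  shows "locally_bounded (\<lambda>x. \<Sum>j. wavelet_layer \<psi> \<alpha> A j x)"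
proof -
  obtain C where "C > 0" "\<And>x. \<bar>\<Sum>j. wavelet_layer \<psi> \<alpha> A j x\<bar> \<le> C"
    using wavelet_series_bounded[where A = A, OF assms] by blast
  then have "bounded ((\<lambda>x. \<Sum>j. wavelet_layer \<psi> \<alpha> A j x) ` UNIV)"
    by (intro boundedI[of _ C]) (metis (no_types) imageE real_norm_def)
  then show ?thesis unfolding locally_bounded_def by blast
qed

lemma smooth_fast_decay_deriv:
  assumes "smooth_fast_decay r g" "i < r"
  shows "((deriv ^^ i) g has_real_derivative (deriv ^^ Suc i) g x) (at x)"
  using assms unfolding smooth_fast_decay_def by (simp add: DERIV_deriv_iff_field_differentiable)

text \<open>Within half of the distance \<open>2 powr (- \<delta> * real j)\<close> from
  \<open>x0\<close>, the point \<open>2 ^ j * y\<close> stays at distance at least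
  \<open>2 powr ((1 - \<delta>) * real j) / 2\<close> from the selected integers. As
  \<open>\<delta> < 1\<close> this grows exponentially, and fast decay outweighs the powers of
  \<open>2 ^ j\<close> produced by differentiation.\<close>

theorem holder_lower_bound:
  assumes \<psi>: "smooth_fast_decay r \<psi>" and A: "\<And>j. finite (A j)"
    and \<delta>: "0 < \<delta>" "\<delta> < 1" and \<kappa>: "0 < \<kappa>" "\<kappa> < \<alpha>" and r: "(\<alpha> - \<kappa>) / \<delta> < real r"
    and far: "\<forall>\<^sub>F j in sequentially. \<forall>k\<in>A j. 2 powr (- \<delta> * real j) < \<bar>x0 - real k / 2 ^ j\<bar>"
  shows "(\<lambda>x. \<Sum>j. wavelet_layer \<psi> \<alpha> A j x) \<in> pointwise_holder_space ((\<alpha> - \<kappa>) / \<delta>) x0"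
proof -
  let ?h = "(\<alpha> - \<kappa>) / \<delta>"
  \<comment> \<open>One more than the degree allowed in \<open>pointwise_holder_space\<close>; as
    the exponent is below \<open>r\<close>, still \<open>n \<le> r\<close>.\<close>
  define n where "n = Suc (nat \<lfloor>?h\<rfloor>)"
  have h_pos: "?h > 0" using \<kappa> \<delta> by simp
  have n: "n > 0" "n - 1 = nat \<lfloor>?h\<rfloor>" "?h \<le> real n" "n \<le> r"
    using h_pos r by (auto simp: n_def Suc_le_eq) linarith+
  define D where "D i = (deriv ^^ i) \<psi>" for i
  have D0: "D 0 = \<psi>" by (simp add: D_def)
  have D_deriv: "(D i has_real_derivative D (Suc i) x) (at x)" if "i < n" for i x
    unfolding D_def by (rule smooth_fast_decay_deriv[OF \<psi>]) (use that n in simp)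
  have D_decay: "fast_decay (D i)" if "i \<le> n" for i
    using \<psi> that n unfolding D_def smooth_fast_decay_def by auto
  define F where "F j i x = 2 powr (- \<alpha> * real j) * (\<Sum>k\<in>A j. (2 ^ j) ^ i * D i (2 ^ j * x - real k))" for j i x
  have F0: "F j 0 = wavelet_layer \<psi> \<alpha> A j" for j by (rule ext) (simp add: F_def D0 wavelet_layer_def)
  have deriv: "(F j i has_real_derivative F j (Suc i) x) (at x)" if "i < n" for j i x
  proof -
    have "((\<lambda>x. D i (2 ^ j * x - real k)) has_real_derivative D (Suc i) (2 ^ j * x - real k) * 2 ^ j) (at x)" for k
      by (rule DERIV_chain2[OF D_deriv[OF that]]) (auto intro!: derivative_eq_intros)
    then have "((\<lambda>x. (2 ^ j) ^ i * D i (2 ^ j * x - real k)) has_real_derivative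
        (2 ^ j) ^ i * (D (Suc i) (2 ^ j * x - real k) * 2 ^ j)) (at x)" for k
      by (rule DERIV_cmult)
    moreover have "(2 ^ j) ^ i * (D (Suc i) (2 ^ j * x - real k) * 2 ^ j) = (2 ^ j) ^ Suc i * D (Suc i) (2 ^ j * x - real k)" for k
      by simp
    ultimately show ?thesis unfolding F_def by (intro DERIV_cmult DERIV_sum) simp
  qed
  obtain j0 where j0: "\<And>j k. j \<ge> j0 \<Longrightarrow> k \<in> A j \<Longrightarrow> 2 powr (- \<delta> * real j) < \<bar>x0 - real k / 2 ^ j\<bar>"
    using far unfolding eventually_sequentially by blast
  \<comment> \<open>The order of decay for which \<open>R ^ N\<close> compensates
    \<open>(2 ^ j) ^ n\<close> below.\<close>
  obtain N :: nat where N: "real n / (1 - \<delta>) \<le> real N" using real_arch_simple by blast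
  have loc_i: "\<exists>C\<ge>0. \<forall>j y. \<bar>y - x0\<bar> \<le> 2 powr (- \<delta> * real j) / 2 \<longrightarrow> \<bar>F j i y\<bar> \<le> C * 2 powr (- \<alpha> * real j)"
    if i: "i \<le> n" for i
  proof -
    obtain C where C: "C > 0" "\<And>A y R. finite A \<Longrightarrow> 0 \<le> R \<Longrightarrow> \<forall>k\<in>A. R \<le> \<bar>y - real k\<bar> \<Longrightarrow>
      (\<Sum>k\<in>A. \<bar>D i (y - real k)\<bar>) \<le> C / (1 + R) ^ N"
      using fast_decay_translates_sum[OF D_decay[OF i], of N] by blast
    \<comment> \<open>The factor \<open>2 ^ N\<close> comes from the half in \<open>R\<close>;
      \<open>(2 ^ j0) ^ n\<close> covers the finitely many generations before \<open>j0\<close>,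
      where nothing is known about the distances.\<close>
    define C' where "C' = C * 2 ^ N * (2 ^ j0) ^ n"
    have "\<bar>F j i y\<bar> \<le> C' * 2 powr (- \<alpha> * real j)" if y: "\<bar>y - x0\<bar> \<le> 2 powr (- \<delta> * real j) / 2" for j y
    proof -
      have F_le: "\<bar>F j i y\<bar> \<le> 2 powr (- \<alpha> * real j) * ((2 ^ j) ^ i * (\<Sum>k\<in>A j. \<bar>D i (2 ^ j * y - real k)\<bar>))"
        unfolding F_def abs_mult sum_distrib_left[symmetric]
        by (intro mult_mono sum_abs) (auto simp: abs_mult)
      have "(2 ^ j) ^ i * (\<Sum>k\<in>A j. \<bar>D i (2 ^ j * y - real k)\<bar>) \<le> C'"
      proof (cases "j \<ge> j0")
        case True
        define R where "R = 2 powr ((1 - \<delta>) * real j) / 2"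
        have "\<forall>k\<in>A j. R \<le> \<bar>2 ^ j * y - real k\<bar>"
        proof
          fix k assume that: "k \<in> A j"
          have "2 powr (- \<delta> * real j) / 2 \<le> \<bar>y - real k / 2 ^ j\<bar>" using j0[OF True that] y by linarith
          then have "2 ^ j * (2 powr (- \<delta> * real j) / 2) \<le> 2 ^ j * \<bar>y - real k / 2 ^ j\<bar>" by simp
          also have "2 ^ j * \<bar>y - real k / 2 ^ j\<bar> = \<bar>2 ^ j * (y - real k / 2 ^ j)\<bar>" by (simp add: abs_mult)
          also have "2 ^ j * (y - real k / 2 ^ j) = 2 ^ j * y - real k" by (simp add: right_diff_distrib)
          also have "2 ^ j * (2 powr (- \<delta> * real j) / 2) = R"
            by (simp add: R_def powr_realpow[symmetric] powr_add[symmetric] algebra_simps)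
          finally show "R \<le> \<bar>2 ^ j * y - real k\<bar>" .
        qed
        then have "(\<Sum>k\<in>A j. \<bar>D i (2 ^ j * y - real k)\<bar>) \<le> C / (1 + R) ^ N"
          by (intro C A) (auto simp: R_def)
        also have "\<dots> \<le> C / R ^ N" using C(1)
          by (intro divide_left_mono power_mono mult_pos_pos zero_less_power) (auto simp: R_def add_pos_pos)
        also have "\<dots> = C * 2 ^ N * 2 powr (- ((1 - \<delta>) * real j * real N))"
        proof -
          have RN: "R ^ N = 2 powr ((1 - \<delta>) * real j * real N) / 2 ^ N"
            by (simp add: R_def power_divide powr_realpow[symmetric] powr_powr)
          show ?thesis unfolding RN powr_minus_divide by simp
        qed
        finally have "(2 ^ j) ^ i * (\<Sum>k\<in>A j. \<bar>D i (2 ^ j * y - real k)\<bar>) \<le>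
          (2 ^ j) ^ n * (C * 2 ^ N * 2 powr (- ((1 - \<delta>) * real j * real N)))"
          using i by (intro mult_mono power_increasing) (auto intro!: sum_nonneg)
        also have "\<dots> = C * 2 ^ N * 2 powr (real j * (real n - (1 - \<delta>) * real N))"
          by (simp add: powr_realpow[symmetric] powr_powr powr_add[symmetric] algebra_simps)
        also have "\<dots> \<le> C * 2 ^ N * 1"
        proof (intro mult_left_mono)
          have "real n \<le> (1 - \<delta>) * real N" using N \<delta> by (simp add: field_simps)
          then show "2 powr (real j * (real n - (1 - \<delta>) * real N)) \<le> 1"
            using powr_mono[of "real j * (real n - (1 - \<delta>) * real N)" 0 2] by (simp add: mult_nonneg_nonpos)
        qed (use C in simp)
        also have "\<dots> \<le> C'" unfolding C'_def using C(1) by (intro mult_left_mono) auto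
        finally show ?thesis .
      next
        case False
        have "(\<Sum>k\<in>A j. \<bar>D i (2 ^ j * y - real k)\<bar>) \<le> C" using C(2)[OF A, of 0 j "2 ^ j * y"] by simp
        then have "(2 ^ j) ^ i * (\<Sum>k\<in>A j. \<bar>D i (2 ^ j * y - real k)\<bar>) \<le> (2 ^ j0) ^ n * C"
        proof (intro mult_mono)
          have "(2 ^ j :: real) ^ i \<le> (2 ^ j) ^ n" using i by (intro power_increasing) auto
          also have "\<dots> \<le> (2 ^ j0) ^ n" using False by (intro power_mono power_increasing) auto
          finally show "(2 ^ j :: real) ^ i \<le> (2 ^ j0) ^ n" .
        qed (auto intro!: sum_nonneg)
        also have "\<dots> \<le> (2 ^ j0) ^ n * (C * 2 ^ N)" using C(1) by (intro mult_left_mono) auto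
        finally show ?thesis by (simp add: C'_def mult_ac)
      qed
      then have "2 powr (- \<alpha> * real j) * ((2 ^ j) ^ i * (\<Sum>k\<in>A j. \<bar>D i (2 ^ j * y - real k)\<bar>)) \<le> 2 powr (- \<alpha> * real j) * C'"
        by (intro mult_left_mono) auto
      then show ?thesis using F_le by (simp only: mult.commute[of C']) 
    qed
    moreover have "C' \<ge> 0" using C(1) by (simp add: C'_def)
    ultimately show ?thesis by blast
  qed
  then obtain c where c: "\<And>i. i \<le> n \<Longrightarrow> c i \<ge> 0"
    "\<And>i j y. i \<le> n \<Longrightarrow> \<bar>y - x0\<bar> \<le> 2 powr (- \<delta> * real j) / 2 \<Longrightarrow> \<bar>F j i y\<bar> \<le> c i * 2 powr (- \<alpha> * real j)" by metis
  obtain C0 where C0: "C0 > 0" "\<And>j x. \<bar>wavelet_layer \<psi> \<alpha> A j x\<bar> \<le> C0 * 2 powr (- \<alpha> * real j)"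
    using wavelet_layer_bound[of \<psi> A \<alpha>] D_decay[of 0] A by (auto simp: D0)
  define C where "C = (\<Sum>i\<le>n. c i) + C0"
  have "c i \<le> C" if "i \<le> n" for i
    using member_le_sum[of i "{..n}" c] c(1) that C0(1) by (auto simp: C_def)
  then have loc: "\<bar>F j i y\<bar> \<le> C * 2 powr (- \<alpha> * real j)"
    if "i \<le> n" "\<bar>y - x0\<bar> \<le> 2 powr (- \<delta> * real j) / 2" for j i y
    using c(2)[OF that] that(1) by (meson mult_right_mono order_trans powr_ge_zero)
  have "C0 \<le> C" unfolding C_def using c(1) by (auto intro!: sum_nonneg)
  then have glob: "\<bar>F j 0 y\<bar> \<le> C * 2 powr (- \<alpha> * real j)" for j y
    unfolding F0 using C0(2)[of j y] by (meson mult_right_mono order_trans powr_ge_zero)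
  obtain P C' where P: "C' > 0" "degree P \<le> n - 1"
    "\<And>x. \<bar>x - x0\<bar> \<le> 1 \<Longrightarrow> \<bar>(\<Sum>j. F j 0 x) - poly P x\<bar> \<le> C' * \<bar>x - x0\<bar> powr ?h"
    using multiscale_taylor[where F = F, OF n(1) \<delta>(1) \<kappa> n(3) deriv loc glob] by blast
  have "\<forall>\<^sub>F x in nhds x0. x \<in> ball x0 1" by (rule eventually_nhds_in_open) auto
  then have "\<forall>\<^sub>F x in nhds x0. \<bar>(\<Sum>j. wavelet_layer \<psi> \<alpha> A j x) - poly P x\<bar> \<le> C' * \<bar>x - x0\<bar> powr ?h"
    by eventually_elim (use P(3) in \<open>auto simp: F0 dist_real_def abs_minus_commute\<close>)
  moreover have "locally_bounded (\<lambda>x. \<Sum>j. wavelet_layer \<psi> \<alpha> A j x)"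
    using locally_bounded_wavelet_series[of \<psi> A \<alpha>] D_decay[of 0] A \<kappa> by (simp add: D0)
  ultimately show ?thesis unfolding pointwise_holder_space_def using P(1,2) n(2) by auto
qed

section \<open>Vanishing moments and irregularity near the selected points\<close>

lemma integrable_inverse_one_plus_square: "integrable lborel (\<lambda>x::real. inverse (1 + x\<^sup>2))"
  using integrable_inverse_1_plus_square by (simp add: set_integrable_def)

lemma fast_decay_integrable:
  assumes u: "fast_decay u" "u \<in> borel_measurable borel" and g: "g \<in> borel_measurable borel"
    and le: "\<And>x. \<bar>g x\<bar> \<le> K * (1 + \<bar>x\<bar>) ^ N"
  shows "integrable lborel (\<lambda>x. g x * u x)"
proof -
  obtain C where C: "C > 0" "\<And>x. \<bar>u x\<bar> \<le> C / (1 + \<bar>x\<bar>) ^ (N + 2)"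
    using fast_decayD[OF u(1), of "N + 2"] by blast
  show ?thesis
  proof (rule Bochner_Integration.integrable_bound)
    show "integrable lborel (\<lambda>x::real. (\<bar>K\<bar> * C) * inverse (1 + x\<^sup>2))"
      by (intro integrable_mult_right integrable_inverse_one_plus_square)
    show "(\<lambda>x. g x * u x) \<in> borel_measurable lborel" using u g by measurable
    show "AE x in lborel. norm (g x * u x) \<le> norm ((\<bar>K\<bar> * C) * inverse (1 + x\<^sup>2))"
    proof (rule AE_I2)
      fix x :: real
      let ?z = "1 + \<bar>x\<bar>"
      have "\<bar>g x\<bar> \<le> \<bar>K\<bar> * ?z ^ N" by (rule order_trans[OF le]) (intro mult_right_mono, auto)
      then have "\<bar>g x * u x\<bar> \<le> (\<bar>K\<bar> * ?z ^ N) * (C / ?z ^ (N + 2))"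
        unfolding abs_mult using C(2)[of x] by (intro mult_mono) auto
      also have "\<dots> = \<bar>K\<bar> * C * inverse (?z\<^sup>2)"
      proof -
        have "?z > 0" by (rule add_pos_nonneg) auto
        have scale: "(a * z ^ N) * (C / z ^ (N + 2)) = a * C * inverse (z\<^sup>2)" if "z > 0" for a z :: real
        proof -
          have "z ^ N * (C / (z ^ N * z\<^sup>2)) = C / z\<^sup>2" using that by simp
          then show ?thesis by (simp only: power_add mult.assoc) (simp add: divide_inverse)
        qed
        show ?thesis by (rule scale[OF \<open>?z > 0\<close>])
      qed
      also have "\<dots> \<le> \<bar>K\<bar> * C * inverse (1 + x\<^sup>2)"
      proof (intro mult_left_mono le_imp_inverse_le)
        show "1 + x\<^sup>2 \<le> (1 + \<bar>x\<bar>)\<^sup>2" by (simp add: power2_sum)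
        show "0 < 1 + x\<^sup>2" by (rule add_pos_nonneg) auto
      qed (use C in auto)
      finally show "norm (g x * u x) \<le> norm ((\<bar>K\<bar> * C) * inverse (1 + x\<^sup>2))"
        using C(1) by (simp add: abs_mult)
    qed
  qed
qed

lemma one_plus_abs_power: "\<bar>x\<bar> ^ i \<le> 1 * (1 + \<bar>x\<bar> :: real) ^ i"
  by (simp add: power_mono)

locale smooth_wavelet =
  fixes r :: nat and \<phi> \<psi> :: "real \<Rightarrow> real"
  assumes basis: "smooth_wavelet_basis r \<phi> \<psi>" and r_pos: "0 < r"
begin

abbreviation D :: "nat \<Rightarrow> real \<Rightarrow> real" where "D i \<equiv> (deriv ^^ i) \<psi>"

lemma \<psi>_smooth: "smooth_fast_decay r \<psi>"
  using basis by (simp add: smooth_wavelet_basis_def)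

lemma D_deriv: "i < r \<Longrightarrow> (D i has_real_derivative D (Suc i) x) (at x)"
  by (rule smooth_fast_decay_deriv[OF \<psi>_smooth])

lemma D_decay: "i \<le> r \<Longrightarrow> fast_decay (D i)"
  using \<psi>_smooth by (simp add: smooth_fast_decay_def)

lemma \<psi>_decay: "fast_decay \<psi>"
  using D_decay[of 0] by simp

lemma D_continuous: "i < r \<Longrightarrow> continuous_on UNIV (D i)"
  by (intro continuous_at_imp_continuous_on ballI DERIV_isCont[OF D_deriv])

lemma \<psi>_measurable [measurable]: "\<psi> \<in> borel_measurable borel"
  using D_continuous[OF r_pos] by (simp add: borel_measurable_continuous_onI)

lemma \<psi>_integrable:
  assumes "g \<in> borel_measurable borel" "\<And>x. \<bar>g x\<bar> \<le> K * (1 + \<bar>x\<bar>) ^ N"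
  shows "integrable lborel (\<lambda>x. g x * \<psi> x)"
  using fast_decay_integrable[OF \<psi>_decay \<psi>_measurable assms] .

lemma scaled_integral: "(\<integral>x. f x * \<psi> (2 ^ j * x - of_int k) \<partial>lborel) =
    (1 / 2 ^ j) * (\<integral>u. f (of_int k / 2 ^ j + u / 2 ^ j) * \<psi> u \<partial>lborel)"
proof -
  have "2 ^ j * (of_int k / 2 ^ j + 1 / 2 ^ j * u) - of_int k = u" for u :: real
    by (simp add: field_simps)
  then show ?thesis
    using lborel_integral_real_affine[of "1 / 2 ^ j" "\<lambda>x. f x * \<psi> (2 ^ j * x - of_int k)" "of_int k / 2 ^ j"]
    by simp
qed

lemma orthogonality:
  "(\<integral>x. \<psi> (2 ^ j * x - of_int k) * \<psi> (2 ^ j' * x - of_int k') \<partial>lborel) =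
    (if (j, k) = (j', k') then 1 / 2 ^ j else 0)"
proof -
  let ?I = "\<integral>x. \<psi> (2 ^ j * x - of_int k) * \<psi> (2 ^ j' * x - of_int k') \<partial>lborel"
  let ?e = "wavelet_system \<phi> \<psi>"
  have "(\<integral>x. ?e (Inr (j, k)) x * ?e (Inr (j', k')) x \<partial>lborel) = (if Inr (j, k) = (Inr (j', k') :: int + nat \<times> int) then 1 else 0)"
    using basis unfolding smooth_wavelet_basis_def wavelet_basis_def L2_orthonormal_basis_def by blast
  also have "(\<integral>x. ?e (Inr (j, k)) x * ?e (Inr (j', k')) x \<partial>lborel) =
    (\<integral>x. (2 powr (real j / 2) * 2 powr (real j' / 2)) * (\<psi> (2 ^ j * x - of_int k) * \<psi> (2 ^ j' * x - of_int k')) \<partial>lborel)"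
    by (intro Bochner_Integration.integral_cong) (auto simp: mult_ac)
  also have "\<dots> = (2 powr (real j / 2) * 2 powr (real j' / 2)) * ?I" by (rule integral_mult_right_zero)
  finally have eq: "(2 powr (real j / 2) * 2 powr (real j' / 2)) * ?I = (if (j, k) = (j', k') then 1 else 0)" by simp
  show ?thesis
  proof (cases "(j, k) = (j', k')")
    case True
    have "2 powr (real j / 2) * 2 powr (real j / 2) = (2 ^ j :: real)"
      by (simp add: powr_add[symmetric] powr_realpow)
    then have "2 ^ j * ?I = 1" using eq True by simp
    then show ?thesis using True by (simp add: field_simps)
  next
    case False
    then show ?thesis using eq by auto
  qed
qed

text \<open>If \<open>D l\<close> vanished, the derivative one order lower would be constant, hence
  zero by decay, and so on down to \<open>\<psi>\<close>, whose norm is 1.\<close>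

lemma D_not_identically_zero:
  assumes "l < r" shows "\<exists>x. D l x \<noteq> 0"
proof
  have zero: "D i x = 0" if "i \<le> l" "\<forall>x. D l x = 0" for i x
    using that(1)
  proof (induction arbitrary: x rule: inc_induct)
    case base
    then show ?case using that(2) by simp
  next
    case (step i)
    have "D i y = D i 0" for y
      by (rule DERIV_isconst_all[rule_format]) (use D_deriv[of i] step assms in force)
    then have const: "\<bar>D i x\<bar> = \<bar>D i y\<bar>" for y by metis
    obtain C where C: "C > 0" "\<And>x. \<bar>D i x\<bar> \<le> C / (1 + \<bar>x\<bar>) ^ 1"
      using fast_decayD[OF D_decay[of i], of 1] step assms by auto
    have "((\<lambda>y::real. C / (1 + y)) \<longlongrightarrow> 0) at_top" by real_asymp
    moreover have "\<forall>\<^sub>F y::real in at_top. \<bar>D i x\<bar> \<le> C / (1 + y)"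
      using eventually_ge_at_top[of 0]
    proof eventually_elim
      case (elim y)
      then show ?case using C(2)[of y] const[of y] by simp
    qed
    ultimately have "\<bar>D i x\<bar> \<le> 0" by (intro tendsto_le[OF _ _ tendsto_const]) auto
    then show ?case by simp
  qed
  show "D l (SOME x. D l x \<noteq> 0) \<noteq> 0"
  proof (rule someI_ex, rule ccontr)
    assume "\<nexists>x. D l x \<noteq> 0"
    then have "\<psi> x = 0" for x using zero[of 0 x] by simp
    then show False using orthogonality[of 0 0 0 0] by simp
  qed
qed

text \<open>The point has to be dyadic so that wavelets of all fine generations can be centred
  exactly there.\<close>

lemma D_nonzero_dyadic:
  assumes "l < r" obtains j0 :: nat and k0 :: int where "D l (of_int k0 / 2 ^ j0) \<noteq> 0"
proof -
  obtain x where x: "D l x \<noteq> 0" using D_not_identically_zero[OF assms] by blast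
  have "isCont (D l) x" using D_deriv[OF assms] by (rule DERIV_isCont)
  then obtain e where e: "e > 0" "\<And>y. \<bar>y - x\<bar> < e \<Longrightarrow> D l y \<noteq> 0"
    using continuous_at_avoid[of x "D l" 0] x by (auto simp: dist_real_def abs_minus_commute)
  obtain j0 where j0: "(1 / 2) ^ j0 < e" using real_arch_pow_inv[of e "1/2"] e by auto
  have "\<bar>of_int \<lfloor>2 ^ j0 * x\<rfloor> / 2 ^ j0 - x\<bar> \<le> 1 / 2 ^ j0"
  proof -
    have "\<bar>of_int \<lfloor>2 ^ j0 * x\<rfloor> - 2 ^ j0 * x\<bar> \<le> 1" by linarith
    then have "\<bar>of_int \<lfloor>2 ^ j0 * x\<rfloor> - 2 ^ j0 * x\<bar> / 2 ^ j0 \<le> 1 / 2 ^ j0" by (intro divide_right_mono) auto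
    moreover have "of_int \<lfloor>2 ^ j0 * x\<rfloor> / 2 ^ j0 - x = (of_int \<lfloor>2 ^ j0 * x\<rfloor> - 2 ^ j0 * x) / 2 ^ j0"
      by (simp add: diff_divide_distrib)
    ultimately show ?thesis by (simp add: abs_divide)
  qed
  then show ?thesis using e(2) j0 that[of "\<lfloor>2 ^ j0 * x\<rfloor>" j0] by (simp add: power_one_over)
qed

lemma taylor_bound:
  assumes l: "l < r"
  shows "\<exists>B>0. \<forall>a y. \<bar>\<psi> (a + y) - (\<Sum>i\<le>l. D i a / fact i * y ^ i)\<bar> \<le> B * \<bar>y\<bar> ^ Suc l"
proof -
  obtain B where B: "B > 0" "\<And>x. \<bar>D (Suc l) x\<bar> \<le> B"
    using fast_decayD[OF D_decay[of "Suc l"], of 0] l by auto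
  have "\<bar>\<psi> (a + y) - (\<Sum>i\<le>l. D i a / fact i * y ^ i)\<bar> \<le> B * \<bar>y\<bar> ^ Suc l" for a y
  proof (cases "y = 0")
    case True
    have "(\<Sum>i\<le>l. D i a / fact i * 0 ^ i) = (\<Sum>i\<in>{0}. D i a / fact i * 0 ^ i)"
      by (rule sum.mono_neutral_right) auto
    then show ?thesis using True by simp
  next
    case False
    obtain t where t: "\<psi> (a + y) = (\<Sum>i<Suc l. D i a / fact i * (a + y - a) ^ i) + D (Suc l) t / fact (Suc l) * (a + y - a) ^ Suc l"
      using Taylor[of "Suc l" D \<psi> "min a (a + y)" "max a (a + y)" a "a + y"] D_deriv l False by auto
    have "\<bar>\<psi> (a + y) - (\<Sum>i\<le>l. D i a / fact i * y ^ i)\<bar> = \<bar>D (Suc l) t\<bar> / fact (Suc l) * \<bar>y\<bar> ^ Suc l"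
      unfolding t lessThan_Suc_atMost by (simp add: abs_mult power_abs del: fact_Suc)
    also have "\<dots> \<le> B * \<bar>y\<bar> ^ Suc l"
    proof (intro mult_right_mono)
      have "\<bar>D (Suc l) t\<bar> / fact (Suc l) \<le> \<bar>D (Suc l) t\<bar> / 1" by (intro divide_left_mono fact_ge_1) auto
      then show "\<bar>D (Suc l) t\<bar> / fact (Suc l) \<le> B" using B(2)[of t] by simp
    qed auto
    finally show ?thesis .
  qed
  with B(1) show ?thesis by blast
qed

text \<open>Testing \<open>\<psi>\<close> against the wavelets concentrating at a dyadic point where its \<open>l\<close>-th
  derivative does not vanish isolates the \<open>l\<close>-th moment as the leading coefficient.\<close>

theorem vanishing_moments:
  assumes "l < r" shows "(\<integral>x. x ^ l * \<psi> x \<partial>lborel) = 0"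
  using assms
proof (induction l rule: less_induct)
  case (less l)
  obtain j0 k0 where a0: "D l (of_int k0 / 2 ^ j0) \<noteq> 0" using D_nonzero_dyadic[OF less.prems] .
  define a where "a = (of_int k0 / 2 ^ j0 :: real)"
  obtain B where B: "B > 0" "\<And>a y. \<bar>\<psi> (a + y) - (\<Sum>i\<le>l. D i a / fact i * y ^ i)\<bar> \<le> B * \<bar>y\<bar> ^ Suc l"
    using taylor_bound[OF less.prems] by blast
  define m where "m i = (\<integral>x. x ^ i * \<psi> x \<partial>lborel)" for i
  define W where "W = (\<integral>x. \<bar>x\<bar> ^ Suc l * \<bar>\<psi> x\<bar> \<partial>lborel)"
  have int_pow: "integrable lborel (\<lambda>x. x ^ i * \<psi> x)" for i
    by (rule \<psi>_integrable[of _ 1 i]) (use one_plus_abs_power in \<open>auto simp: power_abs\<close>)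
  have int_W: "integrable lborel (\<lambda>x. \<bar>x\<bar> ^ Suc l * \<bar>\<psi> x\<bar>)"
    using integrable_norm[OF int_pow[of "Suc l"]] by (simp add: abs_mult power_abs)
  have key: "\<bar>D l a / fact l * m l\<bar> \<le> (B * W) * (1 / 2) ^ j" if j: "j \<ge> max 1 j0" for j
  proof -
    define e where "e = (1 / 2 :: real) ^ j"
    \<comment> \<open>Keeps the centre \<open>k / 2 ^ j\<close> at \<open>a\<close> while
      \<open>j\<close> grows.\<close>
    define k where "k = k0 * 2 ^ (j - j0)"
    have e: "e > 0" "e = 1 / 2 ^ j" by (simp_all add: e_def power_one_over)
    have ak: "of_int k / 2 ^ j = a"
    proof -
      have "(2::real) ^ j = 2 ^ j0 * 2 ^ (j - j0)" using j by (simp add: power_add[symmetric])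
      then show ?thesis by (simp add: k_def a_def)
    qed
    \<comment> \<open>The condition \<open>j \<ge> 1\<close> ensures that the two wavelets are
      different.\<close>
    have "0 = (\<integral>x. \<psi> (2 ^ 0 * x - of_int 0) * \<psi> (2 ^ j * x - of_int k) \<partial>lborel)"
      unfolding orthogonality using j by simp
    also have "\<dots> = 1 / 2 ^ j * (\<integral>u. \<psi> (a + u / 2 ^ j) * \<psi> u \<partial>lborel)"
      using scaled_integral[of \<psi> j k] by (simp add: ak)
    finally have zero: "(\<integral>u. \<psi> (a + e * u) * \<psi> u \<partial>lborel) = 0" by (simp add: e)
    define T where "T u = (\<Sum>i\<le>l. D i a / fact i * (e * u) ^ i)" for u
    have T_eq: "T u * \<psi> u = (\<Sum>i\<le>l. (D i a / fact i * e ^ i) * (u ^ i * \<psi> u))" for u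
      by (simp add: T_def sum_distrib_left power_mult_distrib mult_ac)
    have int_T: "integrable lborel (\<lambda>u. T u * \<psi> u)"
      unfolding T_eq by (intro Bochner_Integration.integrable_sum integrable_mult_right int_pow)
    have "(\<integral>u. T u * \<psi> u \<partial>lborel) = (\<Sum>i\<le>l. (D i a / fact i * e ^ i) * m i)"
      unfolding T_eq m_def
      by (subst Bochner_Integration.integral_sum) (rule integrable_mult_right[OF int_pow], simp)
    \<comment> \<open>The induction hypothesis removes the lower moments.\<close>
    also have "\<dots> = (\<Sum>i\<in>{l}. (D i a / fact i * e ^ i) * m i)"
      by (rule sum.mono_neutral_right) (use less in \<open>auto simp: m_def\<close>)
    finally have T_int: "(\<integral>u. T u * \<psi> u \<partial>lborel) = D l a / fact l * m l * e ^ l" by simp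
    obtain K where K: "K > 0" "\<And>x. \<bar>\<psi> x\<bar> \<le> K" using fast_decayD[OF \<psi>_decay, of 0] by auto
    have int_\<psi>: "integrable lborel (\<lambda>u. \<psi> (a + e * u) * \<psi> u)"
      by (rule \<psi>_integrable[of _ K 0]) (use K in auto)
    have "- (\<integral>u. T u * \<psi> u \<partial>lborel) = (\<integral>u. (\<psi> (a + e * u) - T u) * \<psi> u \<partial>lborel)"
      using Bochner_Integration.integral_diff[OF int_\<psi> int_T] zero by (simp add: left_diff_distrib)
    also have "\<bar>\<dots>\<bar> \<le> (\<integral>u. (B * e ^ Suc l) * (\<bar>u\<bar> ^ Suc l * \<bar>\<psi> u\<bar>) \<partial>lborel)"
    proof (rule order_trans[OF integral_abs_bound], rule Bochner_Integration.integral_mono)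
      show "integrable lborel (\<lambda>u. \<bar>(\<psi> (a + e * u) - T u) * \<psi> u\<bar>)"
        using integrable_norm[OF Bochner_Integration.integrable_diff[OF int_\<psi> int_T]]
        by (simp add: left_diff_distrib)
      show "integrable lborel (\<lambda>u. (B * e ^ Suc l) * (\<bar>u\<bar> ^ Suc l * \<bar>\<psi> u\<bar>))"
        by (intro integrable_mult_right int_W)
      fix u :: real
      have "\<bar>\<psi> (a + e * u) - T u\<bar> \<le> B * \<bar>e * u\<bar> ^ Suc l" unfolding T_def by (rule B(2))
      also have "\<dots> = (B * e ^ Suc l) * \<bar>u\<bar> ^ Suc l" using e(1) by (simp only: abs_mult power_mult_distrib abs_of_pos mult.assoc)
      finally have "\<bar>\<psi> (a + e * u) - T u\<bar> * \<bar>\<psi> u\<bar> \<le> (B * e ^ Suc l) * \<bar>u\<bar> ^ Suc l * \<bar>\<psi> u\<bar>"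
        by (rule mult_right_mono) simp
      then show "\<bar>(\<psi> (a + e * u) - T u) * \<psi> u\<bar> \<le> (B * e ^ Suc l) * (\<bar>u\<bar> ^ Suc l * \<bar>\<psi> u\<bar>)"
        by (simp only: abs_mult mult.assoc)
    qed
    also have "\<dots> = (B * e ^ Suc l) * W" unfolding W_def by (rule integral_mult_right_zero)
    \<comment> \<open>The leading term is of order \<open>e ^ l\<close> and the remainder of order
      \<open>e ^ Suc l\<close>; cancelling leaves a factor \<open>e\<close> that tends to 0.\<close>
    finally have "\<bar>D l a / fact l * m l\<bar> * e ^ l \<le> (B * W * e) * e ^ l"
      unfolding T_int using e by (simp add: abs_mult mult_ac)
    then show ?thesis using e(1) unfolding e_def[symmetric] by (simp only: mult_le_cancel_right) auto
  qed
  have "(\<lambda>j. (B * W) * (1 / 2) ^ j) \<longlonglongrightarrow> (B * W) * 0"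
    by (intro tendsto_intros LIMSEQ_realpow_zero) auto
  then have "\<bar>D l a / fact l * m l\<bar> \<le> B * W * 0"
    by (rule LIMSEQ_le_const) (use key in blast)
  then have "D l a / fact l * m l = 0" by (simp only: mult_zero_right abs_le_zero_iff)
  then show ?case using a0 by (simp add: a_def m_def)
qed

lemma integral_polynomial:
  assumes "degree Q < r" shows "integrable lborel (\<lambda>x. poly Q x * \<psi> x)" "(\<integral>x. poly Q x * \<psi> x \<partial>lborel) = 0"
proof -
  have int_pow: "integrable lborel (\<lambda>x. x ^ i * \<psi> x)" for i
    by (rule \<psi>_integrable[of _ 1 i]) (use one_plus_abs_power in \<open>auto simp: power_abs\<close>)
  have eq: "poly Q x * \<psi> x = (\<Sum>i\<le>degree Q. coeff Q i * (x ^ i * \<psi> x))" for x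
    by (simp only: poly_altdef sum_distrib_right mult.assoc)
  show "integrable lborel (\<lambda>x. poly Q x * \<psi> x)"
    unfolding eq by (intro Bochner_Integration.integrable_sum integrable_mult_right int_pow)
  have "(\<integral>x. poly Q x * \<psi> x \<partial>lborel) = (\<Sum>i\<le>degree Q. coeff Q i * (\<integral>x. x ^ i * \<psi> x \<partial>lborel))"
    unfolding eq by (subst Bochner_Integration.integral_sum) (auto intro: int_pow)
  also have "\<dots> = 0" using assms vanishing_moments by (intro sum.neutral) auto
  finally show "(\<integral>x. poly Q x * \<psi> x \<partial>lborel) = 0" .
qed

lemma wavelet_layer_measurable [measurable]: "wavelet_layer \<psi> \<alpha> A j \<in> borel_measurable borel"
  unfolding wavelet_layer_def by measurable

text \<open>Orthogonality leaves one term of the series, and the substitution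
  \<open>u = 2 ^ j * x - k\<close> cancels the squared norm \<open>1 / 2 ^ j\<close> of the
  unnormalised wavelet. The factors \<open>2 powr (- \<alpha> * real j')\<close> justify exchanging
  sum and integral.\<close>

lemma wavelet_coefficient:
  assumes A: "\<And>j. finite (A j)" and \<alpha>: "\<alpha> > 0" and k: "k \<in> A j"
  shows "(\<integral>u. (\<Sum>j'. wavelet_layer \<psi> \<alpha> A j' (real k / 2 ^ j + u / 2 ^ j)) * \<psi> u \<partial>lborel) = 2 powr (- \<alpha> * real j)"
proof -
  obtain C where C: "C > 0" "\<And>j x. \<bar>wavelet_layer \<psi> \<alpha> A j x\<bar> \<le> C * 2 powr (- \<alpha> * real j)"
    using wavelet_layer_bound[where A = A, OF \<psi>_decay A, of \<alpha>] by blast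
  let ?g = "\<lambda>j' u. wavelet_layer \<psi> \<alpha> A j' (real k / 2 ^ j + u / 2 ^ j)"
  have abs_int: "integrable lborel (\<lambda>u. 1 * \<psi> u)" by (rule \<psi>_integrable[of _ 1 0]) auto
  then have abs_int': "integrable lborel (\<lambda>u. \<bar>\<psi> u\<bar>)" using integrable_norm by fastforce
  have int: "integrable lborel (\<lambda>u. ?g j' u * \<psi> u)" for j'
    by (rule \<psi>_integrable[of _ "C * 2 powr (- \<alpha> * real j')" 0]) (use C(2) in auto)
  have sm: "summable (\<lambda>j'. norm (?g j' u * \<psi> u))" for u
    using summable_mult2[OF summable_wavelet_layer[where A = A, OF \<psi>_decay A \<alpha>]] by (simp add: abs_mult)
  have sm_int: "summable (\<lambda>j'. \<integral>u. norm (?g j' u * \<psi> u) \<partial>lborel)"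
  proof (rule summable_comparison_test'[where N = 0])
    show "summable (\<lambda>j'. C * 2 powr (- \<alpha> * real j') * (\<integral>u. \<bar>\<psi> u\<bar> \<partial>lborel))"
      by (intro summable_mult2 summable_mult summable_powr_geometric \<alpha>)
    fix j'
    have "(\<integral>u. norm (?g j' u * \<psi> u) \<partial>lborel) \<le> (\<integral>u. C * 2 powr (- \<alpha> * real j') * \<bar>\<psi> u\<bar> \<partial>lborel)"
      using int abs_int' C(2) by (intro Bochner_Integration.integral_mono integrable_norm integrable_mult_right)
        (auto simp: abs_mult intro!: mult_right_mono)
    also have "\<dots> = C * 2 powr (- \<alpha> * real j') * (\<integral>u. \<bar>\<psi> u\<bar> \<partial>lborel)" by (rule integral_mult_right_zero)
    finally show "norm (\<integral>u. norm (?g j' u * \<psi> u) \<partial>lborel) \<le> C * 2 powr (- \<alpha> * real j') * (\<integral>u. \<bar>\<psi> u\<bar> \<partial>lborel)"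
      by simp
  qed
  have layer: "(\<integral>u. ?g j' u * \<psi> u \<partial>lborel) = (if j' = j then 2 powr (- \<alpha> * real j) else 0)" for j'
  proof -
    have "(\<integral>u. ?g j' u * \<psi> u \<partial>lborel) = 2 ^ j * (\<integral>x. wavelet_layer \<psi> \<alpha> A j' x * \<psi> (2 ^ j * x - of_int (int k)) \<partial>lborel)"
      unfolding scaled_integral by simp
    also have "(\<integral>x. wavelet_layer \<psi> \<alpha> A j' x * \<psi> (2 ^ j * x - of_int (int k)) \<partial>lborel) =
      (\<integral>x. (\<Sum>k'\<in>A j'. 2 powr (- \<alpha> * real j') * (\<psi> (2 ^ j' * x - of_int (int k')) * \<psi> (2 ^ j * x - of_int (int k)))) \<partial>lborel)"
      by (simp add: wavelet_layer_def sum_distrib_left sum_distrib_right mult.assoc)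
    also have "\<dots> = (\<Sum>k'\<in>A j'. 2 powr (- \<alpha> * real j') * (\<integral>x. \<psi> (2 ^ j' * x - of_int (int k')) * \<psi> (2 ^ j * x - of_int (int k)) \<partial>lborel))"
    proof (subst Bochner_Integration.integral_sum)
      fix k' assume "k' \<in> A j'"
      obtain K where K: "K > 0" "\<And>x. \<bar>\<psi> x\<bar> \<le> K" using fast_decayD[OF \<psi>_decay, of 0] by auto
      have "integrable lborel (\<lambda>u. \<psi> (2 ^ j' * (real k / 2 ^ j + (1 / 2 ^ j) * u) - of_int (int k')) * \<psi> u)"
        by (rule \<psi>_integrable[of _ K 0]) (use K in auto)
      moreover have "2 ^ j * (real k / 2 ^ j + (1 / 2 ^ j) * u) - of_int (int k) = u" for u :: real
        by (simp add: field_simps)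
      ultimately have "integrable lborel (\<lambda>x. \<psi> (2 ^ j' * x - of_int (int k')) * \<psi> (2 ^ j * x - of_int (int k)))"
        by (subst lborel_integrable_real_affine_iff[of "1 / 2 ^ j" _ "real k / 2 ^ j", symmetric]) simp_all
      then show "integrable lborel (\<lambda>x. 2 powr (- \<alpha> * real j') * (\<psi> (2 ^ j' * x - of_int (int k')) * \<psi> (2 ^ j * x - of_int (int k))))"
        by (rule integrable_mult_right)
    qed simp
    also have "\<dots> = (\<Sum>k'\<in>A j'. if (j', k') = (j, k) then 2 powr (- \<alpha> * real j) * (1 / 2 ^ j) else 0)"
      unfolding orthogonality by (intro sum.cong) auto
    also have "\<dots> = (if j' = j then 2 powr (- \<alpha> * real j) * (1 / 2 ^ j) else 0)"
      using A k by (cases "j' = j") (simp_all add: sum.delta)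
    finally show ?thesis by simp
  qed
  have "(\<integral>u. (\<Sum>j'. wavelet_layer \<psi> \<alpha> A j' (real k / 2 ^ j + u / 2 ^ j)) * \<psi> u \<partial>lborel) =
      (\<integral>u. (\<Sum>j'. ?g j' u * \<psi> u) \<partial>lborel)"
    by (simp only: suminf_mult2[OF summable_rabs_cancel[OF summable_wavelet_layer[where A = A, OF \<psi>_decay A \<alpha>]]])
  also have "\<dots> = (\<Sum>j'. \<integral>u. ?g j' u * \<psi> u \<partial>lborel)"
    by (rule integral_suminf[OF int AE_I2[OF sm] sm_int])
  also have "\<dots> = (\<Sum>j'\<in>{j}. \<integral>u. ?g j' u * \<psi> u \<partial>lborel)"
    by (rule suminf_finite) (auto simp: layer)
  also have "\<dots> = 2 powr (- \<alpha> * real j)" by (simp add: layer)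
  finally show ?thesis .
qed

end

section \<open>Polynomial growth, truncation, and monotonicity of the pointwise Holder
  spaces\<close>

lemma poly_growth: "\<exists>C\<ge>0. \<forall>u::real. \<bar>poly Q u\<bar> \<le> C * (1 + \<bar>u\<bar>) ^ degree Q"
proof (intro exI[of _ "\<Sum>i\<le>degree Q. \<bar>coeff Q i\<bar>"] conjI allI)
  fix u :: real
  have "\<bar>poly Q u\<bar> \<le> (\<Sum>i\<le>degree Q. \<bar>coeff Q i * u ^ i\<bar>)" unfolding poly_altdef by (rule sum_abs)
  also have "\<dots> \<le> (\<Sum>i\<le>degree Q. \<bar>coeff Q i\<bar> * (1 + \<bar>u\<bar>) ^ degree Q)"
  proof (intro sum_mono)
    fix i assume "i \<in> {..degree Q}"
    then have "\<bar>u\<bar> ^ i \<le> (1 + \<bar>u\<bar>) ^ degree Q"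
      by (intro order_trans[OF power_mono[of "\<bar>u\<bar>" "1 + \<bar>u\<bar>" i] power_increasing]) auto
    then show "\<bar>coeff Q i * u ^ i\<bar> \<le> \<bar>coeff Q i\<bar> * (1 + \<bar>u\<bar>) ^ degree Q"
      by (simp add: abs_mult power_abs mult_left_mono)
  qed
  finally show "\<bar>poly Q u\<bar> \<le> (\<Sum>i\<le>degree Q. \<bar>coeff Q i\<bar>) * (1 + \<bar>u\<bar>) ^ degree Q"
    by (simp only: sum_distrib_right)
qed (simp add: sum_nonneg)

lemma poly_truncation:
  fixes Q :: "real poly"
  obtains Q' :: "real poly" and C where "degree Q' \<le> m" "C \<ge> 0"
    "\<forall>u. \<bar>u\<bar> \<le> 1 \<longrightarrow> \<bar>poly Q u - poly Q' u\<bar> \<le> C * \<bar>u\<bar> ^ Suc m"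
proof -
  define Q' where "Q' = (\<Sum>i\<le>m. monom (coeff Q i) i)"
  define C where "C = (\<Sum>i\<le>degree Q. \<bar>coeff Q i\<bar>)"
  have deg: "degree Q' \<le> m" unfolding Q'_def
    by (intro degree_sum_le) (auto intro: order_trans[OF degree_monom_le])
  have "\<bar>poly Q u - poly Q' u\<bar> \<le> C * \<bar>u\<bar> ^ Suc m" if u: "\<bar>u\<bar> \<le> 1" for u
  proof -
    have "poly Q' u = (\<Sum>i\<le>m. coeff Q i * u ^ i)" by (simp add: Q'_def poly_sum poly_monom)
    also have "\<dots> = (\<Sum>i\<le>max m (degree Q). if i \<le> m then coeff Q i * u ^ i else 0)"
      by (rule sum.mono_neutral_cong_left) auto
    finally have Q'_eq: "poly Q' u = (\<Sum>i\<le>max m (degree Q). if i \<le> m then coeff Q i * u ^ i else 0)" .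
    have Q_eq: "poly Q u = (\<Sum>i\<le>max m (degree Q). coeff Q i * u ^ i)"
      unfolding poly_altdef by (rule sum.mono_neutral_left) (auto simp: coeff_eq_0)
    have "\<bar>poly Q u - poly Q' u\<bar> \<le> (\<Sum>i\<le>max m (degree Q). \<bar>coeff Q i * u ^ i - (if i \<le> m then coeff Q i * u ^ i else 0)\<bar>)"
      unfolding Q_eq Q'_eq sum_subtractf[symmetric] by (rule sum_abs)
    also have "\<dots> \<le> (\<Sum>i\<le>max m (degree Q). \<bar>coeff Q i\<bar> * \<bar>u\<bar> ^ Suc m)"
    proof (intro sum_mono)
      fix i
      show "\<bar>coeff Q i * u ^ i - (if i \<le> m then coeff Q i * u ^ i else 0)\<bar> \<le> \<bar>coeff Q i\<bar> * \<bar>u\<bar> ^ Suc m"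
      proof (cases "i \<le> m")
        case False
        then have "\<bar>u\<bar> ^ i \<le> \<bar>u\<bar> ^ Suc m" using u by (intro power_decreasing) auto
        then have "\<bar>coeff Q i\<bar> * \<bar>u\<bar> ^ i \<le> \<bar>coeff Q i\<bar> * \<bar>u\<bar> ^ Suc m" by (intro mult_left_mono) auto
        then show ?thesis using False by (simp only: abs_mult power_abs if_False diff_zero)
      qed auto
    qed
    also have "\<dots> = (\<Sum>i\<le>max m (degree Q). \<bar>coeff Q i\<bar>) * \<bar>u\<bar> ^ Suc m" by (simp only: sum_distrib_right)
    also have "(\<Sum>i\<le>max m (degree Q). \<bar>coeff Q i\<bar>) = C"
      unfolding C_def by (rule sum.mono_neutral_right) (auto simp: coeff_eq_0)
    finally show ?thesis .
  qed
  moreover have "C \<ge> 0" by (simp add: C_def sum_nonneg)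
  ultimately show ?thesis using that[of Q' C] deg by blast
qed

text \<open>A smaller exponent also lowers the degree allowed for the polynomial, so it has to be
  truncated about \<open>x0\<close>; the discarded powers have degree at least \<open>Suc m\<close>,
  which is at least \<open>h\<close>.\<close>

lemma pointwise_holder_space_mono:
  assumes h: "0 < h" "h \<le> h'" and f: "f \<in> pointwise_holder_space h' x0"
  shows "f \<in> pointwise_holder_space h x0"
proof -
  obtain C P where C: "C > 0" "locally_bounded f" "\<forall>\<^sub>F x in nhds x0. \<bar>f x - poly P x\<bar> \<le> C * \<bar>x - x0\<bar> powr h'"
    using f unfolding pointwise_holder_space_def by blast
  define m where "m = nat \<lfloor>h\<rfloor>"
  have m: "h \<le> real (Suc m)" using h unfolding m_def by linarith
  obtain Q' C' where Q': "degree Q' \<le> m" "C' \<ge> 0"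
    "\<forall>u. \<bar>u\<bar> \<le> 1 \<longrightarrow> \<bar>poly (pcompose P [:x0, 1:]) u - poly Q' u\<bar> \<le> C' * \<bar>u\<bar> ^ Suc m"
    by (rule poly_truncation)
  define P' where "P' = pcompose Q' [:- x0, 1:]"
  have "degree P' \<le> m" using Q'(1) degree_pcompose_le[of Q' "[:- x0, 1:]"] by (simp add: P'_def)
  moreover have "\<forall>\<^sub>F x in nhds x0. \<bar>f x - poly P' x\<bar> \<le> (C + C') * \<bar>x - x0\<bar> powr h"
    using C(3) eventually_nhds_ball[OF zero_less_one, of x0]
  proof eventually_elim
    case (elim x)
    have x: "\<bar>x - x0\<bar> \<le> 1" using elim(2) by (simp add: dist_real_def abs_minus_commute)
    show ?case
    proof (cases "x = x0")
      case True
      have "\<bar>poly (pcompose P [:x0, 1:]) 0 - poly Q' 0\<bar> \<le> C' * \<bar>0\<bar> ^ Suc m" using Q'(3)[rule_format, of 0] by simp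
      then have "poly P x0 = poly P' x0" by (simp add: poly_pcompose P'_def)
      then show ?thesis using elim(1) True by simp
    next
      case False
      have 1: "C * \<bar>x - x0\<bar> powr h' \<le> C * \<bar>x - x0\<bar> powr h"
        using C(1) h x False by (intro mult_left_mono powr_mono') auto
      have "\<bar>poly P x - poly P' x\<bar> \<le> C' * \<bar>x - x0\<bar> ^ Suc m"
        using Q'(3)[rule_format, OF x] by (simp add: poly_pcompose P'_def)
      also have "\<dots> = C' * \<bar>x - x0\<bar> powr real (Suc m)" using False by (subst powr_realpow) auto
      also have "\<dots> \<le> C' * \<bar>x - x0\<bar> powr h"
        using Q'(2) m x False by (intro mult_left_mono powr_mono') auto
      finally have "\<bar>poly P x - poly P' x\<bar> \<le> C' * \<bar>x - x0\<bar> powr h" .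
      then show ?thesis using 1 elim(1) by (simp only: distrib_right)
    qed
  qed
  moreover have "C + C' > 0" using C(1) Q'(2) by simp
  ultimately show ?thesis unfolding pointwise_holder_space_def m_def using C(2) by blast
qed

context smooth_wavelet
begin

text \<open>The coefficient of a selected wavelet is exactly
  \<open>2 powr (- \<alpha> * real j)\<close>. Vanishing moments allow \<open>P\<close> to be
  subtracted, and for a wavelet centred within \<open>K * 2 powr (- \<delta> * real j)\<close> of
  \<open>x0\<close> the Holder bound makes the coefficient at most a constant times
  \<open>2 powr (- (\<delta> * h) * real j)\<close>. Infinitely many such \<open>j\<close> force the
  inequality.\<close>

theorem holder_condition_necessary:
  assumes A: "\<And>j. finite (A j)" and \<alpha>: "\<alpha> > 0" and h: "0 < h" "nat \<lfloor>h\<rfloor> < r" and \<delta>: "0 < \<delta>" "\<delta> \<le> 1" and K: "K \<ge> 0"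
    and f: "(\<lambda>x. \<Sum>j. wavelet_layer \<psi> \<alpha> A j x) \<in> pointwise_holder_space h x0"
    and freq: "\<forall>J. \<exists>j\<ge>J. \<exists>k\<in>A j. \<bar>x0 - real k / 2 ^ j\<bar> \<le> K * 2 powr (- \<delta> * real j)"
  shows "\<delta> * h \<le> \<alpha>"
proof (rule ccontr)
  assume "\<not> \<delta> * h \<le> \<alpha>"
  then have less: "\<alpha> < \<delta> * h" by simp
  define f where "f x = (\<Sum>j. wavelet_layer \<psi> \<alpha> A j x)" for x
  obtain B where B: "B > 0" "\<And>x. \<bar>f x\<bar> \<le> B"
    using wavelet_series_bounded[where A = A, OF \<psi>_decay A \<alpha>] unfolding f_def by blast
  have f_meas: "f \<in> borel_measurable borel" unfolding f_def by measurable
  have "f \<in> pointwise_holder_space h x0" using f by (simp only: f_def[abs_def])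
  then obtain C P where C: "C > 0" "degree P \<le> nat \<lfloor>h\<rfloor>" "\<forall>\<^sub>F x in nhds x0. \<bar>f x - poly P x\<bar> \<le> C * \<bar>x - x0\<bar> powr h"
    unfolding pointwise_holder_space_def by blast
  then obtain \<rho> where \<rho>: "\<rho> > 0" "\<And>x. \<bar>x - x0\<bar> < \<rho> \<Longrightarrow> \<bar>f x - poly P x\<bar> \<le> C * \<bar>x - x0\<bar> powr h"
    unfolding eventually_nhds_metric dist_real_def by blast
  define Q where "Q = pcompose P [:x0, 1:]"
  define n where "n = degree Q"
  obtain CQ where CQ: "CQ \<ge> 0" "\<And>u. \<bar>poly Q u\<bar> \<le> CQ * (1 + \<bar>u\<bar>) ^ n"
    using poly_growth[of Q] unfolding n_def by blast
  \<comment> \<open>The Holder bound is local, while the integral against \<open>\<psi>\<close> runs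
    over the whole line. Beyond \<open>\<rho>\<close> the bounds on \<open>f\<close> and on the
    growth of \<open>P\<close> are compared with \<open>\<rho> powr h\<close>, which extends the
    estimate at the price of polynomial growth.\<close>
  define C1 where "C1 = C + (B + CQ) * \<rho> powr (- h)"
  have C1: "C \<le> C1" "(B + CQ) * \<rho> powr (- h) \<le> C1" "C1 > 0" using B(1) CQ(1) C(1) by (auto simp: C1_def add_pos_nonneg)
  have global: "\<bar>f x - poly P x\<bar> \<le> C1 * \<bar>x - x0\<bar> powr h * (1 + \<bar>x - x0\<bar>) ^ n" for x
  proof (cases "\<bar>x - x0\<bar> < \<rho>")
    case True
    have "\<bar>f x - poly P x\<bar> \<le> C * \<bar>x - x0\<bar> powr h * 1" using \<rho>(2)[OF True] by simp
    also have "\<dots> \<le> C1 * \<bar>x - x0\<bar> powr h * (1 + \<bar>x - x0\<bar>) ^ n"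
      using C1 by (intro mult_mono mult_right_mono) (auto intro: one_le_power)
    finally show ?thesis .
  next
    case False
    have "poly P x = poly Q (x - x0)" by (simp add: Q_def poly_pcompose)
    then have "\<bar>f x - poly P x\<bar> \<le> B + CQ * (1 + \<bar>x - x0\<bar>) ^ n"
      using B(2)[of x] CQ(2)[of "x - x0"] abs_triangle_ineq4[of "f x" "poly P x"] by linarith
    also have "\<dots> \<le> (B + CQ) * (1 + \<bar>x - x0\<bar>) ^ n"
    proof -
      have "B * 1 \<le> B * (1 + \<bar>x - x0\<bar>) ^ n" using B(1) by (intro mult_left_mono one_le_power) auto
      then show ?thesis by (simp only: distrib_right mult_1_right)
    qed
    also have "\<dots> = (B + CQ) * 1 * (1 + \<bar>x - x0\<bar>) ^ n" by simp
    also have "\<dots> \<le> (B + CQ) * (\<rho> powr (- h) * \<bar>x - x0\<bar> powr h) * (1 + \<bar>x - x0\<bar>) ^ n"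
    proof (intro mult_right_mono mult_left_mono)
      have "1 = \<rho> powr (- h) * \<rho> powr h" using \<rho>(1) by (simp add: powr_add[symmetric])
      also have "\<dots> \<le> \<rho> powr (- h) * \<bar>x - x0\<bar> powr h"
        using False \<rho>(1) h by (intro mult_left_mono powr_mono2) auto
      finally show "1 \<le> \<rho> powr (- h) * \<bar>x - x0\<bar> powr h" .
    qed (use B(1) CQ(1) in auto)
    also have "\<dots> \<le> C1 * \<bar>x - x0\<bar> powr h * (1 + \<bar>x - x0\<bar>) ^ n"
      unfolding mult.assoc[symmetric] using C1(2) by (intro mult_right_mono) auto
    finally show ?thesis .
  qed
  \<comment> \<open>Total polynomial growth of the global estimate in the wavelet variable: the
    exponent \<open>h\<close> rounded up plus the degree of \<open>P\<close>. Fast decay makes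
    \<open>W\<close> finite.\<close>
  define N where "N = nat \<lceil>h\<rceil> + n"
  define C2 where "C2 = C1 * (K + 1) powr h * (K + 2) ^ n"
  define W where "W = (\<integral>u. (1 + \<bar>u\<bar>) ^ N * \<bar>\<psi> u\<bar> \<partial>lborel)"
  have C2: "C2 > 0" using C1(3) K by (simp add: C2_def)
  have int_W: "integrable lborel (\<lambda>u. (1 + \<bar>u\<bar>) ^ N * \<bar>\<psi> u\<bar>)"
  proof -
    have "integrable lborel (\<lambda>u. (1 + \<bar>u\<bar>) ^ N * \<psi> u)" by (rule \<psi>_integrable[of _ 1 N]) auto
    from integrable_norm[OF this] show ?thesis by (simp add: abs_mult power_abs)
  qed
  have bound: "2 powr (- \<alpha> * real j) \<le> C2 * W * 2 powr (- (\<delta> * h) * real j)"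
    if k: "k \<in> A j" "\<bar>x0 - real k / 2 ^ j\<bar> \<le> K * 2 powr (- \<delta> * real j)" for j k
  proof -
    define b where "b = real k / 2 ^ j"
    define e where "e = 2 powr (- \<delta> * real j)"
    have e: "e > 0" "1 / 2 ^ j \<le> e" "e \<le> 1"
    proof -
      have "\<delta> * real j \<le> 1 * real j" using \<delta> by (intro mult_right_mono) auto
      then have "2 powr (- real j) \<le> e" by (simp add: e_def)
      then show "1 / 2 ^ j \<le> e" by (simp add: powr_minus powr_realpow divide_inverse)
      have "e \<le> 2 powr 0" unfolding e_def using \<delta> by (intro powr_mono) auto
      then show "e \<le> 1" by simp
    qed (simp add: e_def)
    define v where "v u = b + u / 2 ^ j" for u
    have v: "\<bar>v u - x0\<bar> \<le> (K + 1) * e * (1 + \<bar>u\<bar>)" for u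
    proof -
      have "\<bar>v u - x0\<bar> \<le> \<bar>x0 - b\<bar> + \<bar>u / 2 ^ j\<bar>" unfolding v_def by linarith
      also have "\<bar>u / 2 ^ j\<bar> = 1 / 2 ^ j * \<bar>u\<bar>" by (simp add: abs_divide)
      also have "\<bar>x0 - b\<bar> + 1 / 2 ^ j * \<bar>u\<bar> \<le> K * e + e * \<bar>u\<bar>"
        using k(2) e by (intro add_mono mult_right_mono) (auto simp: b_def e_def)
      also have "\<dots> \<le> K * e * (1 + \<bar>u\<bar>) + e * (1 + \<bar>u\<bar>)"
      proof (intro add_mono)
        have "K * e * 1 \<le> K * e * (1 + \<bar>u\<bar>)" using K e by (intro mult_left_mono) auto
        then show "K * e \<le> K * e * (1 + \<bar>u\<bar>)" by simp
      qed (use e in simp)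
      finally show ?thesis by (simp only: distrib_right mult_1)
    qed
    have pt: "\<bar>f (v u) - poly P (v u)\<bar> \<le> C2 * 2 powr (- (\<delta> * h) * real j) * (1 + \<bar>u\<bar>) ^ N" for u
    proof -
      let ?z = "1 + \<bar>u\<bar>"
      have "\<bar>v u - x0\<bar> powr h \<le> ((K + 1) * e * ?z) powr h" using v h by (intro powr_mono2) auto
      also have "\<dots> = (K + 1) powr h * e powr h * ?z powr h" using K e by (simp add: powr_mult)
      also have "\<dots> \<le> (K + 1) powr h * e powr h * ?z ^ nat \<lceil>h\<rceil>"
      proof (intro mult_left_mono)
        have "?z powr h \<le> ?z powr real (nat \<lceil>h\<rceil>)" using h(1) by (intro powr_mono) linarith+
        also have "\<dots> = ?z ^ nat \<lceil>h\<rceil>" by (rule powr_realpow) (simp add: add_pos_nonneg)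
        finally show "?z powr h \<le> ?z ^ nat \<lceil>h\<rceil>" .
      qed auto
      finally have 1: "\<bar>v u - x0\<bar> powr h \<le> (K + 1) powr h * e powr h * ?z ^ nat \<lceil>h\<rceil>" .
      have "(K + 1) * e * ?z \<le> (K + 1) * 1 * ?z" using e K by (intro mult_right_mono mult_left_mono) auto
      then have "1 + \<bar>v u - x0\<bar> \<le> 1 + (K + 1) * ?z" using v[of u] by simp
      also have "\<dots> \<le> ?z + (K + 1) * ?z" by simp
      also have "\<dots> = (K + 2) * ?z" by (simp add: algebra_simps)
      finally have 2: "(1 + \<bar>v u - x0\<bar>) ^ n \<le> ((K + 2) * ?z) ^ n" by (intro power_mono) auto
      have "\<bar>f (v u) - poly P (v u)\<bar> \<le> C1 * \<bar>v u - x0\<bar> powr h * (1 + \<bar>v u - x0\<bar>) ^ n" by (rule global)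
      also have "\<dots> \<le> C1 * ((K + 1) powr h * e powr h * ?z ^ nat \<lceil>h\<rceil>) * ((K + 2) * ?z) ^ n"
        using 1 2 C1(3) K by (intro mult_mono) auto
      also have "\<dots> = C2 * e powr h * ?z ^ N"
        unfolding C2_def N_def power_mult_distrib power_add by (simp only: mult_ac)
      also have "e powr h = 2 powr (- (\<delta> * h) * real j)" by (simp add: e_def powr_powr mult_ac)
      finally show ?thesis .
    qed
    define R where "R = pcompose P [:b, 1 / 2 ^ j:]"
    have R: "poly R u = poly P (v u)" for u by (simp add: R_def poly_pcompose v_def)
    have "degree R < r" using degree_pcompose_le[of P "[:b, 1 / 2 ^ j:]"] C(2) h(2) by (simp add: R_def)
    note R_int = integral_polynomial[OF this, unfolded R]
    have f_int: "integrable lborel (\<lambda>u. f (v u) * \<psi> u)"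
      by (rule \<psi>_integrable[of _ B 0]) (use f_meas B(2) in \<open>auto simp: v_def\<close>)
    have "2 powr (- \<alpha> * real j) = (\<integral>u. f (v u) * \<psi> u \<partial>lborel)"
      using wavelet_coefficient[where A = A, OF A \<alpha> k(1)] by (simp only: f_def v_def b_def)
    also have "\<dots> = (\<integral>u. f (v u) * \<psi> u - poly P (v u) * \<psi> u \<partial>lborel)"
      by (simp only: Bochner_Integration.integral_diff[OF f_int R_int(1)] R_int(2) diff_zero)
    also have "\<dots> \<le> (\<integral>u. (C2 * 2 powr (- (\<delta> * h) * real j)) * ((1 + \<bar>u\<bar>) ^ N * \<bar>\<psi> u\<bar>) \<partial>lborel)"
    proof (rule Bochner_Integration.integral_mono)
      fix u
      have "f (v u) * \<psi> u - poly P (v u) * \<psi> u \<le> \<bar>f (v u) - poly P (v u)\<bar> * \<bar>\<psi> u\<bar>"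
        by (simp only: left_diff_distrib[symmetric] abs_mult[symmetric] abs_ge_self)
      also have "\<dots> \<le> C2 * 2 powr (- (\<delta> * h) * real j) * (1 + \<bar>u\<bar>) ^ N * \<bar>\<psi> u\<bar>"
        using pt by (intro mult_right_mono) auto
      finally show "f (v u) * \<psi> u - poly P (v u) * \<psi> u \<le> (C2 * 2 powr (- (\<delta> * h) * real j)) * ((1 + \<bar>u\<bar>) ^ N * \<bar>\<psi> u\<bar>)"
        by (simp only: mult.assoc)
    qed (intro Bochner_Integration.integrable_diff f_int R_int integrable_mult_right int_W)+
    also have "\<dots> = (C2 * 2 powr (- (\<delta> * h) * real j)) * W" unfolding W_def by (rule integral_mult_right_zero)
    finally show ?thesis by (simp only: mult_ac)
  qed
  \<comment> \<open>The extra factor 2 makes this incompatible with \<open>bound\<close>, since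
    \<open>2 powr (- \<alpha> * real j)\<close> is positive.\<close>
  have "\<forall>\<^sub>F j in sequentially. (2 * (C2 * W)) * 2 powr (- (\<delta> * h) * real j) \<le> 2 powr (- \<alpha> * real j)"
    by (rule eventually_exponential_le[OF less])
  then obtain J where J: "\<And>j. j \<ge> J \<Longrightarrow> (2 * (C2 * W)) * 2 powr (- (\<delta> * h) * real j) \<le> 2 powr (- \<alpha> * real j)"
    unfolding eventually_sequentially by blast
  obtain j k where jk: "j \<ge> J" "k \<in> A j" "\<bar>x0 - real k / 2 ^ j\<bar> \<le> K * 2 powr (- \<delta> * real j)" using freq by blast
  have "2 powr (- \<alpha> * real j) > 0" by simp
  then show False using J[OF jk(1)] bound[OF jk(2,3)] by linarith
qed

text \<open>An exponent \<open>h'\<close> in the supremum may exceed \<open>r\<close>, where the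
  moment condition is no longer available; by monotonicity it is replaced by an \<open>h\<close>
  strictly between \<open>\<alpha> / \<delta>\<close> and \<open>r\<close>.\<close>

lemma holder_exponent_upper:
  assumes A: "\<And>j. finite (A j)" and \<alpha>: "\<alpha> > 0" and \<delta>: "0 < \<delta>" "\<delta> \<le> 1" and K: "K \<ge> 0" and r: "\<alpha> / \<delta> < real r"
    and freq: "\<forall>J. \<exists>j\<ge>J. \<exists>k\<in>A j. \<bar>x0 - real k / 2 ^ j\<bar> \<le> K * 2 powr (- \<delta> * real j)"
  shows "holder_exponent (\<lambda>x. \<Sum>j. wavelet_layer \<psi> \<alpha> A j x) x0 \<le> ereal (\<alpha> / \<delta>)"
proof -
  let ?f = "\<lambda>x. \<Sum>j. wavelet_layer \<psi> \<alpha> A j x"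
  have pos: "0 < \<alpha> / \<delta>" using \<alpha> \<delta> by simp
  have "h' \<le> \<alpha> / \<delta>" if h': "0 < h'" "?f \<in> pointwise_holder_space h' x0" for h'
  proof (rule ccontr)
    assume "\<not> h' \<le> \<alpha> / \<delta>"
    then have gr: "\<alpha> / \<delta> < h'" by simp
    define h where "h = min h' ((\<alpha> / \<delta> + real r) / 2)"
    have h: "\<alpha> / \<delta> < h" "h \<le> h'" "h < real r" 
    proof -
      have "q < min h' ((q + R) / 2) \<and> min h' ((q + R) / 2) \<le> h' \<and> min h' ((q + R) / 2) < R"
        if "q < h'" "q < R" for q R :: real
        using that by (auto simp: min_def)
      from this[OF gr r] show "\<alpha> / \<delta> < h" "h \<le> h'" "h < real r" by (simp_all only: h_def)
    qed
    then have "0 < h" using pos by linarith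
    then have "nat \<lfloor>h\<rfloor> < r" using h(3) by linarith
    from holder_condition_necessary[OF A \<alpha> \<open>0 < h\<close> this \<delta> K pointwise_holder_space_mono[OF \<open>0 < h\<close> h(2) h'(2)] freq]
    have "h \<le> \<alpha> / \<delta>" using \<delta> by (simp add: pos_le_divide_eq mult.commute)
    then show False using h(1) by simp
  qed
  then show ?thesis unfolding holder_exponent_def using pos by (intro Sup_least) auto
qed

end

lemma holder_exponent_lower:
  assumes "0 < h" "f \<in> pointwise_holder_space h x0" shows "ereal h \<le> holder_exponent f x0"
  unfolding holder_exponent_def using assms by (intro Sup_upper) auto

section \<open>The spectrum of the lacunary wavelet series\<close>

lemma hausdorff_measure_limsup_balls_eq_0:
  assumes t: "t > 0" and \<delta>: "\<delta> > 0" and u: "u < \<delta> * t" and A: "\<And>j. finite (A j)"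
    and card: "\<forall>\<^sub>F j in sequentially. real (card (A j)) \<le> c * 2 powr (u * real j)"
  shows "hausdorff_measure t {x. \<forall>J. \<exists>j\<ge>J. \<exists>k\<in>A j. \<bar>x - real k / 2 ^ j\<bar> \<le> 2 powr (- \<delta> * real j)} = 0"
proof (rule hausdorff_measure_eq_0I[OF t])
  fix e :: real assume e: "e > 0"
  \<comment> \<open>Half of the gap: one factor \<open>2 powr (- w * real j)\<close> makes the sum
    over generations converge, the other is at most \<open>2 powr (- w * real J)\<close> and makes
    it small.\<close>
  define w where "w = (\<delta> * t - u) / 2"
  have w: "w > 0" using u by (simp add: w_def)
  define C where "C = \<bar>c\<bar> * 2 powr t + 1"
  have C: "C > 0" by (simp add: C_def add_nonneg_pos)
  define S where "S = (\<Sum>j::nat. 2 powr (- w * real j))"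
  have S: "S \<ge> 0" unfolding S_def by (intro suminf_nonneg summable_powr_geometric w) auto
  have "((\<lambda>J::nat. C * S * 2 powr (- w * real J)) \<longlongrightarrow> 0) sequentially" using w by real_asymp
  then have "\<forall>\<^sub>F J::nat in sequentially. C * S * 2 powr (- w * real J) < e" using e by (rule order_tendstoD(2))
  moreover obtain J0 where J0: "\<And>j. j \<ge> J0 \<Longrightarrow> real (card (A j)) \<le> c * 2 powr (u * real j)"
    using card unfolding eventually_sequentially by blast
  ultimately obtain J :: nat where J: "J \<ge> J0" "C * S * 2 powr (- w * real J) < e"
    unfolding eventually_sequentially by (metis linorder_linear order_trans max.cobounded1 max.cobounded2)
  define V where "V = (\<lambda>(j, k). if J \<le> j \<and> k \<in> A j then cball (real k / 2 ^ j) (2 powr (- \<delta> * real j)) else {})"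
  define U where "U i = V (prod_decode i)" for i
  have cover: "{x. \<forall>J. \<exists>j\<ge>J. \<exists>k\<in>A j. \<bar>x - real k / 2 ^ j\<bar> \<le> 2 powr (- \<delta> * real j)} \<subseteq> (\<Union>i. U i)"
  proof
    fix x assume "x \<in> {x. \<forall>J. \<exists>j\<ge>J. \<exists>k\<in>A j. \<bar>x - real k / 2 ^ j\<bar> \<le> 2 powr (- \<delta> * real j)}"
    then obtain j k where jk: "j \<ge> J" "k \<in> A j" "\<bar>x - real k / 2 ^ j\<bar> \<le> 2 powr (- \<delta> * real j)" by blast
    then have "x \<in> U (prod_encode (j, k))" by (simp add: U_def V_def dist_real_def abs_minus_commute)
    then show "x \<in> (\<Union>i. U i)" by blast
  qed
  have bd: "bounded (U i)" for i by (simp add: U_def V_def split: prod.split)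
  have V_le: "diam_power t (V (j, k)) \<le> 2 powr t * 2 powr (- (\<delta> * t) * real j)" for j k
  proof (cases "J \<le> j \<and> k \<in> A j")
    case True
    let ?\<rho> = "2 powr (- \<delta> * real j)"
    have "diam_power t (V (j, k)) \<le> (2 * ?\<rho>) powr t"
      using True by (intro diam_power_le t) (auto simp: V_def)
    also have "\<dots> = 2 powr t * 2 powr (- (\<delta> * t) * real j)" by (simp add: powr_mult powr_powr mult_ac)
    finally show ?thesis .
  qed (auto simp: V_def)
  define G where "G j = C * 2 powr (- w * real J) * 2 powr (- w * real j)" for j :: nat
  have inner: "(\<Sum>k. ennreal (diam_power t (V (j, k)))) \<le> ennreal (G j)" for j
  proof (cases "J \<le> j")
    case True
    have "(\<Sum>k. ennreal (diam_power t (V (j, k)))) = (\<Sum>k\<in>A j. ennreal (diam_power t (V (j, k))))"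
      by (rule suminf_finite[OF A]) (simp add: V_def)
    also have "\<dots> \<le> (\<Sum>k\<in>A j. ennreal (2 powr t * 2 powr (- (\<delta> * t) * real j)))"
      by (intro sum_mono ennreal_leI V_le)
    also have "\<dots> = ennreal (real (card (A j)) * (2 powr t * 2 powr (- (\<delta> * t) * real j)))"
      by (simp add: ennreal_of_nat_eq_real_of_nat ennreal_mult'[symmetric])
    also have "\<dots> \<le> ennreal (G j)"
    proof (rule ennreal_leI)
      have "real (card (A j)) * (2 powr t * 2 powr (- (\<delta> * t) * real j)) \<le>
          (\<bar>c\<bar> * 2 powr (u * real j)) * (2 powr t * 2 powr (- (\<delta> * t) * real j))"
        using J0[of j] J(1) True by (intro mult_right_mono) (auto intro: order_trans[OF _ mult_right_mono[OF abs_ge_self]])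
      also have "\<dots> = (\<bar>c\<bar> * 2 powr t) * (2 powr (u * real j) * 2 powr (- (\<delta> * t) * real j))" by (simp only: mult_ac)
      also have "2 powr (u * real j) * 2 powr (- (\<delta> * t) * real j) = 2 powr (- w * real j) * 2 powr (- w * real j)"
      proof -
        have \<delta>t: "\<delta> * t = u + 2 * w" unfolding w_def by (simp add: field_simps)
        show ?thesis unfolding \<delta>t by (simp add: powr_add[symmetric] algebra_simps)
      qed
      also have "(\<bar>c\<bar> * 2 powr t) * (2 powr (- w * real j) * 2 powr (- w * real j)) \<le>
          C * (2 powr (- w * real J) * 2 powr (- w * real j))"
        using True w C by (intro mult_mono mult_right_mono) (auto simp: C_def)
      finally show "real (card (A j)) * (2 powr t * 2 powr (- (\<delta> * t) * real j)) \<le> G j"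
        by (simp only: G_def mult.assoc)
    qed
    finally show ?thesis .
  next
    case False
    then have "(\<Sum>k. ennreal (diam_power t (V (j, k)))) = (\<Sum>k::nat. 0)"
      by (intro suminf_cong) (simp add: V_def)
    then show ?thesis by simp
  qed
  have "(\<Sum>i. ennreal (diam_power t (U i))) = (\<Sum>j. \<Sum>k. ennreal (diam_power t (V (j, k))))"
    unfolding U_def by (rule suminf_ennreal_2dimen) simp
  also have "\<dots> \<le> (\<Sum>j. ennreal (G j))" by (intro suminf_le inner summableI)
  also have "\<dots> = ennreal (\<Sum>j. G j)"
    unfolding G_def using C by (intro suminf_ennreal2 summable_mult summable_powr_geometric w) auto
  also have "(\<Sum>j. G j) = C * 2 powr (- w * real J) * S"
    unfolding G_def S_def by (intro suminf_mult summable_powr_geometric w)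
  also have "ennreal \<dots> < ennreal e" using J(2) e by (intro ennreal_lessI) (simp_all add: mult_ac)
  finally show "\<exists>U :: nat \<Rightarrow> real set. {x. \<forall>J. \<exists>j\<ge>J. \<exists>k\<in>A j. \<bar>x - real k / 2 ^ j\<bar> \<le> 2 powr (- \<delta> * real j)} \<subseteq> (\<Union>i. U i) \<and>
      (\<forall>i. bounded (U i)) \<and> (\<Sum>i. ennreal (diam_power t (U i))) < ennreal e"
    using cover bd by blast
qed

lemma lacunary_wavelet_series_eq:
  "lacunary_wavelet_series \<psi> I \<alpha> \<xi> \<omega> = (\<lambda>x. \<Sum>j. wavelet_layer \<psi> \<alpha> (\<lambda>j. {k \<in> dyadic_indices I j. \<xi> j k \<omega>}) j x)"
proof -
  have "(\<Sum>k\<in>dyadic_indices I j. 2 powr (- \<alpha> * real j) * of_bool (\<xi> j k \<omega>) * \<psi> (2 ^ j * x - real k)) =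
    wavelet_layer \<psi> \<alpha> (\<lambda>j. {k \<in> dyadic_indices I j. \<xi> j k \<omega>}) j x" for j x
  proof -
    have "(\<Sum>k\<in>dyadic_indices I j. 2 powr (- \<alpha> * real j) * of_bool (\<xi> j k \<omega>) * \<psi> (2 ^ j * x - real k)) =
      (\<Sum>k | k \<in> dyadic_indices I j \<and> \<xi> j k \<omega>. 2 powr (- \<alpha> * real j) * of_bool (\<xi> j k \<omega>) * \<psi> (2 ^ j * x - real k))"
      by (rule sum.mono_neutral_right) auto
    also have "\<dots> = (\<Sum>k | k \<in> dyadic_indices I j \<and> \<xi> j k \<omega>. 2 powr (- \<alpha> * real j) * \<psi> (2 ^ j * x - real k))"
      by (intro sum.cong) auto
    finally show ?thesis by (simp only: wavelet_layer_def sum_distrib_left)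
  qed
  then show ?thesis by (simp only: lacunary_wavelet_series_def[abs_def])
qed

theorem theorem1p3:
  fixes I :: "real set"
    and \<alpha> \<eta> :: real
    and \<phi> \<psi> :: "real \<Rightarrow> real"
    and r :: nat
    and M :: "'w measure"
    and \<xi> :: "nat \<Rightarrow> nat \<Rightarrow> 'w \<Rightarrow> bool"
  assumes "compact I" and "I \<subseteq> {0..1}"
    and "ereal (hausdorff_dim I) = upper_box_dim I"
    and "hausdorff_dim I > 0"
    and "\<alpha> > 0"
    and "0 < \<eta>" and "\<eta> < hausdorff_dim I"
    and "smooth_wavelet_basis r \<phi> \<psi>"
    and "real r > \<alpha> * (hausdorff_dim I / \<eta>) + 1"
    and "prob_space M"
    and "lacunary_coefficients M I \<eta> \<xi>"
  shows "AE \<omega> in M. \<forall>h \<in> {\<alpha>..\<alpha> * (hausdorff_dim I / \<eta>)}.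
    hausdorff_dim {x \<in> {0..1}. holder_exponent (lacunary_wavelet_series \<psi> I \<alpha> \<xi> \<omega>) x \<le> ereal h}
      = \<eta> / \<alpha> * h"
proof -
  let ?d = "hausdorff_dim I"
  interpret lacunary_row M I \<eta> \<xi>
    using assms unfolding lacunary_row_def lacunary_row_axioms_def by auto
  have r_pos: "0 < real r" using assms by (intro less_trans[OF _ assms(9)]) (simp add: add_pos_pos)
  interpret smooth_wavelet r \<phi> \<psi>
    using assms(8) r_pos by unfold_locales auto
  have bI: "bounded I" and ub: "upper_box_dim I \<le> ereal ?d"
    using assms(1,3) compact_imp_bounded by auto
  define A where "A \<omega> j = {k \<in> dyadic_indices I j. \<xi> j k \<omega>}" for \<omega> j
  have A: "finite (A \<omega> j)" for \<omega> j by (simp add: A_def)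
  define f where "f \<omega> = lacunary_wavelet_series \<psi> I \<alpha> \<xi> \<omega>" for \<omega>
  have f: "f \<omega> = (\<lambda>x. \<Sum>j. wavelet_layer \<psi> \<alpha> (A \<omega>) j x)" for \<omega>
    unfolding f_def A_def[abs_def] by (rule lacunary_wavelet_series_eq)
  define E where "E \<omega> h = {x \<in> {0..1}. holder_exponent (f \<omega>) x \<le> ereal h}" for \<omega> h
  define L where "L \<omega> \<delta> = {x \<in> {0..1}. \<forall>J. \<exists>j\<ge>J. \<exists>k\<in>A \<omega> j. \<bar>x - real k / 2 ^ j\<bar> \<le> 2 * 2 powr (- \<delta> * real j)}" for \<omega> \<delta>
  have ae1: "AE \<omega> in M. \<forall>n::nat. \<forall>\<^sub>F j in sequentially.
      real (card (A \<omega> j)) \<le> 3 * 2 powr ((\<eta> + 1 / real (Suc n)) * real j)"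
    unfolding AE_all_countable A_def by (intro allI AE_eventually_count_le bI ub assms(6)) simp
  have ae2: "AE \<omega> in M. \<forall>\<delta>\<in>\<rat>. \<forall>t\<in>\<rat>. 0 < \<delta> \<and> \<delta> \<le> 1 \<and> 0 < t \<and> t < ?d \<and> t * \<delta> < \<eta> \<longrightarrow>
      hausdorff_measure t (L \<omega> \<delta>) \<noteq> 0"
  proof (intro AE_ball_countable[THEN iffD2] countable_rat ballI)
    fix \<delta> t :: real
    show "AE \<omega> in M. 0 < \<delta> \<and> \<delta> \<le> 1 \<and> 0 < t \<and> t < ?d \<and> t * \<delta> < \<eta> \<longrightarrow> hausdorff_measure t (L \<omega> \<delta>) \<noteq> 0"
    proof (cases "0 < \<delta> \<and> \<delta> \<le> 1 \<and> 0 < t \<and> t < ?d \<and> t * \<delta> < \<eta>")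
      case True
      then have "AE \<omega> in M. hausdorff_measure t {x \<in> {0..1}. \<forall>J. \<exists>j\<ge>J. \<exists>k\<in>dyadic_indices I j. \<xi> j k \<omega> \<and>
          \<bar>x - real k / 2 ^ j\<bar> \<le> 2 * 2 powr (- \<delta> * real j)} \<noteq> 0"
        by (intro AE_limsup_set_measure_nonzero assms(2) ub) auto
      then show ?thesis
      proof eventually_elim
        case (elim \<omega>)
        have "L \<omega> \<delta> = {x \<in> {0..1}. \<forall>J. \<exists>j\<ge>J. \<exists>k\<in>dyadic_indices I j. \<xi> j k \<omega> \<and>
          \<bar>x - real k / 2 ^ j\<bar> \<le> 2 * 2 powr (- \<delta> * real j)}"
          by (simp add: L_def A_def Bex_def conj_assoc)
        then show ?case using elim by simp
      qed
    next
      case False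
      then show ?thesis by (intro AE_I2) blast
    qed
  qed
  from ae1 ae2 show ?thesis
  proof eventually_elim
    case (elim \<omega>)
    have "hausdorff_dim (E \<omega> h) = \<eta> / \<alpha> * h" if h: "h \<in> {\<alpha>..\<alpha> * (?d / \<eta>)}" for h
    proof (rule hausdorff_dim_eqI)
      have h_pos: "0 < h" and h_ge: "\<alpha> \<le> h" and h_r: "h < real r" using h assms(5,9) by auto
      have T_le: "\<eta> / \<alpha> * h \<le> ?d"
      proof -
        have "\<eta> / \<alpha> * h \<le> \<eta> / \<alpha> * (\<alpha> * (?d / \<eta>))" using h assms(5,6) by (intro mult_left_mono) auto
        then show ?thesis using assms(5,6) by simp
      qed
      show "0 \<le> \<eta> / \<alpha> * h" using h_pos assms(5,6) by simp
      show "hausdorff_measure t (E \<omega> h) = 0" if t: "\<eta> / \<alpha> * h < t" for t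
      proof -
        have t_pos: "0 < t" using t h_pos assms(5,6) by (intro le_less_trans[OF _ t]) simp
        have "\<eta> / t < \<alpha> / h" using t t_pos h_pos assms(5) by (simp add: field_simps)
        \<comment> \<open>Above \<open>\<eta> / t\<close> the limsup set of the balls is null in
          dimension \<open>t\<close>; below \<open>\<alpha> / h\<close>, avoiding the balls forces
          an exponent larger than \<open>h\<close>.\<close>
        then obtain \<delta> where \<delta>: "\<eta> / t < \<delta>" "\<delta> < \<alpha> / h" using dense by blast
        have "\<alpha> / h \<le> 1" using h_ge h_pos by simp
        then have \<delta>1: "0 < \<delta>" "\<delta> < 1" using \<delta> t_pos assms(6) by (auto intro: less_trans[OF _ \<delta>(1)])
        have \<eta>\<delta>: "\<eta> < \<delta> * t" and h\<delta>: "h < \<alpha> / \<delta>" using \<delta> t_pos h_pos \<delta>1 by (simp_all add: field_simps)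
        obtain n where n: "1 / real (Suc n) < \<delta> * t - \<eta>"
          using reals_Archimedean[of "\<delta> * t - \<eta>"] \<eta>\<delta> by (auto simp: inverse_eq_divide)
        obtain h' where h': "h < h'" "h' < \<alpha> / \<delta>" "h' < real r"
          using dense[of h "min (\<alpha> / \<delta>) (real r)"] h\<delta> h_r by auto
        \<comment> \<open>Chosen so that the exponent
          \<open>(\<alpha> - \<kappa>) / \<delta>\<close> of \<open>holder_lower_bound\<close> is
          \<open>h'\<close>.\<close>
        define \<kappa> where "\<kappa> = \<alpha> - \<delta> * h'"
        have "\<delta> * h' > 0" using \<delta>1 h_pos h' by simp
        moreover have "\<delta> * h' < \<alpha>" using h'(2) \<delta>1 by (simp add: field_simps)
        ultimately have \<kappa>: "0 < \<kappa>" "\<kappa> < \<alpha>" "(\<alpha> - \<kappa>) / \<delta> = h'" using \<delta>1 by (auto simp: \<kappa>_def)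
        have "E \<omega> h \<subseteq> {x. \<forall>J. \<exists>j\<ge>J. \<exists>k\<in>A \<omega> j. \<bar>x - real k / 2 ^ j\<bar> \<le> 2 powr (- \<delta> * real j)}"
        proof (rule subsetI, rule ccontr)
          fix x assume x: "x \<in> E \<omega> h" "x \<notin> {x. \<forall>J. \<exists>j\<ge>J. \<exists>k\<in>A \<omega> j. \<bar>x - real k / 2 ^ j\<bar> \<le> 2 powr (- \<delta> * real j)}"
          from x(2) have "\<exists>J. \<forall>j\<ge>J. \<forall>k\<in>A \<omega> j. \<not> \<bar>x - real k / 2 ^ j\<bar> \<le> 2 powr (- \<delta> * real j)"
            by blast
          then have "\<forall>\<^sub>F j in sequentially. \<forall>k\<in>A \<omega> j. 2 powr (- \<delta> * real j) < \<bar>x - real k / 2 ^ j\<bar>"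
            unfolding eventually_sequentially not_le .
          then have "f \<omega> \<in> pointwise_holder_space h' x"
            unfolding f using holder_lower_bound[where A = "A \<omega>", OF \<psi>_smooth A \<delta>1 \<kappa>(1,2)] h'(3) unfolding \<kappa>(3) by blast
          then have "ereal h' \<le> holder_exponent (f \<omega>) x" using h_pos h'(1) by (intro holder_exponent_lower) auto
          also have "\<dots> \<le> ereal h" using x(1) by (simp add: E_def)
          finally show False using h'(1) by simp
        qed
        moreover have "hausdorff_measure t {x. \<forall>J. \<exists>j\<ge>J. \<exists>k\<in>A \<omega> j. \<bar>x - real k / 2 ^ j\<bar> \<le> 2 powr (- \<delta> * real j)} = 0"
          by (rule hausdorff_measure_limsup_balls_eq_0[OF t_pos \<delta>1(1) _ A elim(1)[rule_format, of n]]) (use n in simp)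
        ultimately show ?thesis using hausdorff_measure_nonzero_mono by blast
      qed
      show "hausdorff_measure t (E \<omega> h) \<noteq> 0" if t: "0 \<le> t" "t < \<eta> / \<alpha> * h" for t
      proof
        assume zero: "hausdorff_measure t (E \<omega> h) = 0"
        obtain t' where t': "t' \<in> \<rat>" "t < t'" "t' < \<eta> / \<alpha> * h" using Rats_dense_in_real[OF t(2)] by blast
        have t'_pos: "0 < t'" using t t' by simp
        \<comment> \<open>For \<open>h = \<alpha>\<close> the only choice is
          \<open>\<delta> = 1\<close>; otherwise there is room for a rational number strictly
          between \<open>\<alpha> / h\<close> and the two upper bounds.\<close>
        have "\<exists>\<delta>\<in>\<rat>. \<alpha> / h \<le> \<delta> \<and> \<delta> \<le> 1 \<and> t' * \<delta> < \<eta>"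
        proof (cases "h = \<alpha>")
          case True
          then show ?thesis using t' assms(5) by (intro bexI[of _ 1]) auto
        next
          case False
          have "\<alpha> / h < 1" using False h_ge h_pos by simp
          moreover have "\<alpha> / h < \<eta> / t'" using t'(3) t'_pos h_pos assms(5) by (simp add: field_simps)
          ultimately obtain \<delta> where "\<delta> \<in> \<rat>" "\<alpha> / h < \<delta>" "\<delta> < min 1 (\<eta> / t')"
            using Rats_dense_in_real[of "\<alpha> / h" "min 1 (\<eta> / t')"] by auto
          then show ?thesis using t'_pos by (intro bexI[of _ \<delta>]) (auto simp: field_simps)
        qed
        then obtain \<delta> where \<delta>: "\<delta> \<in> \<rat>" "\<alpha> / h \<le> \<delta>" "\<delta> \<le> 1" "t' * \<delta> < \<eta>" by blast
        have \<delta>_pos: "0 < \<delta>" using \<delta>(2) h_pos assms(5) by (intro less_le_trans[OF _ \<delta>(2)]) simp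
        have \<alpha>\<delta>: "\<alpha> / \<delta> \<le> h" using \<delta>(2) h_pos \<delta>_pos by (simp add: field_simps)
        have "hausdorff_measure t' (L \<omega> \<delta>) \<noteq> 0"
          using elim(2) \<delta> \<delta>_pos t' t'_pos T_le by auto
        moreover have "L \<omega> \<delta> \<subseteq> E \<omega> h"
        proof
          fix x assume x: "x \<in> L \<omega> \<delta>"
          have "holder_exponent (f \<omega>) x \<le> ereal (\<alpha> / \<delta>)"
            unfolding f using x \<alpha>\<delta> h_r
            by (intro holder_exponent_upper[where A = "A \<omega>" and K = 2] A assms(5) \<delta>_pos \<delta>(3)) (auto simp: L_def)
          also have "\<dots> \<le> ereal h" using \<alpha>\<delta> by simp
          finally show "x \<in> E \<omega> h" using x by (simp add: E_def L_def)
        qed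
        ultimately have "hausdorff_measure t' (E \<omega> h) \<noteq> 0" using hausdorff_measure_nonzero_mono by blast
        then show False using hausdorff_measure_eq_0_mono[OF zero t(1)] t'(2) by simp
      qed
    qed
    then show ?case unfolding E_def f_def by blast
  qed
qed

end
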